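(* Let $M$ be a space-like self-shrinker of dimension $n$ in $\mathbb{R}^{m+n}_m$ (with $0\in M$). Then on $M$ $$\mathcal{L}|B|^2=|B|^2+2|R^\perp|^2+2\sum_{\alpha,\beta}S_{\alpha\beta}^2+2|\nabla B|^2,$$ $$\mathcal{L}|H|^2=|H|^2+2|P|^2+2|\nabla H|^2,$$ $$\mathcal{L}(\ln w)\ge\frac{|B|^2}{w^2},$$ where $w$ is the $w$-function on $M$ with respect to a fixed space-like $n$-plane $A$.
   Context: $\mathbb{R}^{m+n}_m$ is the pseudo-Euclidean space $\mathbb{R}^{m+n}$ with the indefinite flat metric $\langle\cdot,\cdot\rangle$ given by $ds^2=\sum_{i=1}^n (dx^i)^2-\sum_{\alpha=n+1}^{m+n}(dx^\alpha)^2$. Indices $i,j,k$ run over $1,\dots,n$ and $\alpha,\beta$ over $n+1,\dots,m+n$. A space-like $n$-dimensional submanifold $F:M\to\mathbb{R}^{m+n}_m$ (smooth; $F$ is the position vector) is one whose induced metric is positive definite (Riemannian). Let $\bar\nabla$ be the flat connection of $\mathbb{R}^{m+n}_m$, and $(\cdot)^T,(\cdot)^N$ the orthogonal projections onto the tangent bundle $TM$ and the normal bundle $NM$; the metric on $NM$ is negative definite. The second fundamental form is $B_{XY}=(\bar\nabla_XY)^N$ for tangent fields $X,Y$, and the mean curvature vector is $H=\sum_i B_{e_ie_i}$. $M$ is a space-like self-shrinker if $H=-\frac{1}{2}F^N$ on $M$. The origin $0$ of $\mathbb{R}^{m+n}_m$ is assumed to lie on $M$. Let $\{e_i\}$ be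 a local orthonormal (space-like) tangent frame and $\{e_\alpha\}$ a local orthonormal (time-like, $\langle e_\alpha,e_\beta\rangle=-\delta_{\alpha\beta}$) normal frame. Write $B_{ij}=B_{e_ie_j}=\sum_\alpha h_{ij}^\alpha e_\alpha$ and - $S_{\alpha\beta}=\sum_{i,j}h_{ij}^\alpha h_{ij}^\beta$; - $|B|^2=-\langle B,B\rangle=\sum_{i,j,\alpha}(h_{ij}^\alpha)^2$, $|\nabla B|^2=-\langle\nabla B,\nabla B\rangle$, where $\nabla B$ is the covariant derivative of $B$ as a section of $\mathrm{Hom}(\odot^2TM,NM)$ for the connection induced from those of $TM$ and $NM$; - $|H|^2=-\langle H,H\rangle$, $|\nabla H|^2=-\langle\nabla H,\nabla H\rangle$, with $\nabla H$ the normal covariant derivative; - $P_{ij}=\langle B_{ij},H\rangle$ and $|P|^2=\sum_{i,j}P_{ij}^2$; - $|R^\perp|^2=-\sum_{i,j,\alpha}\langle R_{e_ie_j}e_\alpha,R_{e_ie_j}e_\alpha\rangle$, where $R_{e_ie_j}$ here is the curvature of the normal bundle. The drift Laplacian is $\mathcal{L}=\Delta-\frac12\langle F,\nabla(\cdot)\rangle=e^{z/4}\,\mathrm{div}(e^{-z/4}\nabla(\cdot))$, where $z=\langle F,F\rangle$ and $\Delta,\nabla,\mathrm{div}$ are those of the induced metric on $M$. The $w$-function: fix a space-like $n$-dimensional linear subspace $A\subset\mathbb{R}^{m+n}_m$ with orthonormal basis $a_1,\dots,a_n$. For $x\in M$ and an orthonormal basis $e_1,\dots,e_n$ of $T_xM$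 (translated to the origin), set $w(x)=\langle e_1\wedge\cdots\wedge e_n,\,a_1\wedge\cdots\wedge a_n\rangle=\det(\langle e_i,a_j\rangle)$, with orientation chosen so that $w>0$; then automatically $w\ge1$. *)

theory Defs
  imports "HOL-Analysis.Analysis"
begin

section \<open>Smooth maps and smooth manifolds\<close>

text \<open>Iterated differentiability; meant for open sets \<open>S\<close>.\<close>

fun k_times_differentiable_on ::
    "nat \<Rightarrow> 'a::real_normed_vector set \<Rightarrow> ('a \<Rightarrow> 'b::real_normed_vector) \<Rightarrow> bool" where
  "k_times_differentiable_on 0 S f \<longleftrightarrow> continuous_on S f"
| "k_times_differentiable_on (Suc k) S f \<longleftrightarrow>
     (\<forall>x\<in>S. f differentiable (at x)) \<and>
     (\<forall>v. k_times_differentiable_on k S (\<lambda>x. frechet_derivative f (at x) v))"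

definition smooth_on ::
    "'a::real_normed_vector set \<Rightarrow> ('a \<Rightarrow> 'b::real_normed_vector) \<Rightarrow> bool" where
  "smooth_on S f \<longleftrightarrow> (\<forall>k. k_times_differentiable_on k S f)"

text \<open>The manifold \<open>M\<close> is the whole type \<open>'p\<close>.  A chart is a pair of an open domain
  \<open>U\<close> and a coordinate map \<open>\<phi>\<close>, of which only the values on \<open>U\<close> matter.\<close>

type_synonym ('p, 'n) atlas = "('p set \<times> ('p \<Rightarrow> (real, 'n) vec)) set"

definition smooth_atlas ::
    "('p::{t2_space, second_countable_topology}, 'n::finite) atlas \<Rightarrow> bool" where
  "smooth_atlas \<A> \<longleftrightarrow>
     (\<Union>(U, \<phi>)\<in>\<A>. U) = UNIV \<and>
     (\<forall>(U, \<phi>)\<in>\<A>. open U \<and> open (\<phi> ` U) \<and> homeomorphism U (\<phi> ` U) \<phi> (inv_into U \<phi>)) \<and>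
     (\<forall>(U, \<phi>)\<in>\<A>. \<forall>(V, \<psi>)\<in>\<A>. smooth_on (\<phi> ` (U \<inter> V)) (\<psi> \<circ> inv_into U \<phi>))"

text \<open>The differential of a vector-valued map \<open>f\<close> on \<open>M\<close> at \<open>p\<close>, expressed in some chart
  around \<open>p\<close>.  By the chain rule, the tangent spaces and directional derivatives derived from
  it below do not depend on the chart.\<close>

definition chart_at :: "('p, 'n::finite) atlas \<Rightarrow> 'p \<Rightarrow> 'p set \<times> ('p \<Rightarrow> real ^ 'n)" where
  "chart_at \<A> p = (SOME c. c \<in> \<A> \<and> p \<in> fst c)"

definition differential ::
    "('p, 'n::finite) atlas \<Rightarrow> ('p \<Rightarrow> 'b::real_normed_vector) \<Rightarrow> 'p \<Rightarrow> real ^ 'n \<Rightarrow> 'b" where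
  "differential \<A> f p =
     (case chart_at \<A> p of (U, \<phi>) \<Rightarrow> frechet_derivative (f \<circ> inv_into U \<phi>) (at (\<phi> p)))"

section \<open>Pseudo-Euclidean space and space-like submanifolds\<close>

text \<open>The pseudo-Euclidean space of dimension \<open>m + n\<close> and index \<open>m\<close> is
  \<open>(real ^ 'n) \<times> (real ^ 'm)\<close>, with \<open>n = CARD('n)\<close> and \<open>m = CARD('m)\<close>; the first factor carries the
  positive directions.\<close>

type_synonym ('n, 'm) pseudo_space = "(real, 'n) vec \<times> (real, 'm) vec"
type_synonym ('p, 'n, 'm) amb_map = "'p \<Rightarrow> ('n, 'm) pseudo_space"

definition pinner :: "('n::finite, 'm::finite) pseudo_space \<Rightarrow> ('n, 'm) pseudo_space \<Rightarrow> real" where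
  "pinner x y = inner (fst x) (fst y) - inner (snd x) (snd y)"

definition spacelike_on :: "('n::finite, 'm::finite) pseudo_space set \<Rightarrow> bool" where
  "spacelike_on S \<longleftrightarrow> (\<forall>v\<in>S. v \<noteq> 0 \<longrightarrow> pinner v v > 0)"

text \<open>Orthonormal basis \<open>e\<close> of \<open>S\<close> whose vectors all have square \<open>c\<close>: \<open>c = 1\<close> for space-like and
  \<open>c = -1\<close> for time-like bases.\<close>

definition orthonormal_basis ::
    "real \<Rightarrow> ('n::finite, 'm::finite) pseudo_space set \<Rightarrow> ('i \<Rightarrow> ('n, 'm) pseudo_space) \<Rightarrow> bool" where
  "orthonormal_basis c S e \<longleftrightarrow>
     (\<forall>i j. pinner (e i) (e j) = (if i = j then c else 0)) \<and> span (range e) = S"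

text \<open>Since \<open>F\<close> is only required to be an immersion, embedded submanifolds are a special case.
  The last condition says that the induced metric is positive definite; it implies that the
  differential of \<open>F\<close> is injective.\<close>

definition spacelike_submanifold ::
    "('p::{t2_space, second_countable_topology}, 'n::finite) atlas \<Rightarrow>
     ('p, 'n, 'm::finite) amb_map \<Rightarrow> bool" where
  "spacelike_submanifold \<A> F \<longleftrightarrow>
     smooth_atlas \<A> \<and>
     (\<forall>(U, \<phi>)\<in>\<A>. smooth_on (\<phi> ` U) (F \<circ> inv_into U \<phi>)) \<and>
     (\<forall>p \<xi>. \<xi> \<noteq> 0 \<longrightarrow> pinner (differential \<A> F p \<xi>) (differential \<A> F p \<xi>) > 0)"

text \<open>Tangent and normal vectors are vectors of the ambient space; tangent and normal fields
  are maps from \<open>M\<close> to the ambient space.\<close>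

definition tangent_space ::
    "('p, 'n::finite) atlas \<Rightarrow> ('p, 'n, 'm::finite) amb_map \<Rightarrow> 'p \<Rightarrow> ('n, 'm) pseudo_space set" where
  "tangent_space \<A> F p = range (differential \<A> F p)"

definition normal_space ::
    "('p, 'n::finite) atlas \<Rightarrow> ('p, 'n, 'm::finite) amb_map \<Rightarrow> 'p \<Rightarrow> ('n, 'm) pseudo_space set" where
  "normal_space \<A> F p = {v. \<forall>u\<in>tangent_space \<A> F p. pinner v u = 0}"

definition tan_proj ::
    "('p, 'n::finite) atlas \<Rightarrow> ('p, 'n, 'm::finite) amb_map \<Rightarrow> 'p \<Rightarrow>
     ('n, 'm) pseudo_space \<Rightarrow> ('n, 'm) pseudo_space" where
  "tan_proj \<A> F p v = (THE t. t \<in> tangent_space \<A> F p \<and> v - t \<in> normal_space \<A> F p)"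

definition nor_proj ::
    "('p, 'n::finite) atlas \<Rightarrow> ('p, 'n, 'm::finite) amb_map \<Rightarrow> 'p \<Rightarrow>
     ('n, 'm) pseudo_space \<Rightarrow> ('n, 'm) pseudo_space" where
  "nor_proj \<A> F p v = v - tan_proj \<A> F p v"

text \<open>Orthonormal bases at a single point.  All quantities below that use them are independent
  of the choice, which is not assumed to vary smoothly with \<open>p\<close>.\<close>

definition tan_frame ::
    "('p, 'n::finite) atlas \<Rightarrow> ('p, 'n, 'm::finite) amb_map \<Rightarrow> 'p \<Rightarrow> 'n \<Rightarrow> ('n, 'm) pseudo_space" where
  "tan_frame \<A> F p = (SOME e. orthonormal_basis 1 (tangent_space \<A> F p) e)"

definition nor_frame ::
    "('p, 'n::finite) atlas \<Rightarrow> ('p, 'n, 'm::finite) amb_map \<Rightarrow> 'p \<Rightarrow> 'm \<Rightarrow> ('n, 'm) pseudo_space" where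
  "nor_frame \<A> F p = (SOME \<nu>. orthonormal_basis (-1) (normal_space \<A> F p) \<nu>)"

section \<open>Connections and curvature quantities\<close>

text \<open>Derivative of \<open>f\<close> at \<open>p\<close> in the direction of the tangent vector
  \<open>v \<in> tangent_space \<A> F p\<close>; for \<open>f\<close> with values in the ambient space this is the flat
  connection.\<close>

definition dir_deriv ::
    "('p, 'n::finite) atlas \<Rightarrow> ('p, 'n, 'm::finite) amb_map \<Rightarrow> 'p \<Rightarrow> ('n, 'm) pseudo_space \<Rightarrow>
     ('p \<Rightarrow> 'b::real_normed_vector) \<Rightarrow> 'b" where
  "dir_deriv \<A> F p v f = differential \<A> f p (THE \<xi>. differential \<A> F p \<xi> = v)"

definition flat_conn ::
    "('p, 'n::finite) atlas \<Rightarrow> ('p, 'n, 'm::finite) amb_map \<Rightarrow>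
     ('p, 'n, 'm) amb_map \<Rightarrow> ('p, 'n, 'm) amb_map \<Rightarrow> 'p \<Rightarrow> ('n, 'm) pseudo_space" where
  "flat_conn \<A> F X Y p = dir_deriv \<A> F p (X p) Y"

definition tan_conn ::
    "('p, 'n::finite) atlas \<Rightarrow> ('p, 'n, 'm::finite) amb_map \<Rightarrow>
     ('p, 'n, 'm) amb_map \<Rightarrow> ('p, 'n, 'm) amb_map \<Rightarrow> 'p \<Rightarrow> ('n, 'm) pseudo_space" where
  "tan_conn \<A> F X Y p = tan_proj \<A> F p (flat_conn \<A> F X Y p)"

definition nor_conn ::
    "('p, 'n::finite) atlas \<Rightarrow> ('p, 'n, 'm::finite) amb_map \<Rightarrow>
     ('p, 'n, 'm) amb_map \<Rightarrow> ('p, 'n, 'm) amb_map \<Rightarrow> 'p \<Rightarrow> ('n, 'm) pseudo_space" where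
  "nor_conn \<A> F X \<nu> p = nor_proj \<A> F p (flat_conn \<A> F X \<nu> p)"

definition second_ff ::
    "('p, 'n::finite) atlas \<Rightarrow> ('p, 'n, 'm::finite) amb_map \<Rightarrow>
     ('p, 'n, 'm) amb_map \<Rightarrow> ('p, 'n, 'm) amb_map \<Rightarrow> 'p \<Rightarrow> ('n, 'm) pseudo_space" where
  "second_ff \<A> F X Y p = nor_proj \<A> F p (flat_conn \<A> F X Y p)"

text \<open>In \<open>flat_conn\<close>, \<open>tan_conn\<close> and \<open>nor_conn\<close> the first field is the direction of
  differentiation.  Accordingly \<open>nabla_second_ff \<A> F Z X Y\<close> is \<open>(\<nabla>\<^sub>Z B)(X, Y)\<close>.\<close>

definition nabla_second_ff ::
    "('p, 'n::finite) atlas \<Rightarrow> ('p, 'n, 'm::finite) amb_map \<Rightarrow>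
     ('p, 'n, 'm) amb_map \<Rightarrow> ('p, 'n, 'm) amb_map \<Rightarrow> ('p, 'n, 'm) amb_map \<Rightarrow>
     'p \<Rightarrow> ('n, 'm) pseudo_space" where
  "nabla_second_ff \<A> F Z X Y p =
     nor_conn \<A> F Z (second_ff \<A> F X Y) p
     - second_ff \<A> F (tan_conn \<A> F Z X) Y p
     - second_ff \<A> F X (tan_conn \<A> F Z Y) p"

text \<open>The Lie bracket of tangent fields, pushed forward by \<open>F\<close>: the flat connection has no
  torsion.\<close>

definition lie_bracket ::
    "('p, 'n::finite) atlas \<Rightarrow> ('p, 'n, 'm::finite) amb_map \<Rightarrow>
     ('p, 'n, 'm) amb_map \<Rightarrow> ('p, 'n, 'm) amb_map \<Rightarrow> 'p \<Rightarrow> ('n, 'm) pseudo_space" where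
  "lie_bracket \<A> F X Y p = flat_conn \<A> F X Y p - flat_conn \<A> F Y X p"

definition nor_curvature ::
    "('p, 'n::finite) atlas \<Rightarrow> ('p, 'n, 'm::finite) amb_map \<Rightarrow>
     ('p, 'n, 'm) amb_map \<Rightarrow> ('p, 'n, 'm) amb_map \<Rightarrow> ('p, 'n, 'm) amb_map \<Rightarrow>
     'p \<Rightarrow> ('n, 'm) pseudo_space" where
  "nor_curvature \<A> F X Y \<nu> p =
     nor_conn \<A> F X (nor_conn \<A> F Y \<nu>) p
     - nor_conn \<A> F Y (nor_conn \<A> F X \<nu>) p
     - nor_conn \<A> F (lie_bracket \<A> F X Y) \<nu> p"

text \<open>To evaluate these tensors on vectors at a point \<open>p\<close>, the vectors have to be extended to
  smooth fields.  Projecting a constant vector to each tangent (normal) space gives a smooth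
  tangent (normal) field on all of \<open>M\<close>, with the prescribed value at \<open>p\<close> if the vector is tangent
  (normal) there.  The values of the tensors do not depend on the extension.\<close>

definition tan_ext ::
    "('p, 'n::finite) atlas \<Rightarrow> ('p, 'n, 'm::finite) amb_map \<Rightarrow>
     ('n, 'm) pseudo_space \<Rightarrow> 'p \<Rightarrow> ('n, 'm) pseudo_space" where
  "tan_ext \<A> F v = (\<lambda>q. tan_proj \<A> F q v)"

definition nor_ext ::
    "('p, 'n::finite) atlas \<Rightarrow> ('p, 'n, 'm::finite) amb_map \<Rightarrow>
     ('n, 'm) pseudo_space \<Rightarrow> 'p \<Rightarrow> ('n, 'm) pseudo_space" where
  "nor_ext \<A> F v = (\<lambda>q. nor_proj \<A> F q v)"

definition B_frame ::
    "('p, 'n::finite) atlas \<Rightarrow> ('p, 'n, 'm::finite) amb_map \<Rightarrow> 'p \<Rightarrow> 'n \<Rightarrow> 'n \<Rightarrow> ('n, 'm) pseudo_space" where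
  "B_frame \<A> F p i j =
     second_ff \<A> F (tan_ext \<A> F (tan_frame \<A> F p i)) (tan_ext \<A> F (tan_frame \<A> F p j)) p"

definition mean_curvature ::
    "('p, 'n::finite) atlas \<Rightarrow> ('p, 'n, 'm::finite) amb_map \<Rightarrow> 'p \<Rightarrow> ('n, 'm) pseudo_space" where
  "mean_curvature \<A> F p = (\<Sum>i\<in>UNIV. B_frame \<A> F p i i)"

definition spacelike_self_shrinker ::
    "('p::{t2_space, second_countable_topology}, 'n::finite) atlas \<Rightarrow>
     ('p, 'n, 'm::finite) amb_map \<Rightarrow> bool" where
  "spacelike_self_shrinker \<A> F \<longleftrightarrow>
     spacelike_submanifold \<A> F \<and>
     (\<forall>p. mean_curvature \<A> F p = - (1 / 2) *\<^sub>R nor_proj \<A> F p (F p))"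

text \<open>The coefficients in \<open>B\<^sub>i\<^sub>j = (\<Sum>\<alpha>. h\<^sub>i\<^sub>j\<^sup>\<alpha> e\<^sub>\<alpha>)\<close>; the sign comes from the time-like
  normalization of the \<open>e\<^sub>\<alpha>\<close>.\<close>

definition h_coeff ::
    "('p, 'n::finite) atlas \<Rightarrow> ('p, 'n, 'm::finite) amb_map \<Rightarrow> 'p \<Rightarrow> 'm \<Rightarrow> 'n \<Rightarrow> 'n \<Rightarrow> real" where
  "h_coeff \<A> F p \<alpha> i j = - pinner (B_frame \<A> F p i j) (nor_frame \<A> F p \<alpha>)"

definition S_coeff ::
    "('p, 'n::finite) atlas \<Rightarrow> ('p, 'n, 'm::finite) amb_map \<Rightarrow> 'p \<Rightarrow> 'm \<Rightarrow> 'm \<Rightarrow> real" where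
  "S_coeff \<A> F p \<alpha> \<beta> = (\<Sum>i\<in>UNIV. \<Sum>j\<in>UNIV. h_coeff \<A> F p \<alpha> i j * h_coeff \<A> F p \<beta> i j)"

definition P_coeff ::
    "('p, 'n::finite) atlas \<Rightarrow> ('p, 'n, 'm::finite) amb_map \<Rightarrow> 'p \<Rightarrow> 'n \<Rightarrow> 'n \<Rightarrow> real" where
  "P_coeff \<A> F p i j = pinner (B_frame \<A> F p i j) (mean_curvature \<A> F p)"

definition normsq_B ::
    "('p, 'n::finite) atlas \<Rightarrow> ('p, 'n, 'm::finite) amb_map \<Rightarrow> 'p \<Rightarrow> real" where
  "normsq_B \<A> F p = - (\<Sum>i\<in>UNIV. \<Sum>j\<in>UNIV. pinner (B_frame \<A> F p i j) (B_frame \<A> F p i j))"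

definition normsq_nabla_B ::
    "('p, 'n::finite) atlas \<Rightarrow> ('p, 'n, 'm::finite) amb_map \<Rightarrow> 'p \<Rightarrow> real" where
  "normsq_nabla_B \<A> F p =
     - (\<Sum>k\<in>UNIV. \<Sum>i\<in>UNIV. \<Sum>j\<in>UNIV.
          (let e = (\<lambda>l. tan_ext \<A> F (tan_frame \<A> F p l));
               v = nabla_second_ff \<A> F (e k) (e i) (e j) p
           in pinner v v))"

definition normsq_H ::
    "('p, 'n::finite) atlas \<Rightarrow> ('p, 'n, 'm::finite) amb_map \<Rightarrow> 'p \<Rightarrow> real" where
  "normsq_H \<A> F p = - pinner (mean_curvature \<A> F p) (mean_curvature \<A> F p)"

definition normsq_nabla_H ::
    "('p, 'n::finite) atlas \<Rightarrow> ('p, 'n, 'm::finite) amb_map \<Rightarrow> 'p \<Rightarrow> real" where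
  "normsq_nabla_H \<A> F p =
     - (\<Sum>k\<in>UNIV.
          (let v = nor_conn \<A> F (tan_ext \<A> F (tan_frame \<A> F p k)) (mean_curvature \<A> F) p
           in pinner v v))"

definition normsq_P ::
    "('p, 'n::finite) atlas \<Rightarrow> ('p, 'n, 'm::finite) amb_map \<Rightarrow> 'p \<Rightarrow> real" where
  "normsq_P \<A> F p = (\<Sum>i\<in>UNIV. \<Sum>j\<in>UNIV. (P_coeff \<A> F p i j)\<^sup>2)"

definition normsq_R_perp ::
    "('p, 'n::finite) atlas \<Rightarrow> ('p, 'n, 'm::finite) amb_map \<Rightarrow> 'p \<Rightarrow> real" where
  "normsq_R_perp \<A> F p =
     - (\<Sum>i\<in>UNIV. \<Sum>j\<in>UNIV. \<Sum>\<alpha>\<in>UNIV.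
          (let e = (\<lambda>l. tan_ext \<A> F (tan_frame \<A> F p l));
               v = nor_curvature \<A> F (e i) (e j) (nor_ext \<A> F (nor_frame \<A> F p \<alpha>)) p
           in pinner v v))"

section \<open>The drift Laplacian and the w-function\<close>

definition gradient ::
    "('p, 'n::finite) atlas \<Rightarrow> ('p, 'n, 'm::finite) amb_map \<Rightarrow> ('p \<Rightarrow> real) \<Rightarrow>
     'p \<Rightarrow> ('n, 'm) pseudo_space" where
  "gradient \<A> F f p =
     (THE v. v \<in> tangent_space \<A> F p \<and>
             (\<forall>u\<in>tangent_space \<A> F p. pinner v u = dir_deriv \<A> F p u f))"

definition divergence ::
    "('p, 'n::finite) atlas \<Rightarrow> ('p, 'n, 'm::finite) amb_map \<Rightarrow> ('p, 'n, 'm) amb_map \<Rightarrow>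
     'p \<Rightarrow> real" where
  "divergence \<A> F X p =
     (\<Sum>i\<in>UNIV. pinner (tan_conn \<A> F (tan_ext \<A> F (tan_frame \<A> F p i)) X p) (tan_frame \<A> F p i))"

definition drift_laplacian ::
    "('p, 'n::finite) atlas \<Rightarrow> ('p, 'n, 'm::finite) amb_map \<Rightarrow> ('p \<Rightarrow> real) \<Rightarrow> 'p \<Rightarrow> real" where
  "drift_laplacian \<A> F f p =
     divergence \<A> F (gradient \<A> F f) p - (1 / 2) * pinner (F p) (gradient \<A> F f p)"

text \<open>The determinants for different orthonormal bases of the tangent space differ only by sign;
  the orientation is the one that makes the value positive.\<close>

definition w_function ::
    "('p, 'n::finite) atlas \<Rightarrow> ('p, 'n, 'm::finite) amb_map \<Rightarrow> ('n \<Rightarrow> ('n, 'm) pseudo_space) \<Rightarrow>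
     'p \<Rightarrow> real" where
  "w_function \<A> F a p =
     (THE r. r > 0 \<and>
        (\<exists>e :: 'n \<Rightarrow> ('n, 'm) pseudo_space. orthonormal_basis 1 (tangent_space \<A> F p) e \<and>
             r = det (\<chi> i j. pinner (e i) (a j))))"

end

theory Submission
  imports Defs
begin

text \<open>
  Let \<open>T\<close> be the function on \<open>M\<close> whose value at \<open>p\<close> is the orthogonal projection of the ambient
  space onto the tangent space at \<open>p\<close>, a linear endomorphism of the ambient space. Its derivative
  \<open>D v T\<close> contains the second fundamental form: it maps a tangent vector \<open>w\<close> to the normal vector
  \<open>B(v, w)\<close>, and it is self-adjoint, so on normal vectors it is the shape operator.
  Differentiating \<open>T T = T\<close> and \<open>D v F = T v\<close>, together with the symmetry of second derivatives,
  replaces the equations of Gauss, Codazzi and Ricci; no moving frame has to be chosen. Constant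
  ambient vectors \<open>v\<close>, projected to the tangent spaces, provide global derivations \<open>D v\<close>, and the
  Laplacian of \<open>f\<close> is the trace of \<open>D v (D w f)\<close>.

  The mean curvature vector is \<open>H = \<Delta> F\<close>, and the shrinker equation \<open>H = - F\<^sup>N / 2\<close> gives
  \<open>D v H = (D v T) F / 2\<close> (\<open>D_mc\<close>). By Codazzi, the part of \<open>\<Delta> T\<close> that interchanges tangent and
  normal vectors is the normal derivative of \<open>H\<close>, and the drift term cancels it: the Gauss map is
  harmonic for the weighted measure. The rest of \<open>\<L> T\<close> is forced by \<open>T T = T\<close>, so that
  \<open>\<L> T = 2 Q - 4 Q T\<close> with \<open>Q = \<Sum>\<^sub>i (D e\<^sub>i T) (D e\<^sub>i T)\<close> (\<open>drift_lap_T\<close>). All three formulas are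
  consequences.

  For \<open>H\<close>, applying \<open>\<L>\<close> to \<open>H = (T F - F) / 2\<close> expresses \<open>\<L> H\<close> through \<open>\<L> T\<close>, and the product rule
  gives \<open>\<L> |H|\<^sup>2\<close>.

  For \<open>B\<close>, \<open>|B|\<^sup>2 = - tr Q / 2\<close>, and \<open>\<L> |B|\<^sup>2\<close> is a Bochner formula for \<open>T\<close>. The commutator of \<open>\<L>\<close>
  with \<open>D e\<^sub>i\<close> (\<open>drift_lap_D\<close>) contains the Ricci curvature, whose mean curvature part is cancelled
  by the derivative of the drift. What remains are traces of products of four second fundamental
  forms. With \<open>b\<^sub>i\<^sub>j\<^sub>k\<^sub>l = \<langle>B\<^sub>i\<^sub>j, B\<^sub>k\<^sub>l\<rangle>\<close> they are combinations of three complete contractions of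
  \<open>b \<otimes> b\<close>, and so are \<open>|R\<^sup>\<bottom>|\<^sup>2\<close> and \<open>\<Sum> S\<^sub>\<alpha>\<^sub>\<beta>\<^sup>2\<close>; comparing coefficients proves the formula.

  For \<open>w\<close>, \<open>w\<^sup>2\<close> is the determinant of the matrix \<open>\<langle>T a\<^sub>i, a\<^sub>j\<rangle>\<close>. Near \<open>p\<close>, replace \<open>a\<close> by the basis
  \<open>b\<^sub>i = e\<^sub>i + n\<^sub>i\<close> of the same plane whose tangential parts are the orthonormal frame \<open>e\<close> at \<open>p\<close>;
  this changes \<open>ln w\<close> by a constant and makes the matrix the identity at \<open>p\<close>. The second order
  expansion of the determinant there gives \<open>\<L> ln w = |B|\<^sup>2 - \<Sum> \<langle>B\<^sub>k\<^sub>i, n\<^sub>l\<rangle> \<langle>B\<^sub>k\<^sub>l, n\<^sub>i\<rangle>\<close>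
  (\<open>drift_lap_ln_det\<close>). The change of basis is a contraction \<open>X\<close> with \<open>det X = \<plusminus> 1 / w\<close>, and a
  contraction shrinks no vector by more than its determinant (\<open>det_contraction_le\<close>), which bounds
  the \<open>n\<^sub>i\<close> and hence the last sum by \<open>(1 - 1 / w\<^sup>2) |B|\<^sup>2\<close>.
\<close>

section \<open>Smooth functions on open sets\<close>

lemma differentiable_transform_open:
  assumes "open S" "x \<in> S" "\<And>y. y \<in> S \<Longrightarrow> f y = g y" "f differentiable (at x)"
  shows "g differentiable (at x)" and "frechet_derivative g (at x) = frechet_derivative f (at x)"
proof -
  have "(f has_derivative frechet_derivative f (at x)) (at x)"
    using assms(4) frechet_derivative_works by blast
  then have *: "(g has_derivative frechet_derivative f (at x)) (at x)"
    by (rule has_derivative_transform_within_open[OF _ assms(1,2)]) (use assms(3) in auto)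
  then show "g differentiable (at x)" by (auto simp: differentiable_def)
  show "frechet_derivative g (at x) = frechet_derivative f (at x)"
    using frechet_derivative_at[OF *] by simp
qed

lemma k_times_differentiable_on_cong:
  assumes "open S" "\<And>x. x \<in> S \<Longrightarrow> f x = g x" "k_times_differentiable_on k S f"
  shows "k_times_differentiable_on k S g"
  using assms(2,3)
proof (induction k arbitrary: f g)
  case 0
  then show ?case using continuous_on_cong by fastforce
next
  case (Suc k)
  have d: "\<And>x. x \<in> S \<Longrightarrow> f differentiable (at x)" using Suc.prems by auto
  have "\<And>x. x \<in> S \<Longrightarrow> g differentiable (at x)"
    using differentiable_transform_open(1)[OF assms(1)] Suc.prems(1) d by metis
  moreover have "k_times_differentiable_on k S (\<lambda>x. frechet_derivative g (at x) v)" for v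
  proof (rule Suc.IH)
    show "k_times_differentiable_on k S (\<lambda>x. frechet_derivative f (at x) v)" using Suc.prems by auto
    show "frechet_derivative f (at x) v = frechet_derivative g (at x) v" if "x \<in> S" for x
      using differentiable_transform_open(2)[OF assms(1) that Suc.prems(1) d[OF that]] by simp
  qed
  ultimately show ?case by simp
qed

lemma k_times_differentiable_on_SucD:
  "k_times_differentiable_on (Suc k) S f \<Longrightarrow> k_times_differentiable_on k S f"
proof (induction k arbitrary: f)
  case 0
  then show ?case
    by (auto simp: intro!: continuous_at_imp_continuous_on differentiable_imp_continuous_within)
next
  case (Suc k)
  then show ?case by (metis k_times_differentiable_on.simps(2))
qed

lemma k_times_differentiable_on_const: "k_times_differentiable_on k S (\<lambda>x. c)"
  by (induction k arbitrary: c) auto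

lemma k_times_differentiable_on_add:
  assumes "open S" "k_times_differentiable_on k S f" "k_times_differentiable_on k S g"
  shows "k_times_differentiable_on k S (\<lambda>x. f x + g x)"
  using assms(2,3)
proof (induction k arbitrary: f g)
  case 0
  then show ?case by (auto intro: continuous_intros)
next
  case (Suc k)
  have "k_times_differentiable_on k S (\<lambda>x. frechet_derivative (\<lambda>x. f x + g x) (at x) v)" for v
  proof (rule k_times_differentiable_on_cong[OF assms(1)])
    show "k_times_differentiable_on k S (\<lambda>x. frechet_derivative f (at x) v + frechet_derivative g (at x)
        v)"
      using Suc by auto
    show "frechet_derivative f (at x) v + frechet_derivative g (at x) v
        = frechet_derivative (\<lambda>x. f x + g x) (at x) v" if "x \<in> S" for x
    proof -
      have "((\<lambda>x. f x + g x) has_derivative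
         (\<lambda>v. frechet_derivative f (at x) v + frechet_derivative g (at x) v)) (at x)"
        using Suc.prems that by (auto intro!: has_derivative_add simp:
            frechet_derivative_works[symmetric])
      from frechet_derivative_at[OF this] show ?thesis by metis
    qed
  qed
  then show ?case using Suc.prems by (auto intro: differentiable_add)
qed

lemma k_times_differentiable_on_linear:
  assumes "open S" "bounded_linear L" "k_times_differentiable_on k S f"
  shows "k_times_differentiable_on k S (\<lambda>x. L (f x))"
  using assms(3)
proof (induction k arbitrary: f)
  case 0
  then show ?case using assms(2) by (auto intro: bounded_linear.continuous_on)
next
  case (Suc k)
  have hd: "((\<lambda>x. L (f x)) has_derivative (\<lambda>v. L (frechet_derivative f (at x) v))) (at x)" if "x \<in> S" for
      x
    using Suc.prems that by (intro bounded_linear.has_derivative[OF assms(2)]) (auto simp: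
        frechet_derivative_works[symmetric])
  have "k_times_differentiable_on k S (\<lambda>x. frechet_derivative (\<lambda>x. L (f x)) (at x) v)" for v
  proof (rule k_times_differentiable_on_cong[OF assms(1)])
    show "k_times_differentiable_on k S (\<lambda>x. L (frechet_derivative f (at x) v))" using Suc by auto
    show "L (frechet_derivative f (at x) v) = frechet_derivative (\<lambda>x. L (f x)) (at x) v"
      if "x \<in> S" for x using frechet_derivative_at[OF hd[OF that]] by metis
  qed
  then show ?case using hd by (auto simp: differentiable_def)
qed

lemma k_times_differentiable_on_bilinear:
  assumes "open S" "bounded_bilinear bop" "k_times_differentiable_on k S f" "k_times_differentiable_on k S
      g"
  shows "k_times_differentiable_on k S (\<lambda>x. bop (f x) (g x))"
  using assms(3,4)
proof (induction k arbitrary: f g)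
  case 0
  then show ?case using assms(2) by (auto intro: bounded_bilinear.continuous_on)
next
  case (Suc k)
  have hd: "((\<lambda>x. bop (f x) (g x)) has_derivative
      (\<lambda>v. bop (f x) (frechet_derivative g (at x) v) + bop (frechet_derivative f (at x) v) (g x))) (at x)"
    if "x \<in> S" for x
    using Suc.prems that by (intro bounded_bilinear.FDERIV[OF assms(2)]) (auto simp:
        frechet_derivative_works[symmetric])
  have "k_times_differentiable_on k S (\<lambda>x. frechet_derivative (\<lambda>x. bop (f x) (g x)) (at x) v)" for v
  proof (rule k_times_differentiable_on_cong[OF assms(1)])
    show "k_times_differentiable_on k S
       (\<lambda>x. bop (f x) (frechet_derivative g (at x) v) + bop (frechet_derivative f (at x) v) (g x))"
      using Suc.prems Suc.prems[THEN k_times_differentiable_on_SucD]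
      by (auto intro!: k_times_differentiable_on_add[OF assms(1)] Suc.IH)
    show "bop (f x) (frechet_derivative g (at x) v) + bop (frechet_derivative f (at x) v) (g x)
       = frechet_derivative (\<lambda>x. bop (f x) (g x)) (at x) v"
      if "x \<in> S" for x using frechet_derivative_at[OF hd[OF that]] by metis
  qed
  then show ?case using hd by (auto simp: differentiable_def)
qed

text \<open>The derivative of \<open>1 / f\<close> is a product of \<open>1 / f\<close> with derivatives of \<open>f\<close>, so one order
  follows from the previous one.\<close>

lemma k_times_differentiable_on_inverse:
  fixes f :: "'a::real_normed_vector \<Rightarrow> real"
  assumes "open S" "\<And>x. x \<in> S \<Longrightarrow> f x \<noteq> 0" "k_times_differentiable_on k S f"
  shows "k_times_differentiable_on k S (\<lambda>x. inverse (f x))"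
  using assms(3)
proof (induction k)
  case 0
  then show ?case using assms(2) by (auto intro: continuous_intros)
next
  case (Suc k)
  have hd: "((\<lambda>x. inverse (f x)) has_derivative
      (\<lambda>v. - (inverse (f x) * frechet_derivative f (at x) v * inverse (f x)))) (at x)"
    if "x \<in> S" for x
    using Suc.prems that assms(2)[OF that] by (auto intro!: has_derivative_inverse simp:
        frechet_derivative_works[symmetric])
  have "k_times_differentiable_on k S (\<lambda>x. frechet_derivative (\<lambda>x. inverse (f x)) (at x) v)" for v
  proof (rule k_times_differentiable_on_cong[OF assms(1)])
    show "k_times_differentiable_on k S
       (\<lambda>x. - (inverse (f x) * frechet_derivative f (at x) v * inverse (f x)))"
      using Suc.prems Suc.IH[OF k_times_differentiable_on_SucD[OF Suc.prems]]
      by (intro k_times_differentiable_on_linear[OF assms(1) bounded_linear_minus[OF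
          bounded_linear_ident]]
           k_times_differentiable_on_bilinear[OF assms(1) bounded_bilinear_mult]) auto
    show "- (inverse (f x) * frechet_derivative f (at x) v * inverse (f x))
       = frechet_derivative (\<lambda>x. inverse (f x)) (at x) v"
      if "x \<in> S" for x using frechet_derivative_at[OF hd[OF that]] by metis
  qed
  then show ?case using hd by (auto simp: differentiable_def)
qed

lemma smooth_on_cong:
  "open S \<Longrightarrow> (\<And>x. x \<in> S \<Longrightarrow> f x = g x) \<Longrightarrow> smooth_on S f \<Longrightarrow> smooth_on S g"
  unfolding smooth_on_def using k_times_differentiable_on_cong by blast

lemma smooth_on_const: "smooth_on S (\<lambda>x. c)"
  by (simp add: smooth_on_def k_times_differentiable_on_const)

lemma smooth_on_add:
  "open S \<Longrightarrow> smooth_on S f \<Longrightarrow> smooth_on S g \<Longrightarrow> smooth_on S (\<lambda>x. f x + g x)"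
  by (simp add: smooth_on_def k_times_differentiable_on_add)

lemma smooth_on_linear:
  "open S \<Longrightarrow> bounded_linear L \<Longrightarrow> smooth_on S f \<Longrightarrow> smooth_on S (\<lambda>x. L (f x))"
  by (simp add: smooth_on_def k_times_differentiable_on_linear)

lemma smooth_on_bilinear:
  "open S \<Longrightarrow> bounded_bilinear bop \<Longrightarrow> smooth_on S f \<Longrightarrow> smooth_on S g \<Longrightarrow>
   smooth_on S (\<lambda>x. bop (f x) (g x))"
  by (simp add: smooth_on_def k_times_differentiable_on_bilinear)

lemma smooth_on_inverse:
  fixes f :: "'a::real_normed_vector \<Rightarrow> real"
  shows "open S \<Longrightarrow> smooth_on S f \<Longrightarrow> (\<And>x. x \<in> S \<Longrightarrow> f x \<noteq> 0) \<Longrightarrow> smooth_on S (\<lambda>x. inverse (f x))"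
  by (simp add: smooth_on_def k_times_differentiable_on_inverse)

lemma smooth_on_differentiable: "smooth_on S f \<Longrightarrow> x \<in> S \<Longrightarrow> f differentiable (at x)"
  unfolding smooth_on_def by (metis k_times_differentiable_on.simps(2))

lemma smooth_on_derivative: "smooth_on S f \<Longrightarrow> smooth_on S (\<lambda>x. frechet_derivative f (at x) v)"
  unfolding smooth_on_def by (metis k_times_differentiable_on.simps(2))

lemma smooth_on_continuous_on: "smooth_on S f \<Longrightarrow> continuous_on S f"
  unfolding smooth_on_def by (metis k_times_differentiable_on.simps(1))

lemma smooth_on_has_derivative:
  "smooth_on S f \<Longrightarrow> x \<in> S \<Longrightarrow> (f has_derivative frechet_derivative f (at x)) (at x)"
  using smooth_on_differentiable frechet_derivative_works by blast

lemma smooth_on_ln: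
  fixes f :: "'a::real_normed_vector \<Rightarrow> real"
  assumes "open S" "smooth_on S f" "\<And>x. x \<in> S \<Longrightarrow> f x > 0"
  shows "smooth_on S (\<lambda>x. ln (f x))"
  unfolding smooth_on_def
proof
  fix k
  have hd: "((\<lambda>x. ln (f x)) has_derivative (\<lambda>v. frechet_derivative f (at x) v * inverse (f x))) (at x)"
    if "x \<in> S" for x
    using has_derivative_ln[OF assms(3)[OF that] smooth_on_has_derivative[OF assms(2) that]] by simp
  show "k_times_differentiable_on k S (\<lambda>x. ln (f x))"
  proof (cases k)
    case 0
    then show ?thesis
      using hd by (auto intro!: continuous_at_imp_continuous_on intro: has_derivative_continuous)
  next
    case (Suc l)
    have "k_times_differentiable_on l S (\<lambda>x. frechet_derivative (\<lambda>x. ln (f x)) (at x) v)" for v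
    proof (rule k_times_differentiable_on_cong[OF assms(1)])
      have "smooth_on S (\<lambda>x. frechet_derivative f (at x) v * inverse (f x))"
        using assms(3) by (intro smooth_on_bilinear[OF assms(1) bounded_bilinear_mult]
          smooth_on_derivative assms(1,2) smooth_on_inverse) fastforce+
      then show "k_times_differentiable_on l S (\<lambda>x. frechet_derivative f (at x) v * inverse (f x))"
        by (simp add: smooth_on_def)
      show "frechet_derivative f (at x) v * inverse (f x) = frechet_derivative (\<lambda>x. ln (f x)) (at x) v"
        if "x \<in> S" for x using frechet_derivative_at[OF hd[OF that]] by metis
    qed
    then show ?thesis using hd Suc by (auto simp: differentiable_def)
  qed
qed

lemma smooth_on_sum:
  assumes "open S" "finite I" "\<And>i. i \<in> I \<Longrightarrow> smooth_on S (f i)"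
  shows "smooth_on S (\<lambda>x. \<Sum>i\<in>I. f i x)"
  using assms(2,3) by (induction I) (auto simp: smooth_on_const intro!: smooth_on_add[OF assms(1)])

lemma smooth_on_prod:
  fixes f :: "'i \<Rightarrow> 'a::real_normed_vector \<Rightarrow> real"
  assumes "open S" "finite I" "\<And>i. i \<in> I \<Longrightarrow> smooth_on S (f i)"
  shows "smooth_on S (\<lambda>x. \<Prod>i\<in>I. f i x)"
  using assms(2,3)
  by (induction I) (auto simp: smooth_on_const intro!: smooth_on_bilinear[OF assms(1)
      bounded_bilinear_mult])

lemma smooth_on_det:
  fixes M :: "'a::real_normed_vector \<Rightarrow> real ^ 'n ^ 'n::finite"
  assumes "open S" "\<And>i j. smooth_on S (\<lambda>x. M x $ i $ j)"
  shows "smooth_on S (\<lambda>x. det (M x))"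
  unfolding det_def
  by (intro smooth_on_sum smooth_on_prod smooth_on_bilinear[OF assms(1) bounded_bilinear_mult]
      smooth_on_const assms finite_permutations) auto

text \<open>The mean value inequality is used twice, in the direction of \<open>v\<close> for the difference in the
  direction of \<open>w\<close>, and for that difference itself. Being an estimate of norms, it needs no
  reduction to real values. The left side of the conclusion is symmetric in \<open>v\<close> and \<open>w\<close> except for
  \<open>c\<close>.\<close>

lemma second_difference_estimate:
  fixes f :: "'a::real_normed_vector \<Rightarrow> 'b::real_normed_vector"
  assumes S: "smooth_on S f" and t: "t > 0"
    and sub: "\<And>r s. r \<in> {0..t} \<Longrightarrow> s \<in> {0..t} \<Longrightarrow> x + r *\<^sub>R v + s *\<^sub>R w \<in> S"
    and e: "\<And>r s. r \<in> {0..t} \<Longrightarrow> s \<in> {0..t} \<Longrightarrow>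
        norm (frechet_derivative (\<lambda>y. frechet_derivative f (at y) v) (at (x + r *\<^sub>R v + s *\<^sub>R w)) w - c) \<le>
            e"
  shows "norm (f (x + t *\<^sub>R v + t *\<^sub>R w) - f (x + t *\<^sub>R v) - f (x + t *\<^sub>R w) + f x - (t * t) *\<^sub>R c) \<le> t * t *
      e"
proof -
  let ?D = "\<lambda>y. frechet_derivative f (at y) v"
  have D: "smooth_on S ?D" by (rule smooth_on_derivative[OF S])
  have inner_bound: "norm (?D (x + r *\<^sub>R v + t *\<^sub>R w) - ?D (x + r *\<^sub>R v) - t *\<^sub>R c) \<le> t * e"
    if r: "r \<in> {0..t}" for r
  proof -
    let ?k = "\<lambda>s. ?D (x + r *\<^sub>R v + s *\<^sub>R w) - s *\<^sub>R c"
    have "norm (?k t - ?k 0) \<le> e * norm (t - 0)"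
    proof (rule differentiable_bound[where S = "{0..t}"])
      fix s assume s: "s \<in> {0..t}"
      let ?y = "x + r *\<^sub>R v + s *\<^sub>R w"
      let ?L = "frechet_derivative ?D (at ?y)"
      have lin: "linear ?L" by (rule linear_frechet_derivative[OF smooth_on_differentiable[OF D sub[OF r
          s]]])
      have d0: "((\<lambda>s. x + r *\<^sub>R v + s *\<^sub>R w) has_derivative (\<lambda>h. h *\<^sub>R w)) (at s within {0..t})"
        by (auto intro!: derivative_eq_intros)
      have "((\<lambda>s. ?D (x + r *\<^sub>R v + s *\<^sub>R w)) has_derivative (\<lambda>h. ?L (h *\<^sub>R w))) (at s within {0..t})"
        by (rule has_derivative_compose[OF d0 smooth_on_has_derivative[OF D sub[OF r s]]])
      then show "(?k has_derivative (\<lambda>h. ?L (h *\<^sub>R w) - h *\<^sub>R c)) (at s within {0..t})"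
        by (auto intro!: derivative_eq_intros)
      show "onorm (\<lambda>h. ?L (h *\<^sub>R w) - h *\<^sub>R c) \<le> e"
      proof (rule onorm_bound)
        show "0 \<le> e" using e[OF r s] norm_ge_zero order_trans by blast
        fix h :: real
        have "norm (?L (h *\<^sub>R w) - h *\<^sub>R c) = \<bar>h\<bar> * norm (?L w - c)"
          by (simp add: linear_scale[OF lin] flip: scaleR_diff_right)
        also have "\<dots> \<le> \<bar>h\<bar> * e" using e[OF r s] by (intro mult_left_mono) auto
        finally show "norm (?L (h *\<^sub>R w) - h *\<^sub>R c) \<le> e * norm h" by (simp add: mult.commute)
      qed
    qed (use t in auto)
    then show ?thesis using t by (simp add: algebra_simps)
  qed
  let ?g = "\<lambda>r. f (x + r *\<^sub>R v + t *\<^sub>R w) - f (x + r *\<^sub>R v) - (r * t) *\<^sub>R c"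
  have "norm (?g t - ?g 0) \<le> (t * e) * norm (t - 0)"
  proof (rule differentiable_bound[where S = "{0..t}"])
    fix r assume r: "r \<in> {0..t}"
    have d1: "((\<lambda>r. f (x + r *\<^sub>R v + s *\<^sub>R w)) has_derivative
          (\<lambda>h. frechet_derivative f (at (x + r *\<^sub>R v + s *\<^sub>R w)) (h *\<^sub>R v))) (at r within {0..t})"
      if s: "s \<in> {0..t}" for s
    proof -
      have d0: "((\<lambda>r. x + r *\<^sub>R v + s *\<^sub>R w) has_derivative (\<lambda>h. h *\<^sub>R v)) (at r within {0..t})"
        by (auto intro!: derivative_eq_intros)
      show ?thesis by (rule has_derivative_compose[OF d0 smooth_on_has_derivative[OF S sub[OF r s]]])
    qed
    have d1': "((\<lambda>r. f (x + r *\<^sub>R v + s *\<^sub>R w)) has_derivative (\<lambda>h. h *\<^sub>R ?D (x + r *\<^sub>R v + s *\<^sub>R w)))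
          (at r within {0..t})" if s: "s \<in> {0..t}" for s
      using d1[OF s] linear_scale[OF linear_frechet_derivative[OF smooth_on_differentiable[OF S sub[OF r
          s]]]]
      by simp
    have m0: "0 \<in> {0..t}" and mt: "t \<in> {0..t}" using t by auto
    show "(?g has_derivative (\<lambda>h. h *\<^sub>R (?D (x + r *\<^sub>R v + t *\<^sub>R w) - ?D (x + r *\<^sub>R v) - t *\<^sub>R c))) (at r
        within {0..t})"
      using d1'[OF m0] d1'[OF mt] by (auto intro!: derivative_eq_intros simp: algebra_simps)
    show "onorm (\<lambda>h. h *\<^sub>R (?D (x + r *\<^sub>R v + t *\<^sub>R w) - ?D (x + r *\<^sub>R v) - t *\<^sub>R c)) \<le> t * e"
    proof (rule onorm_bound)
      show "0 \<le> t * e" using inner_bound[OF r] norm_ge_zero order_trans by blast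
      show "norm (h *\<^sub>R (?D (x + r *\<^sub>R v + t *\<^sub>R w) - ?D (x + r *\<^sub>R v) - t *\<^sub>R c)) \<le> t * e * norm h" for h ::
          real
        using mult_left_mono[OF inner_bound[OF r], of "\<bar>h\<bar>"] by (simp add: mult.commute)
    qed
  qed (use t in auto)
  then show ?thesis using t by (simp add: algebra_simps)
qed

text \<open>Both mixed derivatives are limits of the same second difference quotient.\<close>

lemma smooth_on_symmetric_derivative:
  fixes f :: "'a::real_normed_vector \<Rightarrow> 'b::real_normed_vector"
  assumes "open S" "smooth_on S f" "x \<in> S"
  shows "frechet_derivative (\<lambda>y. frechet_derivative f (at y) v) (at x) w
       = frechet_derivative (\<lambda>y. frechet_derivative f (at y) w) (at x) v"
proof -
  define A where "A = (\<lambda>v w y. frechet_derivative (\<lambda>y. frechet_derivative f (at y) v) (at y) w)"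
  have cont: "continuous_on S (A v w)" for v w
    unfolding A_def by (intro smooth_on_continuous_on smooth_on_derivative assms(2))
  have "norm (A v w x - A w v x) \<le> 2 * e" if e: "e > 0" for e
  proof -
    have "\<exists>d>0. \<forall>y. dist y x < d \<longrightarrow> y \<in> S \<and> dist (A a b y) (A a b x) < e" for a b
    proof -
      have "isCont (A a b) x" using cont assms(1,3) continuous_on_eq_continuous_at by blast
      then obtain d1 where d1: "d1 > 0" "\<forall>y. dist y x < d1 \<longrightarrow> dist (A a b y) (A a b x) < e"
        using e unfolding continuous_at_eps_delta by blast
      obtain d2 where d2: "d2 > 0" "\<forall>y. dist y x < d2 \<longrightarrow> y \<in> S"
        using assms(1,3) by (metis open_dist)
      show ?thesis using d1 d2 by (intro exI[of _ "min d1 d2"]) auto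
    qed
    then obtain d1 d2 where d: "d1 > 0" "d2 > 0"
      "\<forall>y. dist y x < d1 \<longrightarrow> y \<in> S \<and> dist (A v w y) (A v w x) < e"
      "\<forall>y. dist y x < d2 \<longrightarrow> y \<in> S \<and> dist (A w v y) (A w v x) < e" by metis
    define t where "t = min d1 d2 / (2 * (norm v + norm w + 1))"
    have t: "t > 0" using d(1,2) by (simp add: t_def add_nonneg_pos)
    have "t * (norm v + norm w) < min d1 d2"
    proof -
      have "t * (norm v + norm w) \<le> t * (norm v + norm w + 1)" using t by simp
      also have "\<dots> = min d1 d2 / 2" using norm_ge_zero[of v] norm_ge_zero[of w] by (simp add: t_def
          field_simps add_nonneg_eq_0_iff)
      finally show ?thesis using d by auto
    qed
    then have close: "dist (x + r *\<^sub>R v + s *\<^sub>R w) x < min d1 d2" if "r \<in> {0..t}" "s \<in> {0..t}" for r s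
    proof -
      have "dist (x + r *\<^sub>R v + s *\<^sub>R w) x = norm (r *\<^sub>R v + s *\<^sub>R w)" by (simp add: dist_norm)
      also have "\<dots> \<le> norm (r *\<^sub>R v) + norm (s *\<^sub>R w)" by (rule norm_triangle_ineq)
      also have "\<dots> \<le> t * norm v + t * norm w" using that by (auto intro!: add_mono mult_right_mono)
      finally show ?thesis using \<open>t * (norm v + norm w) < min d1 d2\<close> by (simp add: distrib_left)
    qed
    let ?Q = "f (x + t *\<^sub>R v + t *\<^sub>R w) - f (x + t *\<^sub>R v) - f (x + t *\<^sub>R w) + f x"
    have 1: "norm (?Q - (t * t) *\<^sub>R A v w x) \<le> t * t * e"
    proof (rule second_difference_estimate[OF assms(2) t])
      show "x + r *\<^sub>R v + s *\<^sub>R w \<in> S" if "r \<in> {0..t}" "s \<in> {0..t}" for r s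
        using close[OF that] d by auto
      show "norm (frechet_derivative (\<lambda>y. frechet_derivative f (at y) v) (at (x + r *\<^sub>R v + s *\<^sub>R w)) w - A
          v w x) \<le> e"
        if "r \<in> {0..t}" "s \<in> {0..t}" for r s
        using close[OF that] d(3) unfolding A_def dist_norm by (smt (verit))
    qed
    have 2: "norm (f (x + t *\<^sub>R w + t *\<^sub>R v) - f (x + t *\<^sub>R w) - f (x + t *\<^sub>R v) + f x - (t * t) *\<^sub>R A w v x) \<le>
        t * t * e"
    proof (rule second_difference_estimate[OF assms(2) t])
      have comm: "x + r *\<^sub>R w + s *\<^sub>R v = x + s *\<^sub>R v + r *\<^sub>R w" for r s by simp
      show "x + r *\<^sub>R w + s *\<^sub>R v \<in> S" if "r \<in> {0..t}" "s \<in> {0..t}" for r s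
        using close[OF that(2,1)] d unfolding comm by auto
      show "norm (frechet_derivative (\<lambda>y. frechet_derivative f (at y) w) (at (x + r *\<^sub>R w + s *\<^sub>R v)) v - A
          w v x) \<le> e"
        if "r \<in> {0..t}" "s \<in> {0..t}" for r s
        using close[OF that(2,1)] d(4) unfolding comm A_def dist_norm by (smt (verit))
    qed
    have comm: "x + t *\<^sub>R w + t *\<^sub>R v = x + t *\<^sub>R v + t *\<^sub>R w" by simp
    have 3: "norm (?Q - (t * t) *\<^sub>R A w v x) \<le> t * t * e"
      using 2 unfolding comm by (simp add: algebra_simps)
    have "norm ((t * t) *\<^sub>R A v w x - (t * t) *\<^sub>R A w v x) \<le> t * t * e + t * t * e"
      using norm_triangle_ineq4[of "?Q - (t * t) *\<^sub>R A w v x" "?Q - (t * t) *\<^sub>R A v w x"] 1 3 by (simp add: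
          algebra_simps)
    then have "(t * t) * norm (A v w x - A w v x) \<le> (t * t) * (2 * e)"
      by (simp add: algebra_simps flip: scaleR_diff_right)
    moreover have "t * t > 0" using t by simp
    ultimately show ?thesis by (simp only: mult_le_cancel_left_pos)
  qed
  note * = this
  have "norm (A v w x - A w v x) \<le> 0"
  proof (rule field_le_epsilon)
    fix e :: real assume "e > 0"
    then show "norm (A v w x - A w v x) \<le> 0 + e" using *[of "e / 2"] by simp
  qed
  then show ?thesis by (simp add: A_def)
qed

section \<open>Linear algebra of the indefinite form\<close>

lemma bounded_bilinear_pinner: "bounded_bilinear (pinner :: ('n::finite, 'm::finite) pseudo_space \<Rightarrow> _)"
proof -
  have "bounded_bilinear (\<lambda>x y :: ('n, 'm) pseudo_space. inner x (fst y, - snd y))"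
    by (rule bounded_bilinear.comp[OF bounded_bilinear_inner bounded_linear_ident])
       (intro bounded_linear_Pair bounded_linear_minus bounded_linear_fst bounded_linear_snd)
  moreover have "(\<lambda>x y :: ('n, 'm) pseudo_space. inner x (fst y, - snd y)) = pinner"
    by (intro ext) (simp add: pinner_def inner_prod_def)
  ultimately show ?thesis by simp
qed

interpretation pinner: bounded_bilinear "pinner :: ('n::finite, 'm::finite) pseudo_space \<Rightarrow> _"
  by (rule bounded_bilinear_pinner)

lemmas pinner_simps = pinner.add_left pinner.add_right pinner.diff_left pinner.diff_right
  pinner.minus_left pinner.minus_right pinner.scaleR_left pinner.scaleR_right
  pinner.sum_left pinner.sum_right pinner.zero_left pinner.zero_right

lemma pinner_commute: "pinner x y = pinner y x"
  by (simp add: pinner_def inner_commute)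

text \<open>The reflection that turns the indefinite form into the Euclidean inner product. The flipped
  Euclidean basis is dual to the Euclidean basis with respect to \<open>pinner\<close>; sums over \<open>b \<in> Basis\<close>
  that pair \<open>b\<close> with \<open>flip b\<close> are therefore traces over the indefinite form.\<close>

definition flip :: "('n::finite, 'm::finite) pseudo_space \<Rightarrow> ('n, 'm) pseudo_space" where
  "flip v = (fst v, - snd v)"

lemma pinner_flip_right: "pinner x (flip y) = inner x y"
  by (simp add: flip_def pinner_def inner_prod_def)

lemma pinner_flip_left: "pinner (flip x) y = inner x y"
  by (simp add: flip_def pinner_def inner_prod_def)

lemma pinner_nondegenerate: "(\<And>u. pinner v u = 0) \<Longrightarrow> v = 0"
  by (metis inner_eq_zero_iff pinner_flip_right)

lemma pinner_eqI: "(\<And>u. pinner v u = pinner w u) \<Longrightarrow> v = w"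
  using pinner_nondegenerate[of "v - w"] by (simp add: pinner_simps)

lemma orthonormal_sum_coefficient:
  assumes "\<And>i j. pinner (e i) (e j) = (if i = j then c else 0)"
  shows "pinner (\<Sum>i\<in>UNIV. x i *\<^sub>R e i) (e j) = c * x (j::'i::finite)"
  by (simp add: pinner_simps assms if_distrib sum.delta' cong: if_cong)

lemma orthonormal_span_eq:
  fixes e :: "'i::finite \<Rightarrow> ('n::finite, 'm::finite) pseudo_space"
  assumes "\<And>i j. pinner (e i) (e j) = (if i = j then c else 0)" "c \<noteq> 0" "v \<in> span (range e)"
  shows "v = (\<Sum>i\<in>UNIV. (pinner v (e i) / c) *\<^sub>R e i)"
  using assms(3)
proof (induction rule: span_induct_alt)
  case base
  then show ?case by (simp add: pinner_simps)
next
  case (step a x y)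
  then obtain j where j: "x = e j" by auto
  have "(\<Sum>i\<in>UNIV. (pinner (a *\<^sub>R x + y) (e i) / c) *\<^sub>R e i) = a *\<^sub>R e j + (\<Sum>i\<in>UNIV. (pinner y (e i) / c) *\<^sub>R e
      i)"
  proof -
    have "(pinner (a *\<^sub>R x + y) (e i) / c) *\<^sub>R e i = (if j = i then a *\<^sub>R e j else 0) + (pinner y (e i) / c)
        *\<^sub>R e i" for i
      using assms(2) by (simp add: j pinner_simps assms(1) add_divide_distrib scaleR_left_distrib)
    then show ?thesis by (simp add: sum.distrib)
  qed
  then show ?case using step(2) j by metis
qed

lemma orthonormal_independent:
  fixes e :: "'i::finite \<Rightarrow> ('n::finite, 'm::finite) pseudo_space"
  assumes "\<And>i j. pinner (e i) (e j) = (if i = j then c else 0)" "c \<noteq> 0"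
  shows "inj e" "independent (range e)" "dim (span (range e)) = CARD('i)"
proof -
  show inj: "inj e"
  proof (rule injI)
    fix i j assume "e i = e j"
    then have "pinner (e i) (e j) \<noteq> 0" using assms by metis
    then show "i = j" using assms(1) by metis
  qed
  show ind: "independent (range e)"
  proof (rule independent_if_scalars_zero)
    show "finite (range e)" by simp
    fix f x assume s: "(\<Sum>x\<in>range e. f x *\<^sub>R x) = 0" and "x \<in> range e"
    then obtain j where j: "x = e j" by auto
    have "(\<Sum>i\<in>UNIV. f (e i) *\<^sub>R e i) = 0" using s by (simp add: sum.reindex[OF inj])
    then have "c * f (e j) = 0" using orthonormal_sum_coefficient[OF assms(1), of "\<lambda>i. f (e i)" j] by
        (simp add: pinner_simps)
    then show "f x = 0" using assms(2) j by simp
  qed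
  show "dim (span (range e)) = CARD('i)"
    using dim_eq_card_independent[OF ind] card_image[OF inj] by simp
qed

text \<open>Gram-Schmidt for \<open>c\<close> times the form, which is positive definite on \<open>S\<close>.\<close>

lemma definite_orthonormal_extend:
  fixes S :: "('n::finite, 'm::finite) pseudo_space set"
  assumes S: "subspace S" and c: "\<bar>c\<bar> = 1" and pos: "\<And>v. v \<in> S \<Longrightarrow> v \<noteq> 0 \<Longrightarrow> c * pinner v v > 0"
    and k: "k \<le> dim S"
  shows "\<exists>B\<subseteq>S. finite B \<and> card B = k \<and> (\<forall>x\<in>B. \<forall>y\<in>B. pinner x y = (if x = y then c else 0))"
  using k
proof (induction k)
  case 0
  show ?case by (intro exI[of _ "{}"]) auto
next
  case (Suc k)
  then obtain B where B: "B \<subseteq> S" "finite B" "card B = k"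
    "\<And>x y. x \<in> B \<Longrightarrow> y \<in> B \<Longrightarrow> pinner x y = (if x = y then c else 0)" by force
  have cc: "c * c = 1" using c by (metis abs_mult_self_eq mult_1)
  have "dim B \<le> k" using dim_le_card'[OF B(2)] B(3) by simp
  then have "\<not> S \<subseteq> span B" using Suc.prems dim_subset[of S "span B"] by (metis Suc_n_not_le_n dim_span
      order_trans)
  then obtain v where v: "v \<in> S" "v \<notin> span B" by auto
  define u where "u = v - (\<Sum>b\<in>B. (c * pinner v b) *\<^sub>R b)"
  have sB: "(\<Sum>b\<in>B. (c * pinner v b) *\<^sub>R b) \<in> span B" by (intro span_sum span_scale span_base)
  have "u \<notin> span B" 
  proof
    assume "u \<in> span B"
    from span_add[OF this sB] have "v \<in> span B" by (simp add: u_def)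
    with v(2) show False by contradiction
  qed
  then have u0: "u \<noteq> 0" using span_zero by auto
  have uS: "u \<in> S" unfolding u_def
    using B(1) v(1) by (intro subspace_diff[OF S] subspace_sum[OF S] subspace_scale[OF S]) auto
  have ub: "pinner u b = 0" if "b \<in> B" for b
  proof -
    have "pinner u b = pinner v b - (\<Sum>x\<in>B. (c * pinner v x) * pinner x b)" by (simp add: u_def
        pinner_simps)
    also have "(\<Sum>x\<in>B. (c * pinner v x) * pinner x b) = (\<Sum>x\<in>B. if x = b then pinner v b else 0)"
      using B(4) that cc by (intro sum.cong) (auto simp: algebra_simps)
    also have "\<dots> = pinner v b" using B(2) that by simp
    finally show ?thesis by simp
  qed
  define r where "r = c * pinner u u"
  have r: "r > 0" unfolding r_def by (rule pos[OF uS u0])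
  define x where "x = (1 / sqrt r) *\<^sub>R u"
  have uu: "pinner u u = c * r" using cc by (simp add: r_def flip: mult.assoc)
  have xx: "pinner x x = c" using r by (simp add: x_def pinner_simps uu real_sqrt_mult_self field_simps)
  have xb: "pinner x b = 0" "pinner b x = 0" if "b \<in> B" for b
    using ub[OF that] by (simp_all add: x_def pinner_simps pinner_commute[of b])
  have xB: "x \<notin> B" using xb(1)[of x] xx c by auto
  have xS: "x \<in> S" unfolding x_def by (rule subspace_scale[OF S uS])
  show ?case
  proof (intro exI[of _ "insert x B"] conjI)
    show "\<forall>y\<in>insert x B. \<forall>z\<in>insert x B. pinner y z = (if y = z then c else 0)"
      using B(4) xx xb xB by auto
  qed (use B xS xB in auto)
qed

lemma definite_orthonormal_basis_exists:
  fixes S :: "('n::finite, 'm::finite) pseudo_space set"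
  assumes S: "subspace S" and c: "\<bar>c\<bar> = 1" and pos: "\<And>v. v \<in> S \<Longrightarrow> v \<noteq> 0 \<Longrightarrow> c * pinner v v > 0"
    and d: "dim S = CARD('i::finite)"
  shows "\<exists>e :: 'i \<Rightarrow> ('n, 'm) pseudo_space. orthonormal_basis c S e"
proof -
  obtain B where B: "B \<subseteq> S" "finite B" "card B = CARD('i)"
    "\<And>x y. x \<in> B \<Longrightarrow> y \<in> B \<Longrightarrow> pinner x y = (if x = y then c else 0)"
    using definite_orthonormal_extend[OF S c pos order_refl] d by metis
  obtain e where e: "bij_betw e (UNIV :: 'i set) B"
    using finite_same_card_bij[OF finite_class.finite_UNIV B(2)] B(3) by auto
  have eB: "e i \<in> B" for i using e bij_betwE by blast
  have orth: "pinner (e i) (e j) = (if i = j then c else 0)" for i j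
    using B(4)[OF eB eB] e by (simp add: bij_betw_def inj_eq)
  have c0: "c \<noteq> 0" using c by auto
  have "span (range e) \<subseteq> S" using B(1) eB S by (intro span_minimal) auto
  moreover have "dim (span (range e)) = dim S" using orthonormal_independent(3)[OF orth c0] d by simp
  ultimately have "span (range e) = S" by (intro subspace_dim_equal[OF subspace_span S]) auto
  then have "orthonormal_basis c S e" unfolding orthonormal_basis_def using orth by simp
  then show ?thesis by (rule exI[where x = e])
qed

definition orth_compl :: "('n::finite, 'm::finite) pseudo_space set \<Rightarrow> ('n, 'm) pseudo_space set" where
  "orth_compl S = {v. \<forall>u\<in>S. pinner v u = 0}"

lemma subspace_orth_compl: "subspace (orth_compl S)"
  by (auto simp: subspace_def orth_compl_def pinner_simps)

lemma spacelike_fst_eq_0: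
  assumes "spacelike_on S" "v \<in> S" "fst v = 0"
  shows "v = 0"
proof (rule ccontr)
  assume "v \<noteq> 0"
  then have "pinner v v > 0" using assms by (auto simp: spacelike_on_def)
  then show False using assms(3) inner_ge_zero[of "snd v"] by (simp add: pinner_def)
qed

text \<open>The projection is injective on \<open>S\<close>, since a vector without positive part has non-positive
  square; the rest is a count of dimensions.\<close>

lemma spacelike_fst_surj:
  fixes S :: "('n::finite, 'm::finite) pseudo_space set"
  assumes "spacelike_on S" "subspace S" "dim S = CARD('n)"
  shows "fst ` S = UNIV"
proof -
  have "inj_on fst S"
  proof (rule inj_onI)
    fix x y assume "x \<in> S" "y \<in> S" "fst x = fst y"
    then show "x = y" using spacelike_fst_eq_0[OF assms(1) subspace_diff[OF assms(2)], of x y] by simp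
  qed
  then have "dim (fst ` S) = dim S"
    using assms(2) by (intro dim_image_eq linear_fst) (simp add: span_eq_iff[THEN iffD2])
  then show ?thesis
    using assms(3) by (metis DIM_cart DIM_real dim_eq_full mult.right_neutral span_eq_iff linear_fst
        linear_subspace_image assms(2))
qed

text \<open>The plane contains a vector \<open>u\<close> with the same positive part as \<open>v\<close>. Orthogonality turns
  \<open>|fst v|\<^sup>2\<close> into \<open>\<langle>snd v, snd u\<rangle>\<close>, and \<open>|snd u| < |fst u| = |fst v|\<close> because \<open>u\<close> is space-like.\<close>

lemma orth_compl_timelike:
  fixes S :: "('n::finite, 'm::finite) pseudo_space set"
  assumes "spacelike_on S" "subspace S" "dim S = CARD('n)" "v \<in> orth_compl S" "v \<noteq> 0"
  shows "pinner v v < 0"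
proof -
  obtain u where u: "u \<in> S" "fst u = fst v" using spacelike_fst_surj[OF assms(1-3)] by (metis UNIV_I
      imageE)
  have vu: "inner (fst v) (fst v) = inner (snd v) (snd u)"
    using assms(4) u by (auto simp: orth_compl_def pinner_def)
  show ?thesis
  proof (cases "u = 0")
    case True
    then have "fst v = 0" using u by simp
    then have "snd v \<noteq> 0" using assms(5) by (simp add: prod_eq_iff)
    then show ?thesis using \<open>fst v = 0\<close> by (simp add: pinner_def)
  next
    case False
    then have "pinner u u > 0" using assms(1) u by (auto simp: spacelike_on_def)
    then have lt: "norm (snd u) < norm (fst v)"
      using u(2) by (simp add: pinner_def dot_square_norm power2_less_imp_less)
    have le: "(norm (fst v))\<^sup>2 \<le> norm (snd v) * norm (snd u)"
      using vu norm_cauchy_schwarz[of "snd v" "snd u"] by (simp add: dot_square_norm)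
    have p: "norm (fst v) > 0" using lt norm_ge_zero[of "snd u"] by linarith
    have "norm (snd v) \<noteq> 0"
    proof
      assume "norm (snd v) = 0"
      with le p show False by simp
    qed
    then have "norm (snd v) * norm (snd u) < norm (snd v) * norm (fst v)" using lt by simp
    with le have "norm (fst v) * norm (fst v) < norm (snd v) * norm (fst v)" by (simp add:
        power2_eq_square)
    then have "norm (fst v) < norm (snd v)" using p by (simp only: mult_less_cancel_right_pos)
    then show ?thesis by (simp add: pinner_def dot_square_norm power_strict_mono)
  qed
qed

lemma spacelike_orth_compl_dim:
  fixes S :: "('n::finite, 'm::finite) pseudo_space set"
  assumes "spacelike_on S" "subspace S" "dim S = CARD('n)"
  shows "dim (orth_compl S) = CARD('m)"
    and "\<exists>t\<in>S. v - t \<in> orth_compl S"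
    and "S \<inter> orth_compl S = {0}"
proof -
  obtain e :: "'n \<Rightarrow> _" where e: "orthonormal_basis 1 S e"
    using definite_orthonormal_basis_exists[OF assms(2) _ _ assms(3), of 1] assms(1) by (auto simp:
        spacelike_on_def)
  have dec: "\<exists>t\<in>S. v - t \<in> orth_compl S" for v
  proof
    let ?t = "\<Sum>i\<in>UNIV. pinner v (e i) *\<^sub>R e i"
    show "?t \<in> S" using e unfolding orthonormal_basis_def by (metis (no_types, lifting) rangeI span_base
        span_scale span_sum)
    have "pinner (v - ?t) u = 0" if "u \<in> S" for u
    proof -
      have "u \<in> span (range e)" using e that by (simp add: orthonormal_basis_def)
      then show ?thesis
      proof (induction rule: span_induct_alt)
        case (step c x y)
        then obtain j where "x = e j" by auto
        then have "pinner (v - ?t) x = 0"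
          using orthonormal_sum_coefficient[of e 1 "\<lambda>i. pinner v (e i)" j] e
          by (simp add: pinner.diff_left orthonormal_basis_def)
        then show ?case using step(2) by (simp add: pinner.add_right pinner.scaleR_right)
      qed (simp add: pinner_simps)
    qed
    then show "v - ?t \<in> orth_compl S" by (simp add: orth_compl_def)
  qed
  show "\<exists>t\<in>S. v - t \<in> orth_compl S" by (rule dec)
  show int: "S \<inter> orth_compl S = {0}"
  proof (intro equalityI subsetI)
    fix x assume "x \<in> S \<inter> orth_compl S"
    then have "pinner x x = 0" "x \<in> S" by (auto simp: orth_compl_def)
    then show "x \<in> {0}" using assms(1) by (force simp: spacelike_on_def)
  qed (use assms(2) subspace_orth_compl subspace_0 in auto)
  have "{x + y |x y. x \<in> S \<and> y \<in> orth_compl S} = UNIV"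
  proof -
    have "v \<in> {x + y |x y. x \<in> S \<and> y \<in> orth_compl S}" for v
    proof -
      obtain t where "t \<in> S" "v - t \<in> orth_compl S" using dec by blast
      then show ?thesis by (intro CollectI exI[of _ t] exI[of _ "v - t"]) simp
    qed
    then show ?thesis by blast
  qed
  then have "dim S + dim (orth_compl S) = DIM(('n, 'm) pseudo_space)"
    using dim_sums_Int[OF assms(2) subspace_orth_compl, of S] int by simp
  then show "dim (orth_compl S) = CARD('m)" using assms(3) by simp
qed

definition adapted_frame :: "('n::finite, 'm::finite) pseudo_space set \<Rightarrow> ('n \<Rightarrow> ('n, 'm) pseudo_space) \<Rightarrow>
    ('m \<Rightarrow> ('n, 'm) pseudo_space) \<Rightarrow> bool" where
  "adapted_frame S e \<nu> \<longleftrightarrow> orthonormal_basis 1 S e \<and> orthonormal_basis (-1) (orth_compl S) \<nu>"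

lemma adapted_frame_expansion:
  assumes "adapted_frame S e \<nu>"
  shows "v = (\<Sum>i\<in>UNIV. pinner v (e i) *\<^sub>R e i) - (\<Sum>\<alpha>\<in>UNIV. pinner v (\<nu> \<alpha>) *\<^sub>R \<nu> \<alpha>)"
proof -
  have e: "\<And>i j. pinner (e i) (e j) = (if i = j then 1 else 0)" "span (range e) = S"
    and n: "\<And>i j. pinner (\<nu> i) (\<nu> j) = (if i = j then -1 else 0)" "span (range \<nu>) = orth_compl S"
    using assms by (auto simp: adapted_frame_def orthonormal_basis_def)
  have en: "pinner (\<nu> \<alpha>) (e i) = 0" "pinner (e i) (\<nu> \<alpha>) = 0" for i \<alpha>
  proof -
    have "\<nu> \<alpha> \<in> span (range \<nu>)" "e i \<in> span (range e)" by (rule span_base, simp)+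
    then show *: "pinner (\<nu> \<alpha>) (e i) = 0" by (simp only: e(2) n(2)) (simp add: orth_compl_def)
    show "pinner (e i) (\<nu> \<alpha>) = 0" using pinner_commute[of "e i" "\<nu> \<alpha>"] * by (simp only:)
  qed
  let ?w = "v - (\<Sum>i\<in>UNIV. pinner v (e i) *\<^sub>R e i) + (\<Sum>\<alpha>\<in>UNIV. pinner v (\<nu> \<alpha>) *\<^sub>R \<nu> \<alpha>)"
  have we: "pinner ?w (e j) = 0" for j
    by (simp add: pinner.add_left pinner.diff_left orthonormal_sum_coefficient[OF e(1)])
       (simp add: pinner.sum_left pinner.scaleR_left en)
  have wn: "pinner ?w (\<nu> \<beta>) = 0" for \<beta>
    by (simp add: pinner.add_left pinner.diff_left orthonormal_sum_coefficient[OF n(1)])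
       (simp add: pinner.sum_left pinner.scaleR_left en)
  have "pinner ?w u = 0" if "u \<in> S" for u
  proof -
    have "u \<in> span (range e)" using e that by simp
    then show ?thesis
      by (induction rule: span_induct_alt) (auto simp: pinner.add_right pinner.scaleR_right
          pinner.zero_right we)
  qed
  then have "?w \<in> span (range \<nu>)" using n(2) by (simp add: orth_compl_def)
  from orthonormal_span_eq[OF n(1) _ this] wn have "?w = 0" by simp
  then show ?thesis by (simp add: algebra_simps)
qed

lemma adapted_frame_pinner:
  assumes "adapted_frame S e \<nu>"
  shows "pinner u v = (\<Sum>i\<in>UNIV. pinner u (e i) * pinner v (e i)) - (\<Sum>\<alpha>\<in>UNIV. pinner u (\<nu> \<alpha>) * pinner v (\<nu>
      \<alpha>))"
  by (subst adapted_frame_expansion[OF assms, of u])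
     (simp add: pinner_simps pinner_commute[of v])

text \<open>Expand \<open>flip b\<close> in the frame; the coefficient along \<open>e i\<close> is the Euclidean product
  \<open>\<langle>b, e i\<rangle>\<close>, and the sum over \<open>b\<close> restores \<open>e i\<close> in the first argument.\<close>

lemma contraction_adapted_frame:
  fixes \<beta> :: "('n::finite, 'm::finite) pseudo_space \<Rightarrow> ('n, 'm) pseudo_space \<Rightarrow> 'b::real_vector"
  assumes fr: "adapted_frame S e \<nu>" and l: "\<And>v. linear (\<beta> v)" "\<And>w. linear (\<lambda>v. \<beta> v w)"
  shows "(\<Sum>b\<in>Basis. \<beta> b (flip b)) = (\<Sum>i\<in>UNIV. \<beta> (e i) (e i)) - (\<Sum>\<alpha>\<in>UNIV. \<beta> (\<nu> \<alpha>) (\<nu> \<alpha>))"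
proof -
  have *: "(\<Sum>b\<in>Basis. inner b x *\<^sub>R \<beta> b y) = \<beta> x y" for x y
  proof -
    have "(\<Sum>b\<in>Basis. inner b x *\<^sub>R \<beta> b y) = \<beta> (\<Sum>b\<in>Basis. inner x b *\<^sub>R b) y"
      by (simp add: linear_sum[OF l(2)] linear_scale[OF l(2)] inner_commute)
    then show ?thesis by (simp add: euclidean_representation)
  qed
  have "(\<Sum>b\<in>Basis. \<beta> b (flip b)) = (\<Sum>b\<in>Basis. (\<Sum>i\<in>UNIV. inner b (e i) *\<^sub>R \<beta> b (e i)) - (\<Sum>\<alpha>\<in>UNIV. inner b (\<nu>
      \<alpha>) *\<^sub>R \<beta> b (\<nu> \<alpha>)))"
  proof (rule sum.cong)
    fix b :: "('n, 'm) pseudo_space"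
    show "\<beta> b (flip b) = (\<Sum>i\<in>UNIV. inner b (e i) *\<^sub>R \<beta> b (e i)) - (\<Sum>\<alpha>\<in>UNIV. inner b (\<nu> \<alpha>) *\<^sub>R \<beta> b (\<nu> \<alpha>))"
      by (subst adapted_frame_expansion[OF fr, of "flip b"])
        (simp add: linear_diff[OF l(1)] linear_sum[OF l(1)] linear_scale[OF l(1)] pinner_flip_left)
  qed simp
  also have "\<dots> = (\<Sum>i\<in>UNIV. \<Sum>b\<in>Basis. inner b (e i) *\<^sub>R \<beta> b (e i)) - (\<Sum>\<alpha>\<in>UNIV. \<Sum>b\<in>Basis. inner b (\<nu> \<alpha>) *\<^sub>R \<beta>
      b (\<nu> \<alpha>))"
    by (simp add: sum_subtractf sum.swap[of _ Basis])
  finally show ?thesis by (simp add: *)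
qed

definition lin_trace :: "('a::euclidean_space \<Rightarrow>\<^sub>L 'a) \<Rightarrow> real" where
  "lin_trace L = (\<Sum>b\<in>Basis. inner (L b) b)"

lemma bounded_linear_lin_trace: "bounded_linear lin_trace"
  unfolding lin_trace_def
  by (intro bounded_linear_sum bounded_linear_inner_left_comp bounded_linear_apply_blinfun
      bounded_linear_ident)

lemmas linear_lin_trace = bounded_linear.linear[OF bounded_linear_lin_trace]

lemmas lin_trace_simps = linear_add[OF linear_lin_trace] linear_diff[OF linear_lin_trace] linear_neg[OF
    linear_lin_trace]
  linear_scale[OF linear_lin_trace] linear_sum[OF linear_lin_trace] linear_0[OF linear_lin_trace]

text \<open>The trace expands into a double sum that is symmetric in \<open>A\<close> and \<open>B\<close>.\<close>

lemma lin_trace_compose_commute: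
  fixes A B :: "'a::euclidean_space \<Rightarrow>\<^sub>L 'a"
  shows "lin_trace (A o\<^sub>L B) = lin_trace (B o\<^sub>L A)"
proof -
  have *: "lin_trace (A o\<^sub>L B) = (\<Sum>b\<in>Basis. \<Sum>c\<in>Basis. inner (B b) c * inner (A c) b)" for A B :: "'a \<Rightarrow>\<^sub>L 'a"
  proof -
    have "inner (A (B b)) b = (\<Sum>c\<in>Basis. inner (B b) c * inner (A c) b)" for b
      by (subst euclidean_representation[of "B b", symmetric])
         (simp add: blinfun.bilinear_simps inner_sum_left)
    then show ?thesis by (simp add: lin_trace_def)
  qed
  show ?thesis unfolding * by (subst sum.swap) (simp add: mult.commute)
qed

lemma lin_trace_adapted_frame:
  assumes "adapted_frame S e \<nu>"
  shows "lin_trace L = (\<Sum>i\<in>UNIV. pinner (L (e i)) (e i)) - (\<Sum>\<alpha>\<in>UNIV. pinner (L (\<nu> \<alpha>)) (\<nu> \<alpha>))"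
proof -
  have "lin_trace L = (\<Sum>b\<in>Basis. pinner (L b) (flip b))" by (simp add: lin_trace_def pinner_flip_right)
  also have "\<dots> = (\<Sum>i\<in>UNIV. pinner (L (e i)) (e i)) - (\<Sum>\<alpha>\<in>UNIV. pinner (L (\<nu> \<alpha>)) (\<nu> \<alpha>))"
    by (rule contraction_adapted_frame[OF assms])
       (rule linearI; simp only: pinner_simps blinfun.bilinear_simps real_scaleR_def)+
  finally show ?thesis .
qed

section \<open>Charts, tangent spaces and smooth functions\<close>

locale spacelike_immersion =
  fixes \<A> :: "('p::{t2_space, second_countable_topology}, 'n::finite) atlas"
    and F :: "('p, 'n, 'm::finite) amb_map"
  assumes submanifold: "spacelike_submanifold \<A> F"
begin

definition param :: "'p set \<times> ('p \<Rightarrow> real ^ 'n) \<Rightarrow> real ^ 'n \<Rightarrow> 'p" where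
  "param c = inv_into (fst c) (snd c)"

definition coord_range :: "'p set \<times> ('p \<Rightarrow> real ^ 'n) \<Rightarrow> (real ^ 'n) set" where
  "coord_range c = snd c ` fst c"

lemma chart_homeomorphism:
  assumes "c \<in> \<A>"
  shows "open (fst c)" "open (coord_range c)" "homeomorphism (fst c) (coord_range c) (snd c) (param c)"
  using submanifold assms unfolding spacelike_submanifold_def smooth_atlas_def coord_range_def param_def
  by (auto split: prod.splits)

lemma param_coord: "c \<in> \<A> \<Longrightarrow> p \<in> fst c \<Longrightarrow> param c (snd c p) = p"
  using chart_homeomorphism(3) by (auto simp: homeomorphism_def)

lemma coord_param: "c \<in> \<A> \<Longrightarrow> x \<in> coord_range c \<Longrightarrow> snd c (param c x) = x"
  using chart_homeomorphism(3) by (auto simp: homeomorphism_def)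

lemma param_in: "c \<in> \<A> \<Longrightarrow> x \<in> coord_range c \<Longrightarrow> param c x \<in> fst c"
  using chart_homeomorphism(3) by (fastforce simp: homeomorphism_def)

lemma coord_in: "p \<in> fst c \<Longrightarrow> snd c p \<in> coord_range c"
  by (simp add: coord_range_def)

lemma charts_cover: "\<exists>c\<in>\<A>. p \<in> fst c"
proof -
  have "p \<in> (\<Union>(U, \<phi>)\<in>\<A>. U)" using submanifold by (simp add: spacelike_submanifold_def smooth_atlas_def)
  then show ?thesis by (auto intro: bexI[rotated])
qed

lemma chart_at: "chart_at \<A> p \<in> \<A>" "p \<in> fst (chart_at \<A> p)"
proof -
  have "\<exists>c. c \<in> \<A> \<and> p \<in> fst c" using charts_cover[of p] by blast
  from someI_ex[OF this] show "chart_at \<A> p \<in> \<A>" "p \<in> fst (chart_at \<A> p)"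
    unfolding chart_at_def by blast+
qed

lemma transition_smooth:
  assumes "c \<in> \<A>" "d \<in> \<A>"
  shows "smooth_on (snd c ` (fst c \<inter> fst d)) (snd d \<circ> param c)"
  using submanifold assms unfolding spacelike_submanifold_def smooth_atlas_def param_def
  by (fastforce split: prod.splits)

lemma transition_domain_open:
  assumes "c \<in> \<A>" "d \<in> \<A>"
  shows "open (snd c ` (fst c \<inter> fst d))"
proof -
  have "open (param c -` fst d \<inter> coord_range c)"
    using chart_homeomorphism[OF assms(1)] chart_homeomorphism(1)[OF assms(2)]
    by (metis continuous_on_open_vimage homeomorphism_def)
  moreover have "param c -` fst d \<inter> coord_range c = snd c ` (fst c \<inter> fst d)"
    using param_coord[OF assms(1)] by (auto simp: coord_range_def)
  ultimately show ?thesis by simp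
qed

definition chart_deriv :: "'p set \<times> ('p \<Rightarrow> real ^ 'n) \<Rightarrow> ('p \<Rightarrow> 'b::real_normed_vector) \<Rightarrow> 'p \<Rightarrow> real ^ 'n \<Rightarrow>
    'b" where
  "chart_deriv c f p = frechet_derivative (f \<circ> param c) (at (snd c p))"

lemma differential_eq: "differential \<A> f p = chart_deriv (chart_at \<A> p) f p"
  by (simp add: differential_def chart_deriv_def param_def split: prod.splits)

text \<open>Chain rule for a change of charts, whose differential is \<open>chart_deriv c (snd d) p\<close>.\<close>

lemma chart_deriv_change:
  assumes c: "c \<in> \<A>" "p \<in> fst c" and d: "d \<in> \<A>" "p \<in> fst d"
    and f: "(f \<circ> param d) differentiable (at (snd d p))"
  shows "(f \<circ> param c) differentiable (at (snd c p))"
    and "chart_deriv c f p \<xi> = chart_deriv d f p (chart_deriv c (snd d) p \<xi>)"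
proof -
  let ?O = "snd c ` (fst c \<inter> fst d)"
  have m: "snd c p \<in> ?O" using c d by auto
  have 1: "((snd d \<circ> param c) has_derivative chart_deriv c (snd d) p) (at (snd c p))"
    unfolding chart_deriv_def by (rule smooth_on_has_derivative[OF transition_smooth[OF c(1) d(1)] m])
  have "((f \<circ> param d) has_derivative chart_deriv d f p) (at ((snd d \<circ> param c) (snd c p)))"
    using f param_coord[OF c] by (simp add: chart_deriv_def frechet_derivative_works)
  from diff_chain_at[OF 1 this]
  have "((f \<circ> param d \<circ> (snd d \<circ> param c)) has_derivative (chart_deriv d f p \<circ> chart_deriv c (snd d) p))
      (at (snd c p))" .
  then have h: "((f \<circ> param c) has_derivative (chart_deriv d f p \<circ> chart_deriv c (snd d) p)) (at (snd c
      p))"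
    by (rule has_derivative_transform_within_open[OF _ transition_domain_open[OF c(1) d(1)] m])
       (use param_coord[OF c(1)] param_coord[OF d(1)] in auto)
  then show "(f \<circ> param c) differentiable (at (snd c p))" by (auto simp: differentiable_def)
  show "chart_deriv c f p \<xi> = chart_deriv d f p (chart_deriv c (snd d) p \<xi>)"
    using frechet_derivative_at[OF h] by (metis chart_deriv_def comp_apply)
qed

lemma chart_deriv_coord:
  assumes "c \<in> \<A>" "p \<in> fst c"
  shows "chart_deriv c (snd c) p \<xi> = \<xi>"
proof -
  have "((snd c \<circ> param c) has_derivative (\<lambda>x. x)) (at (snd c p))"
    by (rule has_derivative_transform_within_open[OF has_derivative_ident chart_homeomorphism(2)[OF
        assms(1)] coord_in[OF assms(2)]])
       (simp add: coord_param[OF assms(1)])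
  from frechet_derivative_at[OF this] show ?thesis unfolding chart_deriv_def by (rule fun_cong[symmetric])
qed

text \<open>The chain rule for the vector-valued function \<open>snd c\<close>, whose derivative in the chart \<open>c\<close> is
  the identity.\<close>

lemma transition_cancel:
  assumes c: "c \<in> \<A>" "p \<in> fst c" and d: "d \<in> \<A>" "p \<in> fst d"
  shows "chart_deriv d (snd c) p (chart_deriv c (snd d) p \<xi>) = \<xi>"
proof -
  have "(snd c \<circ> param d) differentiable (at (snd d p))"
    by (rule smooth_on_differentiable[OF transition_smooth[OF d(1) c(1)]]) (use c d in auto)
  from chart_deriv_change(2)[OF c d this, of \<xi>] show ?thesis unfolding chart_deriv_coord[OF c] by (rule
      sym)
qed

definition smooth_fun :: "('p \<Rightarrow> 'b::real_normed_vector) \<Rightarrow> bool" where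
  "smooth_fun f \<longleftrightarrow> (\<forall>c\<in>\<A>. smooth_on (coord_range c) (f \<circ> param c))"

lemma smooth_funD: "smooth_fun f \<Longrightarrow> c \<in> \<A> \<Longrightarrow> smooth_on (coord_range c) (f \<circ> param c)"
  by (simp add: smooth_fun_def)

lemma smooth_fun_differentiable:
  "smooth_fun f \<Longrightarrow> c \<in> \<A> \<Longrightarrow> x \<in> coord_range c \<Longrightarrow> (f \<circ> param c) differentiable (at x)"
  using smooth_on_differentiable smooth_funD by blast

lemma smooth_fun_has_derivative:
  "smooth_fun f \<Longrightarrow> c \<in> \<A> \<Longrightarrow> x \<in> coord_range c \<Longrightarrow>
   ((f \<circ> param c) has_derivative frechet_derivative (f \<circ> param c) (at x)) (at x)"
  using smooth_fun_differentiable frechet_derivative_works by blast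

lemma smooth_fun_const: "smooth_fun (\<lambda>p. k)"
  by (auto simp: smooth_fun_def comp_def smooth_on_const)

lemma smooth_fun_add: "smooth_fun f \<Longrightarrow> smooth_fun g \<Longrightarrow> smooth_fun (\<lambda>p. f p + g p)"
  by (auto simp: smooth_fun_def comp_def intro!: smooth_on_add chart_homeomorphism(2))

lemma smooth_fun_linear: "bounded_linear L \<Longrightarrow> smooth_fun f \<Longrightarrow> smooth_fun (\<lambda>p. L (f p))"
  using smooth_on_linear[OF chart_homeomorphism(2)] by (fastforce simp: smooth_fun_def comp_def)

lemma smooth_fun_bilinear:
  "bounded_bilinear bop \<Longrightarrow> smooth_fun f \<Longrightarrow> smooth_fun g \<Longrightarrow> smooth_fun (\<lambda>p. bop (f p) (g p))"
  using smooth_on_bilinear[OF chart_homeomorphism(2)] by (fastforce simp: smooth_fun_def comp_def)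

lemma smooth_fun_minus: "smooth_fun f \<Longrightarrow> smooth_fun (\<lambda>p. - f p)"
  by (rule smooth_fun_linear[OF bounded_linear_minus[OF bounded_linear_ident]])

lemma smooth_fun_diff: "smooth_fun f \<Longrightarrow> smooth_fun g \<Longrightarrow> smooth_fun (\<lambda>p. f p - g p)"
  using smooth_fun_add[OF _ smooth_fun_minus, of f g] by simp

lemma smooth_fun_sum: "finite I \<Longrightarrow> (\<And>i. i \<in> I \<Longrightarrow> smooth_fun (f i)) \<Longrightarrow> smooth_fun (\<lambda>p. \<Sum>i\<in>I. f i p)"
  by (induction I rule: finite_induct) (auto simp: smooth_fun_const intro!: smooth_fun_add)

lemma smooth_fun_det:
  fixes M :: "'p \<Rightarrow> real ^ 'k ^ 'k::finite"
  assumes "\<And>i j. smooth_fun (\<lambda>p. M p $ i $ j)"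
  shows "smooth_fun (\<lambda>p. det (M p))"
  using assms smooth_on_det[OF chart_homeomorphism(2)] by (fastforce simp: smooth_fun_def comp_def)

lemma smooth_fun_ln:
  fixes f :: "'p \<Rightarrow> real"
  assumes "smooth_fun f" "\<And>p. f p > 0"
  shows "smooth_fun (\<lambda>p. ln (f p))"
  using assms smooth_on_ln[OF chart_homeomorphism(2)] by (fastforce simp: smooth_fun_def comp_def)

lemma smooth_fun_F: "smooth_fun F"
  using submanifold unfolding spacelike_submanifold_def smooth_fun_def param_def coord_range_def
  by (auto split: prod.splits)

lemma smooth_fun_diff_at: "smooth_fun f \<Longrightarrow> c \<in> \<A> \<Longrightarrow> p \<in> fst c \<Longrightarrow> (f \<circ> param c) differentiable (at (snd c p))"
  using smooth_fun_differentiable coord_in by blast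

text \<open>Known for the chart selected by \<open>chart_at\<close>; a change of charts has an injective
  differential.\<close>

lemma chart_deriv_F_pos:
  assumes c: "c \<in> \<A>" "p \<in> fst c" and "\<xi> \<noteq> 0"
  shows "pinner (chart_deriv c F p \<xi>) (chart_deriv c F p \<xi>) > 0"
proof -
  let ?d = "chart_at \<A> p"
  have "chart_deriv c (snd ?d) p \<xi> \<noteq> 0"
  proof
    assume "chart_deriv c (snd ?d) p \<xi> = 0"
    then have "chart_deriv ?d (snd c) p 0 = \<xi>" using transition_cancel[OF c chart_at, of \<xi>] by simp
    moreover have "chart_deriv ?d (snd c) p 0 = 0"
      unfolding chart_deriv_def
      by (intro linear_0 linear_frechet_derivative smooth_on_differentiable[OF transition_smooth[OF
          chart_at(1) c(1)]])
         (use c chart_at in auto)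
    ultimately show False using assms(3) by simp
  qed
  then show ?thesis
    using chart_deriv_change(2)[OF c chart_at smooth_fun_diff_at[OF smooth_fun_F chart_at], of \<xi>]
      submanifold by (simp add: spacelike_submanifold_def differential_eq)
qed

lemma linear_chart_deriv:
  "smooth_fun f \<Longrightarrow> c \<in> \<A> \<Longrightarrow> p \<in> fst c \<Longrightarrow> linear (chart_deriv c f p)"
  unfolding chart_deriv_def by (intro linear_frechet_derivative smooth_fun_diff_at)

lemma inj_chart_deriv_F:
  assumes "c \<in> \<A>" "p \<in> fst c"
  shows "inj (chart_deriv c F p)"
proof (rule linear_injective_0[THEN iffD2, rule_format])
  show "linear (chart_deriv c F p)" by (rule linear_chart_deriv[OF smooth_fun_F assms])
  fix \<xi> assume "chart_deriv c F p \<xi> = 0"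
  then show "\<xi> = 0" using chart_deriv_F_pos[OF assms, of \<xi>] by (auto simp: pinner_simps)
qed

lemma tangent_space_chart:
  assumes c: "c \<in> \<A>" "p \<in> fst c"
  shows "tangent_space \<A> F p = range (chart_deriv c F p)"
proof -
  have "range (chart_deriv c F p) \<subseteq> range (chart_deriv d F p)" if "c \<in> \<A>" "p \<in> fst c" "d \<in> \<A>" "p \<in> fst d"
      for c d
    using chart_deriv_change(2)[OF that smooth_fun_diff_at[OF smooth_fun_F that(3,4)]] by auto
  from this[OF c chart_at] this[OF chart_at c] show ?thesis
    by (auto simp: tangent_space_def differential_eq)
qed

text \<open>A change of charts acts in the same way on the coordinates of the tangent vector and on the
  derivative.\<close>

lemma dir_deriv_chart:
  assumes c: "c \<in> \<A>" "p \<in> fst c" and f: "(f \<circ> param c) differentiable (at (snd c p))"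
  shows "dir_deriv \<A> F p (chart_deriv c F p \<xi>) f = chart_deriv c f p \<xi>"
proof -
  let ?d = "chart_at \<A> p" and ?\<eta> = "chart_deriv c (snd (chart_at \<A> p)) p \<xi>"
  have 1: "chart_deriv c F p \<xi> = chart_deriv ?d F p ?\<eta>"
    by (rule chart_deriv_change(2)[OF c chart_at smooth_fun_diff_at[OF smooth_fun_F chart_at]])
  have "(THE \<eta>. chart_deriv ?d F p \<eta> = chart_deriv c F p \<xi>) = ?\<eta>"
    unfolding 1 by (simp add: inj_eq[OF inj_chart_deriv_F[OF chart_at]])
  then have "dir_deriv \<A> F p (chart_deriv c F p \<xi>) f = chart_deriv ?d f p ?\<eta>"
    by (simp add: dir_deriv_def differential_eq)
  also have "\<dots> = chart_deriv c f p \<xi>"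
    by (rule chart_deriv_change(2)[OF c chart_at chart_deriv_change(1)[OF chart_at c f], symmetric])
  finally show ?thesis .
qed

lemma tangent_space_spacelike:
  "subspace (tangent_space \<A> F p)" "dim (tangent_space \<A> F p) = CARD('n)" "spacelike_on (tangent_space \<A> F
      p)"
proof -
  let ?c = "chart_at \<A> p"
  have lin: "linear (chart_deriv ?c F p)" by (rule linear_chart_deriv[OF smooth_fun_F chart_at])
  have eq: "tangent_space \<A> F p = range (chart_deriv ?c F p)" by (rule tangent_space_chart[OF chart_at])
  show "subspace (tangent_space \<A> F p)" unfolding eq using lin by (simp add: linear_subspace_image)
  show "dim (tangent_space \<A> F p) = CARD('n)" unfolding eq
    using dim_image_eq[OF lin, of UNIV] inj_chart_deriv_F[OF chart_at] by simp
  show "spacelike_on (tangent_space \<A> F p)" unfolding eq spacelike_on_def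
  proof (intro ballI impI)
    fix v assume "v \<in> range (chart_deriv ?c F p)" "v \<noteq> 0"
    then obtain \<xi> where "v = chart_deriv ?c F p \<xi>" "\<xi> \<noteq> 0" using linear_0[OF lin] by (metis imageE)
    then show "pinner v v > 0" using chart_deriv_F_pos[OF chart_at] by simp
  qed
qed

lemma normal_space_eq: "normal_space \<A> F p = orth_compl (tangent_space \<A> F p)"
  by (simp add: normal_space_def orth_compl_def)

lemma tan_proj_eqI:
  assumes "t \<in> tangent_space \<A> F p" "v - t \<in> normal_space \<A> F p"
  shows "tan_proj \<A> F p v = t"
  unfolding tan_proj_def
proof (rule the_equality)
  fix s assume s: "s \<in> tangent_space \<A> F p \<and> v - s \<in> normal_space \<A> F p"
  then have "s - t \<in> tangent_space \<A> F p" using assms tangent_space_spacelike(1) by (simp add: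
      subspace_diff)
  moreover have "(v - t) - (v - s) \<in> normal_space \<A> F p"
    using subspace_diff[OF subspace_orth_compl, of "v - t" _ "v - s"] s assms(2) unfolding normal_space_eq
        by blast
  ultimately have "s - t \<in> tangent_space \<A> F p \<inter> orth_compl (tangent_space \<A> F p)" by (simp add:
      normal_space_eq)
  then show "s = t"
    using spacelike_orth_compl_dim(3)[OF tangent_space_spacelike(3,1,2)] by auto
qed (use assms in simp)

lemma tan_proj_in: "tan_proj \<A> F p v \<in> tangent_space \<A> F p" "v - tan_proj \<A> F p v \<in> normal_space \<A> F p"
proof -
  obtain t where t: "t \<in> tangent_space \<A> F p" "v - t \<in> normal_space \<A> F p"
    using spacelike_orth_compl_dim(2)[OF tangent_space_spacelike(3,1,2), of p v] unfolding normal_space_eq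
        by blast
  with tan_proj_eqI[OF this] show "tan_proj \<A> F p v \<in> tangent_space \<A> F p" "v - tan_proj \<A> F p v \<in>
      normal_space \<A> F p"
    by auto
qed

lemma linear_tan_proj: "linear (tan_proj \<A> F p)"
proof (rule linearI)
  fix u v r
  note ts = tangent_space_spacelike(1)[of p] and ns = subspace_orth_compl[of "tangent_space \<A> F p", folded
      normal_space_eq]
  have "u + v - (tan_proj \<A> F p u + tan_proj \<A> F p v) = (u - tan_proj \<A> F p u) + (v - tan_proj \<A> F p v)"
      by simp
  then have "u + v - (tan_proj \<A> F p u + tan_proj \<A> F p v) \<in> normal_space \<A> F p"
    using subspace_add[OF ns] tan_proj_in by metis
  then show "tan_proj \<A> F p (u + v) = tan_proj \<A> F p u + tan_proj \<A> F p v"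
    by (intro tan_proj_eqI subspace_add[OF ts] tan_proj_in)
  have "r *\<^sub>R u - r *\<^sub>R tan_proj \<A> F p u \<in> normal_space \<A> F p"
    using subspace_scale[OF ns tan_proj_in(2)] by (metis scaleR_diff_right)
  then show "tan_proj \<A> F p (r *\<^sub>R u) = r *\<^sub>R tan_proj \<A> F p u"
    by (intro tan_proj_eqI subspace_scale[OF ts] tan_proj_in)
qed

text \<open>As a bounded operator, the tangent projection is a function into a normed space, so that it
  can be differentiated like any other smooth function.\<close>

definition T :: "'p \<Rightarrow> ('n, 'm) pseudo_space \<Rightarrow>\<^sub>L ('n, 'm) pseudo_space" where
  "T p = Blinfun (tan_proj \<A> F p)"

lemma tan_proj_T: "tan_proj \<A> F p = T p"
  by (simp add: T_def bounded_linear_Blinfun_apply linear_conv_bounded_linear[symmetric] linear_tan_proj)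

lemma nor_proj_T: "nor_proj \<A> F p v = v - T p v"
  by (simp add: nor_proj_def tan_proj_T)

lemma T_in: "T p v \<in> tangent_space \<A> F p"
  using tan_proj_in by (simp add: tan_proj_T)

lemma T_tangent: "v \<in> tangent_space \<A> F p \<Longrightarrow> T p v = v"
  unfolding tan_proj_T[symmetric] using tan_proj_eqI[of v p v] by (simp add: normal_space_eq subspace_0[OF
      subspace_orth_compl])

lemma T_normal: "v \<in> normal_space \<A> F p \<Longrightarrow> T p v = 0"
  unfolding tan_proj_T[symmetric] using tan_proj_eqI[of 0 p v] subspace_0[OF tangent_space_spacelike(1)]
      by simp

lemma tangent_space_iff: "v \<in> tangent_space \<A> F p \<longleftrightarrow> T p v = v"
  using T_in T_tangent by metis

lemma T_T [simp]: "T p (T p v) = T p v"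
  by (rule T_tangent[OF T_in])

lemma pinner_T: "pinner (T p u) v = pinner u (T p v)"
proof -
  have *: "pinner (T p u) (v - T p v) = 0" for u v
    using tan_proj_in(2)[of v p] T_in by (simp add: normal_space_def tan_proj_T pinner_commute[of "T p
        u"])
  show ?thesis using *[of u v] *[of v u] by (simp add: pinner_simps pinner_commute)
qed

lemma normal_space_iff: "v \<in> normal_space \<A> F p \<longleftrightarrow> T p v = 0"
proof
  assume "T p v = 0"
  then show "v \<in> normal_space \<A> F p" using tan_proj_in(2)[of v p] by (simp add: tan_proj_T)
qed (rule T_normal)

lemma T_idem: "T p o\<^sub>L T p = T p"
  by (rule blinfun_eqI) simp

section \<open>Smoothness of the tangent projection\<close>

definition coord_vec :: "'p set \<times> ('p \<Rightarrow> real ^ 'n) \<Rightarrow> 'n \<Rightarrow> real ^ 'n \<Rightarrow> ('n, 'm) pseudo_space" where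
  "coord_vec c i x = frechet_derivative (F \<circ> param c) (at x) (axis i 1)"

text \<open>Cramer's rule for the coordinates of the tangential part of a constant vector.\<close>

definition tan_coord :: "'p set \<times> ('p \<Rightarrow> real ^ 'n) \<Rightarrow> ('n, 'm) pseudo_space \<Rightarrow> real ^ 'n \<Rightarrow> real ^ 'n" where
  "tan_coord c v x = (\<chi> k. det (\<chi> i j. if j = k then pinner v (coord_vec c i x) else pinner (coord_vec c i
      x) (coord_vec c j x))
      * inverse (det (\<chi> i j. pinner (coord_vec c i x) (coord_vec c j x))))"

lemma frechet_derivative_axis:
  assumes "f differentiable (at x)"
  shows "frechet_derivative f (at x) \<xi> = (\<Sum>k\<in>UNIV. \<xi> $ k *\<^sub>R frechet_derivative f (at x) (axis k 1))"
proof -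
  have lin: "linear (frechet_derivative f (at x))" by (rule linear_frechet_derivative[OF assms])
  have "\<xi> = (\<Sum>k\<in>UNIV. \<xi> $ k *\<^sub>R axis k 1)"
    using basis_expansion[of \<xi>] by (simp add: scalar_mult_eq_scaleR)
  then have "frechet_derivative f (at x) \<xi> = frechet_derivative f (at x) (\<Sum>k\<in>UNIV. \<xi> $ k *\<^sub>R axis k 1)" by
      simp
  then show ?thesis by (simp add: linear_sum[OF lin] linear_scale[OF lin])
qed

lemma coord_vec_sum:
  assumes "c \<in> \<A>" "x \<in> coord_range c"
  shows "chart_deriv c F (param c x) \<xi> = (\<Sum>k\<in>UNIV. \<xi> $ k *\<^sub>R coord_vec c k x)"
  unfolding chart_deriv_def coord_vec_def coord_param[OF assms]
  by (rule frechet_derivative_axis[OF smooth_fun_differentiable[OF smooth_fun_F assms]])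

lemma gram_det_nonzero:
  assumes c: "c \<in> \<A>" "x \<in> coord_range c"
  shows "det (\<chi> i j. pinner (coord_vec c i x) (coord_vec c j x)) \<noteq> 0"
proof -
  let ?g = "\<chi> i j. pinner (coord_vec c i x) (coord_vec c j x)"
  have "y = 0" if "?g *v y = 0" for y
  proof (rule ccontr)
    assume "y \<noteq> 0"
    let ?w = "chart_deriv c F (param c x) y"
    have "pinner ?w ?w > 0" by (rule chart_deriv_F_pos[OF c(1) param_in[OF c] \<open>y \<noteq> 0\<close>])
    moreover have "pinner (coord_vec c i x) ?w = (?g *v y) $ i" for i
      by (simp add: coord_vec_sum[OF c] pinner_simps matrix_vector_mult_def mult.commute)
    then have "pinner (coord_vec c i x) ?w = 0" for i using that by simp
    then have "pinner ?w ?w = 0" by (subst (1) coord_vec_sum[OF c]) (simp add: pinner.sum_left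
        pinner.scaleR_left)
    ultimately show False by simp
  qed
  then have "invertible ?g" using matrix_left_invertible_ker[of ?g] invertible_left_inverse[of ?g] by
      blast
  then show ?thesis using invertible_det_nz by blast
qed

lemma tan_coord:
  assumes c: "c \<in> \<A>" "x \<in> coord_range c"
  shows "chart_deriv c F (param c x) (tan_coord c v x) = T (param c x) v"
proof -
  let ?g = "\<chi> i j. pinner (coord_vec c i x) (coord_vec c j x)"
  let ?b = "\<chi> i. pinner v (coord_vec c i x)"
  let ?w = "chart_deriv c F (param c x) (tan_coord c v x)"
  have "?g *v tan_coord c v x = ?b"
    by (subst cramer[OF gram_det_nonzero[OF c]])
       (simp add: tan_coord_def vec_eq_iff divide_inverse cong: if_cong)
  then have "(?g *v tan_coord c v x) $ i = ?b $ i" for i by simp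
  then have e: "pinner ?w (coord_vec c i x) = pinner v (coord_vec c i x)" for i
    by (simp add: coord_vec_sum[OF c] pinner_simps matrix_vector_mult_def mult.commute pinner_commute[of _
        "coord_vec c i x"])
  have "v - ?w \<in> normal_space \<A> F (param c x)"
    unfolding normal_space_def tangent_space_chart[OF c(1) param_in[OF c]]
    by (auto simp: coord_vec_sum[OF c] pinner.sum_right pinner.scaleR_right)
       (use e in \<open>simp add: pinner.diff_left coord_vec_sum[OF c]\<close>)
  moreover have "?w \<in> tangent_space \<A> F (param c x)" using tangent_space_chart[OF c(1) param_in[OF c]] by
      auto
  ultimately show ?thesis using tan_proj_eqI by (simp add: tan_proj_T)
qed

lemma smooth_on_coord_vec: "c \<in> \<A> \<Longrightarrow> smooth_on (coord_range c) (coord_vec c i)"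
  unfolding coord_vec_def[abs_def] by (intro smooth_on_derivative smooth_funD smooth_fun_F)

lemma smooth_on_tan_coord:
  assumes "c \<in> \<A>"
  shows "smooth_on (coord_range c) (\<lambda>x. tan_coord c v x $ k)"
proof -
  note o = chart_homeomorphism(2)[OF assms] and cv = smooth_on_coord_vec[OF assms]
  have g: "smooth_on (coord_range c) (\<lambda>x. pinner (coord_vec c i x) (coord_vec c j x))" for i j
    by (rule smooth_on_bilinear[OF o bounded_bilinear_pinner cv cv])
  have b: "smooth_on (coord_range c) (\<lambda>x. pinner v (coord_vec c i x))" for i
    by (rule smooth_on_linear[OF o pinner.bounded_linear_right cv])
  show ?thesis unfolding tan_coord_def vec_lambda_beta
  proof (rule smooth_on_bilinear[OF o bounded_bilinear_mult smooth_on_det[OF o] smooth_on_inverse[OF o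
      smooth_on_det[OF o]]])
    show "smooth_on (coord_range c) (\<lambda>x. (\<chi> i j. if j = k then pinner v (coord_vec c i x) else pinner
        (coord_vec c i x) (coord_vec c j x)) $ i $ j)" for i j
      using g b by (cases "j = k") auto
    show "smooth_on (coord_range c) (\<lambda>x. (\<chi> i j. pinner (coord_vec c i x) (coord_vec c j x)) $ i $ j)" for
        i j
      using g by simp
  qed (use gram_det_nonzero[OF assms] in auto)
qed

text \<open>Reduces smoothness of the operator-valued function \<open>T\<close> to that of its values on constant
  vectors: the right side is linear in the vectors \<open>T p b\<close>.\<close>

lemma T_representation:
  "T p = (\<Sum>b\<in>Basis. blinfun_scaleR_left (T p b) o\<^sub>L blinfun_inner_right b)"
proof (rule blinfun_eqI)
  fix v
  have "T p v = T p (\<Sum>b\<in>Basis. inner v b *\<^sub>R b)" by (simp add: euclidean_representation)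
  then show "T p v = (\<Sum>b\<in>Basis. blinfun_scaleR_left (T p b) o\<^sub>L blinfun_inner_right b) v"
    by (simp add: blinfun.bilinear_simps inner_commute)
qed

lemma smooth_fun_T: "smooth_fun T"
proof -
  have "smooth_on (coord_range c) (\<lambda>x. T (param c x) v)" if c: "c \<in> \<A>" for c v
  proof (rule smooth_on_cong[OF chart_homeomorphism(2)[OF c]])
    show "(\<Sum>k\<in>UNIV. tan_coord c v x $ k *\<^sub>R coord_vec c k x) = T (param c x) v" if "x \<in> coord_range c" for
        x
      using tan_coord[OF c that] by (simp add: coord_vec_sum[OF c that])
    show "smooth_on (coord_range c) (\<lambda>x. \<Sum>k\<in>UNIV. tan_coord c v x $ k *\<^sub>R coord_vec c k x)"
      using chart_homeomorphism(2)[OF c] smooth_on_tan_coord[OF c] smooth_on_coord_vec[OF c]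
      by (intro smooth_on_sum smooth_on_bilinear[OF _ bounded_bilinear_scaleR]) auto
  qed
  then have "smooth_fun (\<lambda>p. T p v)" for v by (simp add: smooth_fun_def comp_def)
  then have "smooth_fun (\<lambda>p. \<Sum>b\<in>Basis. blinfun_scaleR_left (T p b) o\<^sub>L blinfun_inner_right b)"
    by (intro smooth_fun_sum smooth_fun_bilinear[OF bounded_bilinear_blinfun_compose] smooth_fun_const
        smooth_fun_linear[OF bounded_linear_blinfun_scaleR_left]) auto
  then show ?thesis unfolding T_representation[symmetric] .
qed

section \<open>Derivations along projected constant vectors\<close>

text \<open>The derivative in the direction of the tangential part of a constant vector \<open>v\<close>. These
  derivations are defined on all of \<open>M\<close>, which makes them substitutes for a frame.\<close>

definition D :: "('n, 'm) pseudo_space \<Rightarrow> ('p \<Rightarrow> 'b::real_normed_vector) \<Rightarrow> 'p \<Rightarrow> 'b" where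
  "D v f p = dir_deriv \<A> F p (T p v) f"

lemma D_chart:
  assumes c: "c \<in> \<A>" "x \<in> coord_range c" and f: "((f \<circ> param c) has_derivative f') (at x)"
  shows "D v f (param c x) = f' (tan_coord c v x)"
proof -
  have "(f \<circ> param c) differentiable (at (snd c (param c x)))"
    using f coord_param[OF c] by (auto simp: differentiable_def)
  from dir_deriv_chart[OF c(1) param_in[OF c] this, of "tan_coord c v x"]
  show ?thesis unfolding tan_coord[OF c] D_def by (simp only: chart_deriv_def coord_param[OF c]
      frechet_derivative_at[OF f, symmetric])
qed

lemma D_chart_smooth:
  assumes "c \<in> \<A>" "x \<in> coord_range c" "smooth_fun f"
  shows "D v f (param c x) = frechet_derivative (f \<circ> param c) (at x) (tan_coord c v x)"
  by (rule D_chart[OF assms(1,2) smooth_fun_has_derivative[OF assms(3,1,2)]])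

lemma in_some_chart: obtains c x where "c \<in> \<A>" "x \<in> coord_range c" "p = param c x"
  using charts_cover[of p] coord_in param_coord by metis

lemma D_T: "D (T p v) f p = D v f p"
  by (simp add: D_def)

lemma D_const [simp]: "D v (\<lambda>q. k) p = 0"
proof -
  obtain c x where c: "c \<in> \<A>" "x \<in> coord_range c" "p = param c x" using in_some_chart .
  show ?thesis unfolding c(3) by (rule D_chart[OF c(1,2)]) (simp add: comp_def)
qed

lemma D_linear:
  assumes "bounded_linear L" "smooth_fun f"
  shows "D v (\<lambda>q. L (f q)) p = L (D v f p)"
proof -
  obtain c x where c: "c \<in> \<A>" "x \<in> coord_range c" "p = param c x" using in_some_chart .
  show ?thesis unfolding c(3) D_chart_smooth[OF c(1,2) assms(2)]
    by (rule D_chart[OF c(1,2)])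
       (use bounded_linear.has_derivative[OF assms(1) smooth_fun_has_derivative[OF assms(2) c(1,2)]] in
           \<open>simp add: comp_def\<close>)
qed

lemma D_bilinear:
  assumes "bounded_bilinear bop" "smooth_fun f" "smooth_fun g"
  shows "D v (\<lambda>q. bop (f q) (g q)) p = bop (D v f p) (g p) + bop (f p) (D v g p)"
proof -
  obtain c x where c: "c \<in> \<A>" "x \<in> coord_range c" "p = param c x" using in_some_chart .
  have "D v (\<lambda>q. bop (f q) (g q)) (param c x) = bop ((f \<circ> param c) x) (D v g p) + bop (D v f p) ((g \<circ>
      param c) x)"
    unfolding c(3) D_chart_smooth[OF c(1,2) assms(2)] D_chart_smooth[OF c(1,2) assms(3)]
    by (rule D_chart[OF c(1,2)])
       (use bounded_bilinear.FDERIV[OF assms(1) smooth_fun_has_derivative[OF assms(2) c(1,2)]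
           smooth_fun_has_derivative[OF assms(3) c(1,2)]]
         in \<open>simp add: comp_def\<close>)
  then show ?thesis by (simp add: c(3))
qed

lemma D_add:
  assumes "smooth_fun f" "smooth_fun g"
  shows "D v (\<lambda>q. f q + g q) p = D v f p + D v g p"
proof -
  obtain c x where c: "c \<in> \<A>" "x \<in> coord_range c" "p = param c x" using in_some_chart .
  show ?thesis unfolding c(3) D_chart_smooth[OF c(1,2) assms(1)] D_chart_smooth[OF c(1,2) assms(2)]
    by (rule D_chart[OF c(1,2)])
       (use has_derivative_add[OF smooth_fun_has_derivative[OF assms(1) c(1,2)]
           smooth_fun_has_derivative[OF assms(2) c(1,2)]]
         in \<open>simp add: comp_def\<close>)
qed

lemma D_minus: "smooth_fun f \<Longrightarrow> D v (\<lambda>q. - f q) p = - D v f p"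
  by (rule D_linear[OF bounded_linear_minus[OF bounded_linear_ident]])

lemma D_diff: "smooth_fun f \<Longrightarrow> smooth_fun g \<Longrightarrow> D v (\<lambda>q. f q - g q) p = D v f p - D v g p"
  using D_add[OF _ smooth_fun_minus, of f g] by (simp add: D_minus)

lemma D_scaleR: "smooth_fun f \<Longrightarrow> D v (\<lambda>q. r *\<^sub>R f q) p = r *\<^sub>R D v f p"
  by (rule D_linear[OF bounded_linear_scaleR_right])

lemma D_sum:
  "finite I \<Longrightarrow> (\<And>i. i \<in> I \<Longrightarrow> smooth_fun (f i)) \<Longrightarrow> D v (\<lambda>q. \<Sum>i\<in>I. f i q) p = (\<Sum>i\<in>I. D v (f i) p)"
  by (induction I rule: finite_induct) (simp_all add: D_add smooth_fun_sum)

lemma D_chain_real: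
  assumes "smooth_fun f" "(g has_real_derivative g') (at (f p))"
  shows "D v (\<lambda>q. g (f q)) p = g' * D v f p"
proof -
  obtain c x where c: "c \<in> \<A>" "x \<in> coord_range c" "p = param c x" using in_some_chart .
  have "((g \<circ> (f \<circ> param c)) has_derivative ((*) g' \<circ> frechet_derivative (f \<circ> param c) (at x))) (at x)"
    by (rule diff_chain_at[OF smooth_fun_has_derivative[OF assms(1) c(1,2)]])
       (use assms(2) in \<open>simp add: c(3) has_field_derivative_def\<close>)
  then have "((\<lambda>q. g (f q)) \<circ> param c has_derivative ((*) g' \<circ> frechet_derivative (f \<circ> param c) (at x)))
      (at x)"
    by (simp add: comp_def)
  from D_chart[OF c(1,2) this] show ?thesis by (simp add: c(3) D_chart_smooth[OF c(1,2) assms(1)])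
qed

lemma linear_D:
  assumes "smooth_fun f"
  shows "linear (\<lambda>v. D v f p)"
proof -
  obtain c where c: "c \<in> \<A>" "p \<in> fst c" using charts_cover by blast
  have lin: "linear (chart_deriv c f p)" and linF: "linear (chart_deriv c F p)"
    using linear_chart_deriv[OF assms c] linear_chart_deriv[OF smooth_fun_F c] by auto
  have ex: "\<exists>\<xi>. chart_deriv c F p \<xi> = T p v" for v using T_in tangent_space_chart[OF c] by (metis imageE)
  have eq: "D v f p = chart_deriv c f p \<xi>" if "chart_deriv c F p \<xi> = T p v" for v \<xi>
    using dir_deriv_chart[OF c smooth_fun_diff_at[OF assms c], of \<xi>] that by (simp add: D_def)
  show ?thesis
  proof (rule linearI)
    fix u v r
    obtain \<xi> \<eta> where *: "chart_deriv c F p \<xi> = T p u" "chart_deriv c F p \<eta> = T p v" using ex by metis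
    show "D (u + v) f p = D u f p + D v f p"
      using eq[of "\<xi> + \<eta>" "u + v"] eq[OF *(1)] eq[OF *(2)] *
      by (simp add: linear_add[OF lin] linear_add[OF linF] blinfun.bilinear_simps)
    show "D (r *\<^sub>R u) f p = r *\<^sub>R D u f p"
      using eq[of "r *\<^sub>R \<xi>" "r *\<^sub>R u"] eq[OF *(1)] *
      by (simp add: linear_scale[OF lin] linear_scale[OF linF] blinfun.bilinear_simps)
  qed
qed

lemma D_F: "D v F p = T p v"
proof -
  obtain c x where c: "c \<in> \<A>" "x \<in> coord_range c" "p = param c x" using in_some_chart .
  show ?thesis unfolding c(3) D_chart_smooth[OF c(1,2) smooth_fun_F]
    using tan_coord[OF c(1,2), of v] by (simp add: chart_deriv_def coord_param[OF c(1,2)])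
qed

text \<open>In a chart, \<open>D v f\<close> is a combination of partial derivatives of \<open>f\<close> with the smooth
  coefficients \<open>tan_coord\<close>.\<close>

lemma smooth_fun_D:
  assumes "smooth_fun f"
  shows "smooth_fun (D v f)"
  unfolding smooth_fun_def
proof
  fix c assume c: "c \<in> \<A>"
  note o = chart_homeomorphism(2)[OF c]
  show "smooth_on (coord_range c) (D v f \<circ> param c)"
  proof (rule smooth_on_cong[OF o])
    show "(\<Sum>k\<in>UNIV. tan_coord c v x $ k *\<^sub>R frechet_derivative (f \<circ> param c) (at x) (axis k 1)) = (D v f \<circ>
        param c) x"
      if x: "x \<in> coord_range c" for x
      using frechet_derivative_axis[OF smooth_fun_differentiable[OF assms c x], of "tan_coord c v x"]
      by (simp add: D_chart_smooth[OF c x assms])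
    show "smooth_on (coord_range c) (\<lambda>x. \<Sum>k\<in>UNIV. tan_coord c v x $ k *\<^sub>R frechet_derivative (f \<circ> param c)
        (at x) (axis k 1))"
      using o smooth_on_tan_coord[OF c] smooth_on_derivative[OF smooth_funD[OF assms c]]
      by (intro smooth_on_sum smooth_on_bilinear[OF _ bounded_bilinear_scaleR]) auto
  qed
qed

lemma D_expand:
  assumes "smooth_fun f"
  shows "D v f p = (\<Sum>b\<in>Basis. inner v b *\<^sub>R D b f p)"
proof -
  have "D v f p = D (\<Sum>b\<in>Basis. inner v b *\<^sub>R b) f p" by (simp add: euclidean_representation)
  then show ?thesis by (simp only: linear_sum[OF linear_D[OF assms]] linear_scale[OF linear_D[OF assms]])
qed

lemma smooth_fun_D_field:
  assumes "smooth_fun f" "smooth_fun X"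
  shows "smooth_fun (\<lambda>q. D (X q) f q)"
  using assms
  by (subst D_expand[OF assms(1)])
     (intro smooth_fun_sum smooth_fun_bilinear[OF bounded_bilinear_scaleR] smooth_fun_linear[OF
         bounded_linear_inner_left] smooth_fun_D; simp)

text \<open>Expand \<open>X\<close> in the constant Euclidean basis and use the product rule.\<close>

lemma D_D_field:
  assumes "smooth_fun f" "smooth_fun X"
  shows "D v (\<lambda>q. D (X q) f q) p = D (D v X p) f p + D v (D (X p) f) p"
proof -
  have sX: "smooth_fun (\<lambda>q. inner (X q) b)" for b by (rule smooth_fun_linear[OF bounded_linear_inner_left
      assms(2)])
  have "D v (\<lambda>q. D (X q) f q) p = D v (\<lambda>q. \<Sum>b\<in>Basis. inner (X q) b *\<^sub>R D b f q) p"
    by (subst D_expand[OF assms(1)]) simp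
  also have "\<dots> = (\<Sum>b\<in>Basis. D v (\<lambda>q. inner (X q) b *\<^sub>R D b f q) p)"
    by (intro D_sum smooth_fun_bilinear[OF bounded_bilinear_scaleR] sX smooth_fun_D assms) auto
  also have "\<dots> = (\<Sum>b\<in>Basis. inner (D v X p) b *\<^sub>R D b f p + inner (X p) b *\<^sub>R D v (D b f) p)"
    by (simp add: D_bilinear[OF bounded_bilinear_scaleR sX smooth_fun_D[OF assms(1)]] D_linear[OF
        bounded_linear_inner_left assms(2)])
  also have "\<dots> = D (D v X p) f p + (\<Sum>b\<in>Basis. inner (X p) b *\<^sub>R D v (D b f) p)"
    by (subst D_expand[OF assms(1), of "D v X p"]) (simp add: sum.distrib)
  also have "(\<Sum>b\<in>Basis. inner (X p) b *\<^sub>R D v (D b f) p) = D v (\<lambda>q. \<Sum>b\<in>Basis. inner (X p) b *\<^sub>R D b f q) p"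
    by (subst D_sum) (auto intro!: smooth_fun_linear[OF bounded_linear_scaleR_right] smooth_fun_D assms
        simp: D_scaleR[OF smooth_fun_D[OF assms(1)]])
  also have "(\<lambda>q. \<Sum>b\<in>Basis. inner (X p) b *\<^sub>R D b f q) = D (X p) f"
    by (rule ext) (rule D_expand[OF assms(1), symmetric])
  finally show ?thesis .
qed

text \<open>The Hessian in coordinates is symmetric, so only derivatives of the coefficient functions
  survive in a commutator; applying this to the immersion itself identifies them.\<close>

lemma D_commute:
  assumes f: "smooth_fun f"
  shows "D v (D w f) p - D w (D v f) p = D (D v T p w - D w T p v) f p"
proof -
  obtain c x where c: "c \<in> \<A>" "x \<in> coord_range c" "p = param c x" using in_some_chart .
  note o = chart_homeomorphism(2)[OF c(1)]
  define h where "h = (\<lambda>u k. frechet_derivative (\<lambda>y. tan_coord c u y $ k) (at x))"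
  define br where "br = (\<chi> k. h w k (tan_coord c v x) - h v k (tan_coord c w x))"
  have tc: "((\<lambda>y. tan_coord c u y $ k) has_derivative h u k) (at x)" for u k
    unfolding h_def by (rule smooth_on_has_derivative[OF smooth_on_tan_coord[OF c(1)] c(2)])
  have bracket: "D v (D w g) p - D w (D v g) p = frechet_derivative (g \<circ> param c) (at x) br"
    if g: "smooth_fun g" for g :: "'p \<Rightarrow> 'c::real_normed_vector"
  proof -
    let ?G = "g \<circ> param c"
    have G: "smooth_on (coord_range c) ?G" by (rule smooth_funD[OF g c(1)])
    define G1 where "G1 = (\<lambda>k y. frechet_derivative ?G (at y) (axis k 1))"
    define G2 where "G2 = (\<lambda>k. frechet_derivative (G1 k) (at x))"
    have G1: "smooth_on (coord_range c) (G1 k)" for k unfolding G1_def by (rule smooth_on_derivative[OF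
        G])
    have G2: "(G1 k has_derivative G2 k) (at x)" for k
      unfolding G2_def by (rule smooth_on_has_derivative[OF G1 c(2)])
    have sym: "G2 k (axis l 1) = G2 l (axis k 1)" for k l
      unfolding G2_def G1_def by (rule smooth_on_symmetric_derivative[OF o G c(2)])
    have DD: "D a (D b g) p = (\<Sum>k\<in>UNIV. h b k (tan_coord c a x) *\<^sub>R G1 k x)
        + (\<Sum>k\<in>UNIV. \<Sum>l\<in>UNIV. (tan_coord c b x $ k * tan_coord c a x $ l) *\<^sub>R G2 k (axis l 1))" for a b
    proof -
      have "((\<lambda>y. \<Sum>k\<in>UNIV. tan_coord c b y $ k *\<^sub>R G1 k y) has_derivative
         (\<lambda>\<xi>. \<Sum>k\<in>UNIV. tan_coord c b x $ k *\<^sub>R G2 k \<xi> + h b k \<xi> *\<^sub>R G1 k x)) (at x)"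
        by (intro has_derivative_sum has_derivative_scaleR tc G2)
      then have "((D b g \<circ> param c) has_derivative
         (\<lambda>\<xi>. \<Sum>k\<in>UNIV. tan_coord c b x $ k *\<^sub>R G2 k \<xi> + h b k \<xi> *\<^sub>R G1 k x)) (at x)"
        by (rule has_derivative_transform_within_open[OF _ o c(2)])
           (simp add: D_chart_smooth[OF c(1) _ g] G1_def
              frechet_derivative_axis[OF smooth_fun_differentiable[OF g c(1)]])
      from D_chart[OF c(1,2) this, of a]
      have "D a (D b g) p = (\<Sum>k\<in>UNIV. tan_coord c b x $ k *\<^sub>R G2 k (tan_coord c a x) + h b k (tan_coord c a
          x) *\<^sub>R G1 k x)"
        by (simp add: c(3))
      moreover have "G2 k (tan_coord c a x) = (\<Sum>l\<in>UNIV. tan_coord c a x $ l *\<^sub>R G2 k (axis l 1))" for k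
        unfolding G2_def by (rule frechet_derivative_axis[OF smooth_on_differentiable[OF G1 c(2)]])
      ultimately show ?thesis by (simp add: sum.distrib scaleR_sum_right add.commute)
    qed
    have "(\<Sum>k\<in>UNIV. \<Sum>l\<in>UNIV. (tan_coord c w x $ k * tan_coord c v x $ l) *\<^sub>R G2 k (axis l 1))
        = (\<Sum>k\<in>UNIV. \<Sum>l\<in>UNIV. (tan_coord c v x $ k * tan_coord c w x $ l) *\<^sub>R G2 k (axis l 1))"
      by (subst sum.swap) (simp add: sym mult.commute)
    then have "D v (D w g) p - D w (D v g) p = (\<Sum>k\<in>UNIV. br $ k *\<^sub>R G1 k x)"
      by (simp add: DD br_def scaleR_diff_left sum_subtractf)
    also have "\<dots> = frechet_derivative ?G (at x) br"
      unfolding G1_def by (rule frechet_derivative_axis[OF smooth_fun_differentiable[OF g c(1,2)],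
          symmetric])
    finally show ?thesis .
  qed
  have DT: "D a (\<lambda>q. T q b) p = D a T p b" for a b
    by (rule D_linear[OF blinfun.bounded_linear_left smooth_fun_T])
  have "D v (D w F) p - D w (D v F) p = D v T p w - D w T p v"
    by (simp add: D_F[abs_def] DT)
  then have br: "chart_deriv c F p br = D v T p w - D w T p v"
    using bracket[OF smooth_fun_F] by (simp add: c(3) chart_deriv_def coord_param[OF c(1,2)])
  have pc: "p \<in> fst c" using param_in[OF c(1,2)] c(3) by simp
  have "D v T p w - D w T p v \<in> tangent_space \<A> F p"
    using br tangent_space_chart[OF c(1) pc] by (metis rangeI)
  then have "D (D v T p w - D w T p v) f p = dir_deriv \<A> F p (chart_deriv c F p br) f"
    by (simp add: D_def T_tangent br)
  also have "\<dots> = chart_deriv c f p br"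
    by (rule dir_deriv_chart[OF c(1) pc smooth_fun_diff_at[OF f c(1) pc]])
  finally show ?thesis using bracket[OF f] by (simp add: chart_deriv_def c(3) coord_param[OF c(1,2)])
qed

end

context spacelike_immersion begin

lemma smooth_fun_DT: "smooth_fun (D v T)" "smooth_fun (D v (D w T))"
  by (intro smooth_fun_D smooth_fun_T)+

lemma smooth_fun_apply:
  "smooth_fun L \<Longrightarrow> smooth_fun X \<Longrightarrow> smooth_fun (\<lambda>q. blinfun_apply (L q) (X q))"
  by (rule smooth_fun_bilinear[OF bounded_bilinear_blinfun_apply])

lemma D_apply:
  "smooth_fun L \<Longrightarrow> smooth_fun X \<Longrightarrow>
    D v (\<lambda>q. blinfun_apply (L q) (X q)) p = D v L p (X p) + L p (D v X p)"
  by (rule D_bilinear[OF bounded_bilinear_blinfun_apply])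

lemma D_apply_const: "smooth_fun L \<Longrightarrow> D v (\<lambda>q. blinfun_apply (L q) x) p = D v L p x"
  using D_apply[OF _ smooth_fun_const, of L v x p] by (simp add: blinfun.zero_right)

lemma D_zero [simp]: "D 0 f p = 0" if "smooth_fun f"
  by (rule linear_0[OF linear_D[OF that]])

lemma D_normal: "smooth_fun f \<Longrightarrow> T p v = 0 \<Longrightarrow> D v f p = 0"
  using D_T[of p v f] by simp

lemma linear_D_D:
  assumes "smooth_fun f"
  shows "linear (\<lambda>w. D v (D w f) p)"
proof (rule linearI)
  fix u w r
  have "D (u + w) f = (\<lambda>q. D u f q + D w f q)" by (rule ext) (rule linear_add[OF linear_D[OF assms]])
  then show "D v (D (u + w) f) p = D v (D u f) p + D v (D w f) p" by (simp add: D_add smooth_fun_D assms)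
  have "D (r *\<^sub>R u) f = (\<lambda>q. r *\<^sub>R D u f q)" by (rule ext) (rule linear_scale[OF linear_D[OF assms]])
  then show "D v (D (r *\<^sub>R u) f) p = r *\<^sub>R D v (D u f) p" by (simp add: D_scaleR smooth_fun_D assms)
qed

section \<open>Derivatives of the tangent projection\<close>

text \<open>The derivative of \<open>T T = T\<close>. It implies that \<open>D v T\<close> interchanges tangent and normal
  vectors.\<close>

lemma DT_idem: "D v T p (T p x) + T p (D v T p x) = D v T p x"
proof -
  have "D v (\<lambda>q. T q (T q x)) p = D v T p (T p x) + T p (D v (\<lambda>q. T q x) p)"
    by (intro D_apply smooth_fun_T smooth_fun_apply smooth_fun_const)
  then show ?thesis by (simp add: D_apply_const[OF smooth_fun_T])
qed

lemma DT_tangent: "T p x = x \<Longrightarrow> T p (D v T p x) = 0"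
  using DT_idem[of v p x] by simp

lemma DT_normal: "T p x = 0 \<Longrightarrow> T p (D v T p x) = D v T p x"
  using DT_idem[of v p x] by (simp add: blinfun.zero_right)

lemma DT_selfadjoint: "pinner (D v T p x) y = pinner x (D v T p y)"
proof -
  have 1: "D v (\<lambda>q. pinner (T q x) y) p = pinner (D v T p x) y"
    using D_linear[OF pinner.bounded_linear_left smooth_fun_apply[OF smooth_fun_T smooth_fun_const]]
    by (simp add: D_apply_const[OF smooth_fun_T])
  have 2: "D v (\<lambda>q. pinner x (T q y)) p = pinner x (D v T p y)"
    using D_linear[OF pinner.bounded_linear_right smooth_fun_apply[OF smooth_fun_T smooth_fun_const]]
    by (simp add: D_apply_const[OF smooth_fun_T])
  show ?thesis using 1 2 by (simp add: pinner_T)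
qed

lemma DDT_selfadjoint: "pinner (D w (D v T) p x) y = pinner x (D w (D v T) p y)"
proof -
  have 1: "D w (\<lambda>q. pinner (D v T q x) y) p = pinner (D w (D v T) p x) y"
    using D_linear[OF pinner.bounded_linear_left smooth_fun_apply[OF smooth_fun_DT(1) smooth_fun_const]]
    by (simp add: D_apply_const[OF smooth_fun_DT(1)])
  have 2: "D w (\<lambda>q. pinner x (D v T q y)) p = pinner x (D w (D v T) p y)"
    using D_linear[OF pinner.bounded_linear_right smooth_fun_apply[OF smooth_fun_DT(1) smooth_fun_const]]
    by (simp add: D_apply_const[OF smooth_fun_DT(1)])
  show ?thesis using 1 2 by (simp add: DT_selfadjoint)
qed

text \<open>The second derivative of \<open>T T = T\<close> expresses the blocks of \<open>D w (D v T)\<close> that preserve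
  tangent and normal vectors through first derivatives.\<close>

lemma DDT_idem:
  "D w (D v T) p (T p x) + D v T p (D w T p x) + D w T p (D v T p x) + T p (D w (D v T) p x) = D w (D v T)
      p x"
proof -
  have "D w (\<lambda>q. D v T q (T q x) + T q (D v T q x)) p
      = (D w (D v T) p (T p x) + D v T p (D w (\<lambda>q. T q x) p)) + (D w T p (D v T p x) + T p (D w (\<lambda>q. D v T
          q x) p))"
    by (subst D_add; (intro smooth_fun_apply smooth_fun_T smooth_fun_DT smooth_fun_const)?)
       (simp add: D_apply smooth_fun_apply smooth_fun_T smooth_fun_DT smooth_fun_const)
  then show ?thesis unfolding DT_idem D_apply_const[OF smooth_fun_T] D_apply_const[OF smooth_fun_DT(1)]
    by (simp only: add.assoc)
qed

text \<open>The commutator of the derivations applied to the immersion itself: the flat connection of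
  the ambient space is torsion-free.\<close>

lemma DT_torsion: "T p (D v T p w - D w T p v) = D v T p w - D w T p v"
proof -
  have "D v (D w F) p - D w (D v F) p = D (D v T p w - D w T p v) F p" by (rule D_commute[OF
      smooth_fun_F])
  then show ?thesis by (simp add: D_F[abs_def] D_apply_const[OF smooth_fun_T])
qed

text \<open>The symmetry of the second fundamental form: by torsion-freeness the difference of the two
  sides is tangential, while both sides are normal.\<close>

lemma DT_symmetric:
  assumes "T p v = v" "T p w = w"
  shows "D v T p w = D w T p v"
proof -
  have "T p (D v T p w - D w T p v) = 0"
    by (simp only: blinfun.diff_right DT_tangent[OF assms(1)] DT_tangent[OF assms(2)] diff_self)
  then show ?thesis unfolding DT_torsion by simp
qed

lemma D_commute_tangent:
  assumes "T p v = v" "T p w = w" "smooth_fun f"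
  shows "D v (D w f) p = D w (D v f) p"
proof -
  have "D v (D w f) p - D w (D v f) p = 0"
    unfolding D_commute[OF assms(3)] DT_symmetric[OF assms(1,2)] by (simp add: assms(3))
  then show ?thesis by simp
qed

abbreviation "te \<equiv> tan_frame \<A> F"
abbreviation "ne \<equiv> nor_frame \<A> F"

lemma frame_adapted: "adapted_frame (tangent_space \<A> F p) (te p) (ne p)"
proof -
  note ts = tangent_space_spacelike[of p]
  have 1: "\<exists>e :: 'n \<Rightarrow> _. orthonormal_basis 1 (tangent_space \<A> F p) e"
    using ts(3) by (intro definite_orthonormal_basis_exists[OF ts(1) _ _ ts(2)]) (auto simp:
        spacelike_on_def)
  have 2: "\<exists>\<nu> :: 'm \<Rightarrow> _. orthonormal_basis (-1) (normal_space \<A> F p) \<nu>"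
    unfolding normal_space_eq using orth_compl_timelike[OF ts(3,1,2)]
    by (intro definite_orthonormal_basis_exists[OF subspace_orth_compl _ _ spacelike_orth_compl_dim(1)[OF
        ts(3,1,2)]]) auto
  show ?thesis
    unfolding adapted_frame_def tan_frame_def nor_frame_def normal_space_eq[symmetric]
    using someI_ex[OF 1] someI_ex[OF 2] by (rule conjI)
qed

lemma frame_orthonormal:
  "pinner (te p i) (te p j) = (if i = j then 1 else 0)"
  "pinner (ne p \<alpha>) (ne p \<beta>) = (if \<alpha> = \<beta> then -1 else 0)"
  using frame_adapted[of p] by (auto simp: adapted_frame_def orthonormal_basis_def)

lemma T_frame [simp]: "T p (te p i) = te p i" "T p (ne p \<alpha>) = 0"
proof -
  have "te p i \<in> span (range (te p))" "ne p \<alpha> \<in> span (range (ne p))"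
    by (auto intro: span_base)
  then have "te p i \<in> tangent_space \<A> F p" "ne p \<alpha> \<in> normal_space \<A> F p"
    using frame_adapted[of p] by (auto simp: adapted_frame_def orthonormal_basis_def normal_space_eq)
  then show "T p (te p i) = te p i" "T p (ne p \<alpha>) = 0"
    by (auto simp: tangent_space_iff normal_space_iff)
qed

lemma D_nor_frame [simp]: "smooth_fun f \<Longrightarrow> D (ne p \<alpha>) f p = 0"
  by (rule D_normal) simp_all

lemma T_expansion: "T p x = (\<Sum>i\<in>UNIV. pinner x (te p i) *\<^sub>R te p i)"
  by (subst adapted_frame_expansion[OF frame_adapted, of x p]) (simp add: blinfun.bilinear_simps)

lemma tangent_expansion: "T p x = x \<Longrightarrow> x = (\<Sum>i\<in>UNIV. pinner x (te p i) *\<^sub>R te p i)"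
  using T_expansion by metis

lemma pinner_tangent_normal: "T p x = x \<Longrightarrow> T p y = 0 \<Longrightarrow> pinner x y = 0"
  using pinner_T[of p x y] by (simp add: pinner.zero_right)

lemma tangent_parseval:
  assumes "T p x = x"
  shows "pinner x y = (\<Sum>i\<in>UNIV. pinner x (te p i) * pinner y (te p i))"
  using adapted_frame_pinner[OF frame_adapted[of p], of x y] pinner_tangent_normal[OF assms T_frame(2)] by
      simp

lemma normal_parseval:
  assumes "T p x = 0"
  shows "pinner x y = - (\<Sum>\<alpha>\<in>UNIV. pinner x (ne p \<alpha>) * pinner y (ne p \<alpha>))"
proof -
  have "pinner x (te p i) = 0" for i
    using pinner_tangent_normal[OF T_frame(1) assms, of i] pinner_commute[of x "te p i"] by simp
  then show ?thesis using adapted_frame_pinner[OF frame_adapted[of p], of x y] by simp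
qed

lemma contraction_frame:
  assumes l: "\<And>v. linear (\<beta> v)" "\<And>w. linear (\<lambda>v. \<beta> v w)"
    and z: "\<And>\<alpha>. \<beta> (ne p \<alpha>) (ne p \<alpha>) = 0"
  shows "(\<Sum>b\<in>Basis. \<beta> b (flip b)) = (\<Sum>i\<in>UNIV. \<beta> (te p i) (te p i))"
  using contraction_adapted_frame[OF frame_adapted[of p] l] z by simp

section \<open>Second fundamental form and normal curvature\<close>

lemma second_ff_ext:
  "second_ff \<A> F (tan_ext \<A> F u) (tan_ext \<A> F v) q = D u T q v - T q (D u T q v)"
  unfolding second_ff_def flat_conn_def tan_ext_def nor_proj_T tan_proj_T D_def[symmetric]
  by (simp add: D_apply_const[OF smooth_fun_T])

text \<open>Here \<open>D v T\<close> maps tangent to normal vectors, so the normal projection disappears at \<open>p\<close>.\<close>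

lemma B_frame_eq: "B_frame \<A> F p i j = D (te p i) T p (te p j)"
  unfolding B_frame_def second_ff_ext by (simp add: DT_tangent)

text \<open>The mean curvature vector as a trace over a fixed basis of the ambient space: unlike the sum
  over the frames, this expression is visibly smooth.\<close>

definition mc :: "'p \<Rightarrow> ('n, 'm) pseudo_space" where
  "mc p = (\<Sum>b\<in>Basis. D b T p (flip b))"

lemma mc_frame: "mc p = (\<Sum>i\<in>UNIV. D (te p i) T p (te p i))"
  unfolding mc_def
  by (rule contraction_frame)
     ((rule linearI; simp only: blinfun.bilinear_simps linear_add[OF linear_D[OF smooth_fun_T]]
         linear_scale[OF linear_D[OF smooth_fun_T]])+,
      simp add: smooth_fun_T)

lemma mean_curvature_eq: "mean_curvature \<A> F = mc"
  by (rule ext) (simp add: mean_curvature_def mc_frame B_frame_eq)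

lemma smooth_fun_mc: "smooth_fun mc"
  unfolding mc_def by (intro smooth_fun_sum smooth_fun_apply smooth_fun_DT smooth_fun_const) auto

lemma T_mc: "T p (mc p) = 0"
  unfolding mc_frame by (simp add: blinfun.sum_right DT_tangent)

text \<open>The projected constant vectors are parallel at \<open>p\<close> to first order, so the terms of the
  covariant derivative in which the arguments of \<open>B\<close> are differentiated vanish, the last one
  because \<open>D v T\<close> maps normal to tangent vectors.\<close>

lemma nabla_second_ff_eq:
  fixes p i j k
  defines "e \<equiv> te p"
  shows "nabla_second_ff \<A> F (tan_ext \<A> F (e k)) (tan_ext \<A> F (e i)) (tan_ext \<A> F (e j)) p
     = D (e k) (D (e i) T) p (e j) - T p (D (e k) (D (e i) T) p (e j))"
proof -
  have Te: "T p (e l) = e l" for l by (simp add: e_def)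
  have s1: "smooth_fun (\<lambda>q. D (e i) T q (e j))" by (intro smooth_fun_apply smooth_fun_DT smooth_fun_const)
  have 1: "nor_conn \<A> F (tan_ext \<A> F (e k)) (second_ff \<A> F (tan_ext \<A> F (e i)) (tan_ext \<A> F (e j))) p
     = D (e k) (D (e i) T) p (e j) - T p (D (e k) (D (e i) T) p (e j))"
  proof -
    have "nor_conn \<A> F (tan_ext \<A> F (e k)) (second_ff \<A> F (tan_ext \<A> F (e i)) (tan_ext \<A> F (e j))) p
        = (let y = D (e k) (\<lambda>q. D (e i) T q (e j) - T q (D (e i) T q (e j))) p in y - T p y)"
      unfolding second_ff_ext[abs_def]
      unfolding nor_conn_def flat_conn_def nor_proj_T tan_ext_def tan_proj_T D_def[symmetric] Let_def ..
    also have "D (e k) (\<lambda>q. D (e i) T q (e j) - T q (D (e i) T q (e j))) p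
       = D (e k) (D (e i) T) p (e j) - (D (e k) T p (D (e i) T p (e j)) + T p (D (e k) (D (e i) T) p (e
           j)))"
      by (simp add: D_diff s1 smooth_fun_apply smooth_fun_T D_apply D_apply_const smooth_fun_DT)
    finally show ?thesis
      by (simp add: Let_def blinfun.diff_right blinfun.add_right DT_normal[OF DT_tangent[OF Te]])
  qed
  have 2: "second_ff \<A> F (tan_conn \<A> F (tan_ext \<A> F (e k)) (tan_ext \<A> F (e i))) (tan_ext \<A> F (e j)) p = 0"
  proof -
    have "tan_conn \<A> F (tan_ext \<A> F (e k)) (tan_ext \<A> F (e i)) p = T p 0"
      unfolding tan_conn_def flat_conn_def tan_ext_def tan_proj_T D_def[symmetric]
      by (simp add: D_apply_const smooth_fun_T DT_tangent[OF Te])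
    then show ?thesis
      unfolding second_ff_def flat_conn_def tan_ext_def nor_proj_T tan_proj_T
      by (simp only: D_def[symmetric]) (simp add: smooth_fun_apply smooth_fun_T smooth_fun_const)
  qed
  have 3: "second_ff \<A> F (tan_ext \<A> F (e i)) (tan_conn \<A> F (tan_ext \<A> F (e k)) (tan_ext \<A> F (e j))) p = 0"
  proof -
    have "second_ff \<A> F (tan_ext \<A> F (e i)) (tan_conn \<A> F (tan_ext \<A> F (e k)) (tan_ext \<A> F (e j))) p
        = (let y = D (e i) (\<lambda>q. T q (D (e k) T q (e j))) p in y - T p y)"
      unfolding second_ff_def tan_conn_def[abs_def] flat_conn_def nor_proj_T tan_ext_def tan_proj_T
          D_def[symmetric] Let_def
      by (simp add: D_apply_const smooth_fun_T)
    also have "D (e i) (\<lambda>q. T q (D (e k) T q (e j))) p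
        = D (e i) T p (D (e k) T p (e j)) + T p (D (e i) (D (e k) T) p (e j))"
      by (simp add: smooth_fun_apply smooth_fun_T D_apply D_apply_const smooth_fun_DT smooth_fun_const)
    finally show ?thesis
      by (simp add: Let_def blinfun.add_right DT_normal[OF DT_tangent[OF Te]])
  qed
  show ?thesis unfolding nabla_second_ff_def by (simp add: 1 2 3)
qed

text \<open>The Ricci equation. Second derivatives of \<open>T\<close> cancel in the commutator because the bracket
  of the two fields vanishes at \<open>p\<close>.\<close>

lemma nor_curvature_eq:
  fixes p i j \<alpha>
  defines "e \<equiv> te p" and "\<nu> \<equiv> ne p \<alpha>"
  shows "nor_curvature \<A> F (tan_ext \<A> F (e i)) (tan_ext \<A> F (e j)) (nor_ext \<A> F \<nu>) p
     = D (e i) T p (D (e j) T p \<nu>) - D (e j) T p (D (e i) T p \<nu>)"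
proof -
  have Te: "T p (e l) = e l" for l by (simp add: e_def)
  have Tn: "T p \<nu> = 0" by (simp add: \<nu>_def)
  have TTn: "T p (D (e l) T p \<nu>) = D (e l) T p \<nu>" for l by (rule DT_normal[OF Tn])
  have c1: "nor_conn \<A> F (tan_ext \<A> F (e l)) (nor_ext \<A> F \<nu>) = (\<lambda>q. T q (D (e l) T q \<nu>) - D (e l) T q \<nu>)"
      for l
  proof
    fix q
    have "nor_conn \<A> F (tan_ext \<A> F (e l)) (nor_ext \<A> F \<nu>) q
       = (let y = D (e l) (\<lambda>q. \<nu> - T q \<nu>) q in y - T q y)"
      unfolding nor_conn_def flat_conn_def nor_ext_def nor_proj_T tan_ext_def tan_proj_T D_def[symmetric]
          Let_def ..
    also have "D (e l) (\<lambda>q. \<nu> - T q \<nu>) q = - D (e l) T q \<nu>"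
      by (simp add: D_diff smooth_fun_const smooth_fun_apply smooth_fun_T D_apply_const)
    finally show "nor_conn \<A> F (tan_ext \<A> F (e l)) (nor_ext \<A> F \<nu>) q = T q (D (e l) T q \<nu>) - D (e l) T q
        \<nu>"
      by (simp add: Let_def blinfun.minus_right)
  qed
  have c2: "nor_conn \<A> F (tan_ext \<A> F (e l)) (\<lambda>q. T q (D (e l') T q \<nu>) - D (e l') T q \<nu>) p
      = D (e l) T p (D (e l') T p \<nu>) - (D (e l) (D (e l') T) p \<nu> - T p (D (e l) (D (e l') T) p \<nu>))" for l
          l'
  proof -
    have "nor_conn \<A> F (tan_ext \<A> F (e l)) (\<lambda>q. T q (D (e l') T q \<nu>) - D (e l') T q \<nu>) p
        = (let y = D (e l) (\<lambda>q. T q (D (e l') T q \<nu>) - D (e l') T q \<nu>) p in y - T p y)"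
      unfolding nor_conn_def flat_conn_def nor_proj_T tan_ext_def tan_proj_T D_def[symmetric] Let_def ..
    also have "D (e l) (\<lambda>q. T q (D (e l') T q \<nu>) - D (e l') T q \<nu>) p
        = D (e l) T p (D (e l') T p \<nu>) + T p (D (e l) (D (e l') T) p \<nu>) - D (e l) (D (e l') T) p \<nu>"
      by (simp add: D_diff smooth_fun_const smooth_fun_apply smooth_fun_T smooth_fun_DT D_apply
          D_apply_const)
    finally show ?thesis
      by (simp add: Let_def blinfun.diff_right blinfun.add_right DT_tangent[OF TTn])
  qed
  have lie: "lie_bracket \<A> F (tan_ext \<A> F (e i)) (tan_ext \<A> F (e j)) p = T p 0"
    unfolding lie_bracket_def flat_conn_def tan_ext_def tan_proj_T D_def[symmetric]
    by (simp add: D_apply_const smooth_fun_T DT_symmetric[OF Te Te])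
  have c3: "nor_conn \<A> F (lie_bracket \<A> F (tan_ext \<A> F (e i)) (tan_ext \<A> F (e j))) (nor_ext \<A> F \<nu>) p = 0"
    unfolding nor_conn_def flat_conn_def lie nor_ext_def nor_proj_T
    by (simp only: D_def[symmetric]) (simp add: smooth_fun_diff smooth_fun_apply smooth_fun_T
        smooth_fun_const)
  have "D (e i) (D (e j) T) p = D (e j) (D (e i) T) p" by (rule D_commute_tangent[OF Te Te smooth_fun_T])
  then show ?thesis unfolding nor_curvature_def c1 c2 c3 by simp
qed

section \<open>The drift Laplacian\<close>

text \<open>The trace of \<open>D v (D w f)\<close> over a fixed basis, for functions with values in any normed
  space.\<close>

definition lap :: "('p \<Rightarrow> 'b::real_normed_vector) \<Rightarrow> 'p \<Rightarrow> 'b" where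
  "lap f p = (\<Sum>b\<in>Basis. D b (D (flip b) f) p)"

definition drift_lap :: "('p \<Rightarrow> 'b::real_normed_vector) \<Rightarrow> 'p \<Rightarrow> 'b" where
  "drift_lap f p = lap f p - (1 / 2) *\<^sub>R D (F p) f p"

lemma lap_frame:
  assumes "smooth_fun f"
  shows "lap f p = (\<Sum>i\<in>UNIV. D (te p i) (D (te p i) f) p)"
  unfolding lap_def
  by (rule contraction_frame) (use assms in \<open>auto intro: linear_D_D linear_D smooth_fun_D simp:
      smooth_fun_D\<close>)

lemma smooth_fun_lap: "smooth_fun f \<Longrightarrow> smooth_fun (lap f)"
  unfolding lap_def[abs_def] by (intro smooth_fun_sum smooth_fun_D) auto

lemma smooth_fun_drift_lap: "smooth_fun f \<Longrightarrow> smooth_fun (drift_lap f)"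
  unfolding drift_lap_def[abs_def]
  by (intro smooth_fun_diff smooth_fun_lap smooth_fun_linear[OF bounded_linear_scaleR_right]
      smooth_fun_D_field smooth_fun_F)

lemma gradient_eq:
  assumes "smooth_fun f"
  shows "gradient \<A> F f q = T q (\<Sum>b\<in>Basis. D b f q *\<^sub>R flip b)"
proof -
  let ?g = "T q (\<Sum>b\<in>Basis. D b f q *\<^sub>R flip b)"
  have g: "pinner ?g u = dir_deriv \<A> F q u f" if "u \<in> tangent_space \<A> F q" for u
  proof -
    have u: "T q u = u" using that by (simp add: tangent_space_iff)
    have "pinner ?g u = (\<Sum>b\<in>Basis. inner u b *\<^sub>R D b f q)"
      by (simp add: pinner_T u pinner.sum_left pinner.scaleR_left pinner_flip_left inner_commute
          mult.commute)
    also have "\<dots> = D u f q" by (rule D_expand[OF assms, symmetric])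
    finally show ?thesis by (simp add: D_def u)
  qed
  show ?thesis unfolding gradient_def
  proof (rule the_equality)
    show "?g \<in> tangent_space \<A> F q \<and> (\<forall>u\<in>tangent_space \<A> F q. pinner ?g u = dir_deriv \<A> F q u f)"
      using g T_in by blast
    fix v assume v: "v \<in> tangent_space \<A> F q \<and> (\<forall>u\<in>tangent_space \<A> F q. pinner v u = dir_deriv \<A> F q u f)"
    have "pinner (v - ?g) u = 0" for u
    proof -
      have "T q (v - ?g) = v - ?g" using v by (simp add: tangent_space_iff blinfun.diff_right)
      then have "pinner (v - ?g) u = pinner (v - ?g) (T q u)" using pinner_T[of q "v - ?g" u] by (simp
          only:)
      also have "\<dots> = 0" using v g[OF T_in] T_in by (simp add: pinner.diff_left)
      finally show ?thesis .
    qed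
    then have "v - ?g = 0" by (rule pinner_nondegenerate)
    then show "v = ?g" by simp
  qed
qed

text \<open>Besides the trace of \<open>D v (D w f)\<close>, the divergence of the gradient contains the terms in
  which the projection is differentiated; they add up to the derivative of \<open>f\<close> along the normal
  vector \<open>mc\<close>, which is zero because \<open>D\<close> only sees tangential parts.\<close>

lemma drift_laplacian_eq:
  assumes f: "smooth_fun f"
  shows "drift_laplacian \<A> F f p = drift_lap f p"
proof -
  let ?e = "te p"
  define G where "G = (\<lambda>q. \<Sum>b\<in>Basis. D b f q *\<^sub>R flip b)"
  have sG: "smooth_fun G" unfolding G_def
    by (intro smooth_fun_sum smooth_fun_linear[OF bounded_linear_scaleR_left] smooth_fun_D f) auto
  have grad: "gradient \<A> F f = (\<lambda>q. T q (G q))" unfolding G_def by (rule ext) (rule gradient_eq[OF f])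
  have DG: "D v G p = (\<Sum>b\<in>Basis. D v (D b f) p *\<^sub>R flip b)" for v
    unfolding G_def using f
    by (subst D_sum) (auto simp: D_linear[OF bounded_linear_scaleR_left] smooth_fun_D intro!:
        smooth_fun_linear[OF bounded_linear_scaleR_left])
  have pG: "pinner (G p) u = D u f p" for u
    unfolding G_def D_expand[OF f, of u] by (simp add: pinner.sum_left pinner.scaleR_left pinner_flip_left
        inner_commute mult.commute)
  have pDG: "pinner (D v G p) u = D v (D u f) p" for u v
  proof -
    have "D v (D u f) p = D v (D (\<Sum>b\<in>Basis. inner u b *\<^sub>R b) f) p" by (simp add: euclidean_representation)
    also have "\<dots> = (\<Sum>b\<in>Basis. inner u b *\<^sub>R D v (D b f) p)"
      by (simp only: linear_sum[OF linear_D_D[OF f]] linear_scale[OF linear_D_D[OF f]])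
    finally show ?thesis by (simp add: DG pinner.sum_left pinner.scaleR_left pinner_flip_left
        inner_commute mult.commute)
  qed
  have "pinner (tan_conn \<A> F (tan_ext \<A> F (?e i)) (gradient \<A> F f) p) (?e i)
       = pinner (G p) (D (?e i) T p (?e i)) + D (?e i) (D (?e i) f) p" for i
  proof -
    have "tan_conn \<A> F (tan_ext \<A> F (?e i)) (gradient \<A> F f) p = T p (D (?e i) (\<lambda>q. T q (G q)) p)"
      unfolding tan_conn_def flat_conn_def tan_ext_def tan_proj_T D_def[symmetric] grad ..
    then show ?thesis by (simp add: D_apply smooth_fun_T sG pinner_T pinner.add_left pDG DT_selfadjoint)
  qed
  then have "divergence \<A> F (gradient \<A> F f) p = pinner (G p) (mc p) + lap f p"
    by (simp add: divergence_def sum.distrib mc_frame pinner.sum_right lap_frame[OF f])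
  also have "pinner (G p) (mc p) = 0" by (simp add: pG D_normal[OF f T_mc])
  finally have div: "divergence \<A> F (gradient \<A> F f) p = lap f p" by simp
  have "pinner (F p) (gradient \<A> F f p) = D (F p) f p"
    using pinner_T[of p "G p" "F p"] by (simp add: grad pinner_commute[of "F p"] pG D_T)
  then show ?thesis by (simp add: drift_laplacian_def div drift_lap_def)
qed

lemma D_bilinear2:
  assumes b: "bounded_bilinear bop" and f: "smooth_fun f" and g: "smooth_fun g"
  shows "D v (D w (\<lambda>q. bop (f q) (g q))) p
     = bop (D v (D w f) p) (g p) + bop (D w f p) (D v g p) + bop (D v f p) (D w g p) + bop (f p) (D v (D w
         g) p)"
proof -
  have "D w (\<lambda>q. bop (f q) (g q)) = (\<lambda>q. bop (D w f q) (g q) + bop (f q) (D w g q))"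
    by (rule ext) (rule D_bilinear[OF b f g])
  then show ?thesis
    by (simp add: D_add smooth_fun_bilinear[OF b] smooth_fun_D f g D_bilinear[OF b])
qed

lemma drift_lap_bilinear:
  assumes b: "bounded_bilinear bop" and f: "smooth_fun f" and g: "smooth_fun g"
  shows "drift_lap (\<lambda>q. bop (f q) (g q)) p
     = bop (drift_lap f p) (g p) + bop (f p) (drift_lap g p)
      + 2 *\<^sub>R (\<Sum>i\<in>UNIV. bop (D (te p i) f p) (D (te p i) g p))"
proof -
  interpret bounded_bilinear bop by (rule b)
  show ?thesis
    by (simp add: drift_lap_def lap_frame smooth_fun_bilinear[OF b] f g D_bilinear2[OF b f g]
        D_bilinear[OF b f g]
       sum.distrib diff_left diff_right sum_left sum_right scaleR_left scaleR_right scaleR_add_right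
           scaleR_2 scaleR_diff_right)
qed

lemma drift_lap_linear:
  assumes L: "bounded_linear L" and f: "smooth_fun f"
  shows "drift_lap (\<lambda>q. L (f q)) p = L (drift_lap f p)"
proof -
  have 1: "D v (\<lambda>q. L (f q)) = (\<lambda>q. L (D v f q))" for v by (rule ext) (rule D_linear[OF L f])
  interpret bounded_linear L by (rule L)
  show ?thesis
    by (simp add: drift_lap_def lap_frame smooth_fun_linear[OF L] f 1 D_linear[OF L] smooth_fun_D diff sum
        scale)
qed

lemma drift_lap_sum:
  assumes "finite I" "\<And>i. i \<in> I \<Longrightarrow> smooth_fun (f i)"
  shows "drift_lap (\<lambda>q. \<Sum>i\<in>I. f i q) p = (\<Sum>i\<in>I. drift_lap (f i) p)"
proof -
  have 1: "D v (\<lambda>q. \<Sum>i\<in>I. f i q) = (\<lambda>q. \<Sum>i\<in>I. D v (f i) q)" for v by (rule ext) (rule D_sum[OF assms])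
  have "lap (\<lambda>q. \<Sum>i\<in>I. f i q) p = (\<Sum>i\<in>I. lap (f i) p)"
    unfolding lap_def 1 by (subst sum.swap) (intro sum.cong refl D_sum assms smooth_fun_D)
  then show ?thesis by (simp add: drift_lap_def 1 sum_subtractf scaleR_sum_right)
qed

end

section \<open>The drift Laplacian of the Gauss map\<close>

context spacelike_immersion begin

text \<open>The projected field \<open>q \<mapsto> T q w\<close> vanishes at \<open>p\<close>, so only its derivative contributes.\<close>

lemma D_D_normal:
  assumes "T p w = 0" "smooth_fun f"
  shows "D v (D w f) p = D (D v T p w) f p"
proof -
  have "D v (D w f) p = D v (\<lambda>q. D (T q w) f q) p" by (simp add: D_T)
  also have "\<dots> = D (D v T p w) f p + D v (D 0 f) p"
    using D_D_field[OF assms(2) smooth_fun_apply[OF smooth_fun_T smooth_fun_const], of v w p]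
    by (simp add: D_apply_const[OF smooth_fun_T] assms(1))
  also have "D 0 f = (\<lambda>q. 0)" by (rule ext) (simp add: assms(2))
  finally show ?thesis by simp
qed

lemma DDT_tangent_part:
  assumes "T p x = x"
  shows "T p (D w (D v T) p x) = - (D v T p (D w T p x) + D w T p (D v T p x))"
  using DDT_idem[of w v p x] by (simp add: assms algebra_simps eq_neg_iff_add_eq_0)

lemma DDT_normal_part:
  assumes "T p y = 0"
  shows "D w (D v T) p y - T p (D w (D v T) p y) = D v T p (D w T p y) + D w T p (D v T p y)"
  using DDT_idem[of w v p y] by (simp add: assms algebra_simps blinfun.zero_right)

lemma drift_lap_add:
  assumes "smooth_fun f" "smooth_fun g"
  shows "drift_lap (\<lambda>q. f q + g q) p = drift_lap f p + drift_lap g p"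
proof -
  have 1: "D v (\<lambda>q. f q + g q) = (\<lambda>q. D v f q + D v g q)" for v by (rule ext) (rule D_add[OF assms])
  show ?thesis by (simp add: drift_lap_def lap_def 1 D_add smooth_fun_D assms sum.distrib algebra_simps)
qed

text \<open>The square of the derivative of the Gauss map, traced. On tangent vectors it is
  \<open>\<Sum>\<^sub>i \<langle>B\<^sub>i\<^sub>j, B\<^sub>i\<^sub>k\<rangle>\<close>, on normal vectors \<open>- S\<^sub>\<alpha>\<^sub>\<beta>\<close>.\<close>

definition Q :: "'p \<Rightarrow> ('n, 'm) pseudo_space \<Rightarrow>\<^sub>L ('n, 'm) pseudo_space" where
  "Q p = (\<Sum>b\<in>Basis. D b T p o\<^sub>L D (flip b) T p)"

lemma Q_frame: "Q p = (\<Sum>i\<in>UNIV. D (te p i) T p o\<^sub>L D (te p i) T p)"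
  unfolding Q_def
  by (rule contraction_frame)
     ((rule linearI; rule blinfun_eqI; simp only: blinfun.bilinear_simps blinfun_apply_blinfun_compose
         linear_add[OF linear_D[OF smooth_fun_T]] linear_scale[OF linear_D[OF smooth_fun_T]])+,
      simp add: smooth_fun_T)

lemma Q_apply: "Q p x = (\<Sum>i\<in>UNIV. D (te p i) T p (D (te p i) T p x))"
  by (simp add: Q_frame blinfun.sum_left)

lemma Q_T: "T p (Q p x) = Q p (T p x)"
proof -
  have "T p (D v T p (D v T p x)) = D v T p (D v T p (T p x))" for v
  proof -
    have "T p (D v T p (D v T p x)) = D v T p (D v T p x) - D v T p (T p (D v T p x))"
      using DT_idem[of v p "D v T p x"] by (simp add: algebra_simps)
    also have "T p (D v T p x) = D v T p x - D v T p (T p x)"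
      using DT_idem[of v p x] by (simp add: algebra_simps)
    finally show ?thesis by (simp add: blinfun.diff_right)
  qed
  then show ?thesis by (simp add: Q_apply blinfun.sum_right)
qed

lemma Q_selfadjoint: "pinner (Q p x) y = pinner x (Q p y)"
  by (simp add: Q_apply pinner.sum_left pinner.sum_right DT_selfadjoint)

lemma drift_lap_T_selfadjoint: "pinner (drift_lap T p x) y = pinner x (drift_lap T p y)"
  by (simp add: drift_lap_def lap_frame smooth_fun_T blinfun.diff_left blinfun.sum_left
      blinfun.scaleR_left
      pinner.diff_left pinner.diff_right pinner.sum_left pinner.sum_right pinner.scaleR_left
          pinner.scaleR_right
      DT_selfadjoint DDT_selfadjoint)

end

locale spacelike_shrinker = spacelike_immersion \<A> F
  for \<A> :: "('p::{t2_space, second_countable_topology}, 'n::finite) atlas"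
    and F :: "('p, 'n, 'm::finite) amb_map" +
  assumes shrinker: "mean_curvature \<A> F p = - (1 / 2) *\<^sub>R nor_proj \<A> F p (F p)"
begin

lemma mc_shrinker: "mc p = - (1 / 2) *\<^sub>R (F p - T p (F p))"
  using shrinker[of p] by (simp add: mean_curvature_eq nor_proj_T)

lemma F_normal_part: "F p - T p (F p) = - 2 *\<^sub>R mc p"
  by (simp add: mc_shrinker)

text \<open>Differentiate \<open>mc = (T F - F) / 2\<close>; the terms \<open>T v\<close> cancel.\<close>

lemma D_mc: "D v mc p = (1 / 2) *\<^sub>R D v T p (F p)"
proof -
  have sTF: "smooth_fun (\<lambda>q. T q (F q))" by (intro smooth_fun_apply smooth_fun_T smooth_fun_F)
  have "D v mc p = D v (\<lambda>q. - (1 / 2) *\<^sub>R (F q - T q (F q))) p"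
    by (rule arg_cong[of _ _ "\<lambda>f. D v f p"]) (rule ext, rule mc_shrinker)
  also have "\<dots> = - (1 / 2) *\<^sub>R D v (\<lambda>q. F q - T q (F q)) p"
    by (rule D_scaleR) (intro smooth_fun_diff smooth_fun_F sTF)
  also have "D v (\<lambda>q. F q - T q (F q)) p = - D v T p (F p)"
    by (simp add: D_diff smooth_fun_F sTF D_F D_apply smooth_fun_T)
  finally show ?thesis by simp
qed

text \<open>The mixed part of the drift Laplacian of the tangent projection vanishes: by the Codazzi
  equation it is the normal derivative of the mean curvature vector, which the shrinker equation
  identifies with the drift term.\<close>

lemma drift_lap_T_tangent_invariant:
  assumes x: "T p x = x"
  shows "T p (drift_lap T p x) = drift_lap T p x"
proof -
  let ?e = "te p" and ?\<nu> = "ne p"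
  define N where "N = (\<lambda>y. y - T p y)"
  have N_add: "N (u + v) = N u + N v" and N_diff: "N (u - v) = N u - N v" and N_scaleR: "N (r *\<^sub>R u) = r *\<^sub>R
      N u" for u v r
    by (simp_all add: N_def blinfun.bilinear_simps scaleR_diff_right)
  have N_sum: "N (\<Sum>i\<in>I. f i) = (\<Sum>i\<in>I. N (f i))" for f and I :: "'n set"
    by (simp add: N_def blinfun.sum_right sum_subtractf)
  have N_sum': "N (\<Sum>i\<in>I. f i) = (\<Sum>i\<in>I. N (f i))" for f and I :: "'m set"
    by (simp add: N_def blinfun.sum_right sum_subtractf)
  \<comment> \<open>Codazzi equation: differentiate \<open>DT_torsion\<close>, which holds at every point, along \<open>e i\<close>.\<close>
  have codazzi: "N (D (?e i) (D (?e i) T) p x) = N (D x (D (?e i) T) p (?e i))" for i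
  proof -
    have sC: "smooth_fun (\<lambda>q. D (?e i) T q x - D x T q (?e i))"
      by (intro smooth_fun_diff smooth_fun_apply smooth_fun_DT smooth_fun_const)
    have DC: "D (?e i) (\<lambda>q. D (?e i) T q x - D x T q (?e i)) p = D (?e i) (D (?e i) T) p x - D (?e i) (D x
        T) p (?e i)"
      by (simp add: D_diff smooth_fun_apply smooth_fun_DT smooth_fun_const D_apply_const)
    have "D (?e i) (\<lambda>q. T q (D (?e i) T q x - D x T q (?e i))) p = D (?e i) (\<lambda>q. D (?e i) T q x - D x T q
        (?e i)) p"
      by (simp only: DT_torsion)
    then have "D (?e i) T p 0 + T p (D (?e i) (D (?e i) T) p x - D (?e i) (D x T) p (?e i))
       = D (?e i) (D (?e i) T) p x - D (?e i) (D x T) p (?e i)"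
      by (simp only: D_apply[OF smooth_fun_T sC] DC DT_symmetric[OF T_frame(1) x] diff_self)
    then have "N (D (?e i) (D (?e i) T) p x - D (?e i) (D x T) p (?e i)) = 0"
      by (simp add: N_def blinfun.zero_right)
    then show ?thesis
      by (simp add: N_diff D_commute_tangent[OF T_frame(1) x smooth_fun_T])
  qed
  have "D x mc p = (\<Sum>b\<in>Basis. D x (D b T) p (flip b))"
    unfolding mc_def by (subst D_sum) (auto intro: smooth_fun_apply smooth_fun_DT smooth_fun_const simp:
        D_apply_const smooth_fun_DT)
  also have "\<dots> = (\<Sum>i\<in>UNIV. D x (D (?e i) T) p (?e i)) - (\<Sum>\<alpha>\<in>UNIV. D x (D (?\<nu> \<alpha>) T) p (?\<nu> \<alpha>))"
  proof (rule contraction_adapted_frame[OF frame_adapted])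
    show "linear (\<lambda>w. blinfun_apply (D x (D v T) p) w)" for v
      by (rule linearI) (simp_all only: blinfun.bilinear_simps)
    show "linear (\<lambda>v. blinfun_apply (D x (D v T) p) w)" for w
      by (rule linearI) (simp_all only: linear_add[OF linear_D_D[OF smooth_fun_T]] linear_scale[OF
          linear_D_D[OF smooth_fun_T]] blinfun.bilinear_simps)
  qed
  finally have Dmc: "D x mc p = (\<Sum>i\<in>UNIV. D x (D (?e i) T) p (?e i)) - (\<Sum>\<alpha>\<in>UNIV. D x (D (?\<nu> \<alpha>) T) p (?\<nu>
      \<alpha>))" .
  have "N (D x (D (?\<nu> \<alpha>) T) p (?\<nu> \<alpha>)) = 0" for \<alpha>
    using DT_normal[OF T_frame(2)[of p \<alpha>], of "D x T p (?\<nu> \<alpha>)"]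
    by (simp add: D_D_normal[OF T_frame(2) smooth_fun_T] N_def)
  then have "N (D x mc p) = (\<Sum>i\<in>UNIV. N (D x (D (?e i) T) p (?e i)))"
    by (simp add: Dmc N_diff N_sum N_sum')
  also have "\<dots> = N (lap T p x)"
    by (simp add: codazzi lap_frame smooth_fun_T blinfun.sum_left N_sum)
  finally have lapN: "N (lap T p x) = N (D x mc p)" by simp
  have FT: "T p (T p (F p)) = T p (F p)" and FN: "T p (F p - T p (F p)) = 0"
    by (simp_all add: blinfun.diff_right)
  have "N (D x mc p) = (1 / 2) *\<^sub>R N (D x T p (T p (F p)) + D x T p (F p - T p (F p)))"
    by (simp add: D_mc N_scaleR flip: blinfun.add_right)
  also have "\<dots> = (1 / 2) *\<^sub>R N (D x T p (T p (F p)))"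
    unfolding N_add using DT_normal[OF FN, of x] by (simp add: N_def)
  also have "D x T p (T p (F p)) = D (F p) T p x"
    using DT_symmetric[OF x FT] by (simp only: D_T)
  finally have "N (drift_lap T p x) = 0"
    by (simp add: drift_lap_def blinfun.diff_left blinfun.scaleR_left N_diff N_scaleR lapN)
  then show ?thesis by (simp add: N_def)
qed

text \<open>By \<open>drift_lap_T_tangent_invariant\<close> and self-adjointness, the operator preserves tangent and
  normal vectors. Its two blocks are determined by applying the drift Laplacian to \<open>T T = T\<close>: it
  is \<open>- 2 Q\<close> on tangent and \<open>2 Q\<close> on normal vectors.\<close>

lemma drift_lap_T: "drift_lap T p x = 2 *\<^sub>R Q p x - 4 *\<^sub>R Q p (T p x)"
proof -
  have idem: "drift_lap T p x = drift_lap T p (T p x) + T p (drift_lap T p x) + 2 *\<^sub>R Q p x" for x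
  proof -
    have "drift_lap (\<lambda>q. T q o\<^sub>L T q) p = (drift_lap T p o\<^sub>L T p) + (T p o\<^sub>L drift_lap T p) + 2 *\<^sub>R Q p"
      unfolding Q_frame by (rule drift_lap_bilinear[OF bounded_bilinear_blinfun_compose smooth_fun_T
          smooth_fun_T])
    then have "drift_lap T p = (drift_lap T p o\<^sub>L T p) + (T p o\<^sub>L drift_lap T p) + 2 *\<^sub>R Q p" unfolding
        T_idem .
    then have "drift_lap T p x = ((drift_lap T p o\<^sub>L T p) + (T p o\<^sub>L drift_lap T p) + 2 *\<^sub>R Q p) x" by (rule
        arg_cong)
    then show ?thesis unfolding blinfun.bilinear_simps blinfun_apply_blinfun_compose .
  qed
  have tan: "drift_lap T p x = - 2 *\<^sub>R Q p x" if "T p x = x" for x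
  proof -
    have cancel: "u = - v" if "u = u + u + v" for u v :: "('n, 'm) pseudo_space"
    proof -
      from that have "u + v = (u + u + v) - u" by simp
      also have "\<dots> = 0" using that by (metis diff_self)
      finally show ?thesis by (simp add: eq_neg_iff_add_eq_0)
    qed
    from idem[of x] have "drift_lap T p x = drift_lap T p x + drift_lap T p x + 2 *\<^sub>R Q p x"
      unfolding \<open>T p x = x\<close> drift_lap_T_tangent_invariant[OF \<open>T p x = x\<close>] .
    from cancel[OF this] show ?thesis by simp
  qed
  have nor: "drift_lap T p y = 2 *\<^sub>R Q p y" if y: "T p y = 0" for y
  proof -
    have "pinner (T p (drift_lap T p y)) u = 0" for u
    proof -
      have "pinner (T p (drift_lap T p y)) u = pinner y (drift_lap T p (T p u))"
        by (simp add: pinner_T drift_lap_T_selfadjoint)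
      also have "\<dots> = pinner (T p y) (drift_lap T p (T p u))"
        by (simp only: pinner_T drift_lap_T_tangent_invariant[OF T_T])
      finally show ?thesis by (simp add: y pinner.zero_left)
    qed
    then have "T p (drift_lap T p y) = 0" by (rule pinner_nondegenerate)
    with idem[of y] show ?thesis unfolding y blinfun.zero_right by (simp only: add_0)
  qed
  have "drift_lap T p x = drift_lap T p (T p x) + drift_lap T p (x - T p x)"
    by (simp flip: blinfun.add_right)
  also have "\<dots> = - 2 *\<^sub>R Q p (T p x) + 2 *\<^sub>R Q p (x - T p x)"
  proof -
    have "T p (x - T p x) = 0" by (simp add: blinfun.diff_right)
    from nor[OF this] show ?thesis by (simp only: tan[OF T_T])
  qed
  also have "\<dots> = 2 *\<^sub>R Q p x - (2 *\<^sub>R Q p (T p x) + 2 *\<^sub>R Q p (T p x))"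
    by (simp add: blinfun.diff_right scaleR_diff_right)
  finally show ?thesis by (simp flip: scaleR_add_left)
qed

section \<open>The norm of the mean curvature vector\<close>

lemma drift_lap_F: "drift_lap F p = mc p - (1 / 2) *\<^sub>R T p (F p)"
proof -
  have "D v F = (\<lambda>q. T q v)" for v by (rule ext) (rule D_F)
  then show ?thesis by (simp add: drift_lap_def lap_def mc_def D_apply_const smooth_fun_T)
qed

lemma drift_lap_mc: "drift_lap mc p = (1 / 2) *\<^sub>R (mc p + drift_lap T p (F p))"
proof -
  have sTF: "smooth_fun (\<lambda>q. T q (F q))" by (intro smooth_fun_apply smooth_fun_T smooth_fun_F)
  have mc': "mc = (\<lambda>q. (1 / 2) *\<^sub>R T q (F q) + (- 1 / 2) *\<^sub>R F q)"
    by (rule ext) (simp add: mc_shrinker scaleR_diff_right)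
  have TF: "drift_lap (\<lambda>q. T q (F q)) p = drift_lap T p (F p) + T p (drift_lap F p) + 2 *\<^sub>R mc p"
    using drift_lap_bilinear[OF bounded_bilinear_blinfun_apply smooth_fun_T smooth_fun_F, of p]
    by (simp add: D_F mc_frame)
  have "drift_lap mc p = (1 / 2) *\<^sub>R drift_lap (\<lambda>q. T q (F q)) p + (- 1 / 2) *\<^sub>R drift_lap F p"
    by (subst mc', subst drift_lap_add) (simp_all add: smooth_fun_linear[OF bounded_linear_scaleR_right]
        sTF smooth_fun_F
       drift_lap_linear[OF bounded_linear_scaleR_right] del: scaleR_minus_left)
  also have "\<dots> = (1 / 2) *\<^sub>R (mc p + drift_lap T p (F p))"
    by (simp add: TF drift_lap_F blinfun.bilinear_simps T_mc scaleR_add_right scaleR_diff_right flip: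
        scaleR_add_left)
       (simp add: algebra_simps flip: scaleR_add_left)
  finally show ?thesis .
qed

text \<open>Parseval: \<open>P i j\<close> is the component along \<open>e j\<close> of the tangent vector \<open>(D e\<^sub>i T) H\<close>.\<close>

lemma normsq_P_eq: "normsq_P \<A> F p = pinner (mc p) (Q p (mc p))"
proof -
  let ?e = "te p"
  have "(\<Sum>j\<in>UNIV. (P_coeff \<A> F p i j)\<^sup>2) = pinner (mc p) (D (?e i) T p (D (?e i) T p (mc p)))" for i
  proof -
    have t: "T p (D (?e i) T p (mc p)) = D (?e i) T p (mc p)" by (rule DT_normal[OF T_mc])
    have "P_coeff \<A> F p i j = pinner (D (?e i) T p (mc p)) (?e j)" for j
      using DT_selfadjoint[of "?e i" p "?e j" "mc p"]
      by (simp add: P_coeff_def mean_curvature_eq B_frame_eq pinner_commute[of "?e j"])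
    then show ?thesis
      using tangent_parseval[OF t, of "D (?e i) T p (mc p)"] by (simp add: power2_eq_square
          DT_selfadjoint)
  qed
  then show ?thesis by (simp add: normsq_P_def Q_apply pinner.sum_right)
qed

lemma normsq_H_fun: "normsq_H \<A> F = (\<lambda>q. - pinner (mc q) (mc q))"
  by (rule ext) (simp add: normsq_H_def mean_curvature_eq)

text \<open>The tangential part of \<open>D v mc\<close> is \<open>- (D v T) mc\<close>, by differentiating \<open>T mc = 0\<close>.\<close>

lemma normsq_nabla_H_eq:
  "normsq_nabla_H \<A> F p
   = - (\<Sum>k\<in>UNIV. pinner (D (te p k) mc p) (D (te p k) mc p)) + pinner (mc p) (Q p (mc p))"
proof -
  let ?e = "te p"
  have k: "pinner (D v mc p - T p (D v mc p)) (D v mc p - T p (D v mc p))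
      = pinner (D v mc p) (D v mc p) - pinner (mc p) (D v T p (D v T p (mc p)))" for v
  proof -
    have "D v (\<lambda>q. T q (mc q)) p = 0" by (simp add: T_mc)
    then have "T p (D v mc p) = - D v T p (mc p)"
      by (simp add: D_apply smooth_fun_T smooth_fun_mc eq_neg_iff_add_eq_0 add.commute)
    then have "pinner (T p (D v mc p)) (T p (D v mc p)) = pinner (mc p) (D v T p (D v T p (mc p)))"
      by (simp add: pinner.minus_left pinner.minus_right DT_selfadjoint)
    moreover have "pinner (T p (D v mc p)) (D v mc p) = pinner (T p (D v mc p)) (T p (D v mc p))"
      by (simp add: pinner_T)
    ultimately show ?thesis
      by (simp add: pinner.diff_left pinner.diff_right pinner_commute[of "D v mc p" "T p (D v mc p)"])
  qed
  have "nor_conn \<A> F (tan_ext \<A> F (?e k)) (mean_curvature \<A> F) p = D (?e k) mc p - T p (D (?e k) mc p)"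
      for k
    unfolding nor_conn_def flat_conn_def nor_proj_T tan_ext_def tan_proj_T D_def[symmetric]
        mean_curvature_eq ..
  then show ?thesis
    by (simp add: normsq_nabla_H_def Let_def k sum_subtractf Q_apply pinner.sum_right)
qed

theorem drift_laplacian_normsq_H:
  "drift_laplacian \<A> F (normsq_H \<A> F) p = normsq_H \<A> F p + 2 * normsq_P \<A> F p + 2 * normsq_nabla_H \<A> F p"
proof -
  let ?e = "te p"
  note s = smooth_fun_bilinear[OF bounded_bilinear_pinner smooth_fun_mc smooth_fun_mc]
  have "pinner (mc p) (drift_lap T p (F p)) = - 4 * pinner (mc p) (Q p (mc p))"
  proof -
    have "pinner (mc p) (drift_lap T p (F p)) = pinner (2 *\<^sub>R Q p (mc p)) (F p)"
      using drift_lap_T_selfadjoint[of p "mc p" "F p"] drift_lap_T[of p "mc p"]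
      by (simp add: T_mc blinfun.zero_right)
    also have "\<dots> = 2 * pinner (Q p (mc p)) (F p - T p (F p))"
      using Q_T[of p "mc p"] by (simp add: pinner.scaleR_left pinner.diff_right pinner_T[symmetric] T_mc
          blinfun.zero_right pinner.zero_left)
    also have "\<dots> = - 4 * pinner (mc p) (Q p (mc p))"
      by (simp add: F_normal_part pinner.minus_right pinner.scaleR_right Q_selfadjoint)
    finally show ?thesis .
  qed
  then have 1: "pinner (mc p) (drift_lap mc p) = pinner (mc p) (mc p) / 2 - 2 * pinner (mc p) (Q p (mc
      p))"
    by (simp add: drift_lap_mc pinner.scaleR_right pinner.add_right)
  have "drift_laplacian \<A> F (normsq_H \<A> F) p = drift_lap (\<lambda>q. - pinner (mc q) (mc q)) p"
    unfolding normsq_H_fun by (rule drift_laplacian_eq) (intro smooth_fun_minus s)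
  also have "\<dots> = - drift_lap (\<lambda>q. pinner (mc q) (mc q)) p"
    by (rule drift_lap_linear[OF bounded_linear_minus[OF bounded_linear_ident] s])
  also have "\<dots> = - (2 * pinner (mc p) (drift_lap mc p)
      + 2 * (\<Sum>i\<in>UNIV. pinner (D (?e i) mc p) (D (?e i) mc p)))"
    by (simp add: drift_lap_bilinear[OF bounded_bilinear_pinner smooth_fun_mc smooth_fun_mc]
        pinner_commute[of "drift_lap mc p"])
  finally show ?thesis
    by (simp add: 1 normsq_P_eq normsq_nabla_H_eq normsq_H_fun)
qed

end

section \<open>Commuting the drift Laplacian with derivatives\<close>

context spacelike_immersion begin

lemma linear_D_D_D:
  assumes "smooth_fun f"
  shows "linear (\<lambda>w. D u (D v (D w f)) p)"
proof (rule linearI)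
  fix a b r
  have "D v (D (a + b) f) = (\<lambda>q. D v (D a f) q + D v (D b f) q)"
    by (rule ext) (rule linear_add[OF linear_D_D[OF assms]])
  then show "D u (D v (D (a + b) f)) p = D u (D v (D a f)) p + D u (D v (D b f)) p"
    by (simp add: D_add smooth_fun_D assms)
  have "D v (D (r *\<^sub>R a) f) = (\<lambda>q. r *\<^sub>R D v (D a f) q)"
    by (rule ext) (rule linear_scale[OF linear_D_D[OF assms]])
  then show "D u (D v (D (r *\<^sub>R a) f)) p = r *\<^sub>R D u (D v (D a f)) p"
    by (simp add: D_scaleR smooth_fun_D assms)
qed

lemma tangent_eqI:
  assumes "T p v = v" "T p w = w" "\<And>u. T p u = u \<Longrightarrow> pinner v u = pinner w u"
  shows "v = w"
proof (rule pinner_eqI)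
  fix u
  have "pinner v u = pinner v (T p u)" using pinner_T[of p v u] assms(1) by simp
  also have "\<dots> = pinner w (T p u)" by (rule assms(3)) simp
  also have "\<dots> = pinner w u" using pinner_T[of p w u] assms(2) by simp
  finally show "pinner v u = pinner w u" .
qed

text \<open>Apply Parseval first to the tangent vectors \<open>(D v T) \<nu>\<^sub>\<alpha>\<close> and then to the normal vectors
  \<open>(D v T) e\<^sub>l\<close>; the minus sign is that of the normal metric.\<close>

lemma normal_trace_DT:
  assumes "T p u = u" "T p x = x"
  shows "(\<Sum>\<alpha>\<in>UNIV. pinner (D u T p (ne p \<alpha>)) (D x T p (ne p \<alpha>))) = - pinner (Q p x) u"
proof -
  let ?e = "te p" and ?\<nu> = "ne p"
  have DT_flip: "pinner (D v T p (?\<nu> \<alpha>)) (?e l) = pinner (D v T p (?e l)) (?\<nu> \<alpha>)" for v \<alpha> l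
    using DT_selfadjoint[of v p "?\<nu> \<alpha>" "?e l"] pinner_commute[of "?\<nu> \<alpha>"] by simp
  have "pinner (D u T p (?\<nu> \<alpha>)) (D x T p (?\<nu> \<alpha>))
      = (\<Sum>l\<in>UNIV. pinner (D u T p (?e l)) (?\<nu> \<alpha>) * pinner (D x T p (?e l)) (?\<nu> \<alpha>))" for \<alpha>
    unfolding tangent_parseval[OF DT_normal[OF T_frame(2)], of u p \<alpha> "D x T p (?\<nu> \<alpha>)"]
    by (simp only: DT_flip)
  then have "(\<Sum>\<alpha>\<in>UNIV. pinner (D u T p (?\<nu> \<alpha>)) (D x T p (?\<nu> \<alpha>)))
      = (\<Sum>l\<in>UNIV. \<Sum>\<alpha>\<in>UNIV. pinner (D u T p (?e l)) (?\<nu> \<alpha>) * pinner (D x T p (?e l)) (?\<nu> \<alpha>))"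
    by (simp add: sum.swap[of _ "UNIV :: 'm set"])
  also have "\<dots> = (\<Sum>l\<in>UNIV. - pinner (D u T p (?e l)) (D x T p (?e l)))"
  proof (rule sum.cong[OF refl])
    fix l
    show "(\<Sum>\<alpha>\<in>UNIV. pinner (D u T p (?e l)) (?\<nu> \<alpha>) * pinner (D x T p (?e l)) (?\<nu> \<alpha>)) = - pinner (D u T p
        (?e l)) (D x T p (?e l))"
      using normal_parseval[OF DT_tangent[OF T_frame(1)], of u p l "D x T p (?e l)"] by simp
  qed
  also have "\<dots> = (\<Sum>l\<in>UNIV. - pinner (D (?e l) T p (D (?e l) T p x)) u)"
  proof (rule sum.cong[OF refl])
    fix l
    have "pinner (D u T p (?e l)) (D x T p (?e l)) = pinner u (D (?e l) T p (D (?e l) T p x))"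
      unfolding DT_symmetric[OF assms(1) T_frame(1)] DT_symmetric[OF assms(2) T_frame(1)] by (rule
          DT_selfadjoint)
    then show "- pinner (D u T p (?e l)) (D x T p (?e l)) = - pinner (D (?e l) T p (D (?e l) T p x)) u"
      by (simp add: pinner_commute)
  qed
  finally show ?thesis by (simp add: Q_apply pinner.sum_left sum_negf)
qed

text \<open>Both sides are tangential, so they can be tested against tangent vectors \<open>u\<close>. Symmetry and
  self-adjointness turn the left side into the trace of \<open>normal_trace_DT\<close>.\<close>

lemma sum_normal_DT_DT:
  assumes x: "T p x = x"
  shows "(\<Sum>\<alpha>\<in>UNIV. D (D x T p (ne p \<alpha>)) T p (ne p \<alpha>)) = - Q p x"
proof -
  let ?\<nu> = "ne p"
  have t: "T p (D x T p (?\<nu> \<alpha>)) = D x T p (?\<nu> \<alpha>)" for \<alpha> by (rule DT_normal) simp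
  show ?thesis
  proof (rule tangent_eqI)
    show "T p (\<Sum>\<alpha>\<in>UNIV. D (D x T p (?\<nu> \<alpha>)) T p (?\<nu> \<alpha>)) = (\<Sum>\<alpha>\<in>UNIV. D (D x T p (?\<nu> \<alpha>)) T p (?\<nu> \<alpha>))"
      by (simp add: blinfun.sum_right DT_normal)
    show "T p (- Q p x) = - Q p x" by (simp add: blinfun.minus_right Q_T x)
    fix u assume u: "T p u = u"
    have "pinner (D (D x T p (?\<nu> \<alpha>)) T p (?\<nu> \<alpha>)) u = pinner (D u T p (?\<nu> \<alpha>)) (D x T p (?\<nu> \<alpha>))" for \<alpha>
      unfolding DT_symmetric[OF t u, symmetric] DT_selfadjoint[of "D x T p (?\<nu> \<alpha>)"]
      using DT_selfadjoint[of u p "?\<nu> \<alpha>" "D x T p (?\<nu> \<alpha>)"] by (simp only: DT_symmetric[OF t u])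
    then show "pinner (\<Sum>\<alpha>\<in>UNIV. D (D x T p (?\<nu> \<alpha>)) T p (?\<nu> \<alpha>)) u = pinner (- Q p x) u"
      by (simp add: pinner.sum_left normal_trace_DT[OF u x] pinner.minus_left)
  qed
qed

end

context spacelike_shrinker begin

text \<open>The curvature terms of the Bochner formula; the shrinker equation cancels the mean curvature
  part of the Ricci tensor against the derivative of the drift.\<close>

lemma drift_lap_D:
  fixes f :: "'p \<Rightarrow> 'b::real_normed_vector"
  assumes x: "T p x = x" and f: "smooth_fun f"
  shows "drift_lap (D x f) p = D x (drift_lap f) p + D ((1 / 2) *\<^sub>R x - 2 *\<^sub>R Q p x) f p"
proof -
  let ?e = "te p" and ?\<nu> = "ne p"
  define C where "C = (\<lambda>j q. D (?e j) T q x - D x T q (?e j))"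
  have sC: "smooth_fun (C j)" for j unfolding C_def
    by (rule smooth_fun_diff; rule smooth_fun_apply[OF smooth_fun_DT(1) smooth_fun_const])
  have C0: "C j p = 0" for j unfolding C_def by (simp add: DT_symmetric[OF T_frame(1) x])
  have comm: "D (?e j) (D x f) = (\<lambda>q. D x (D (?e j) f) q + D (C j q) f q)" for j
    unfolding C_def by (rule ext) (simp flip: D_commute[OF f])
  have D0: "D 0 f = (\<lambda>q. 0)" by (rule ext) (simp add: f)
  have DD: "D (?e j) (D (?e j) (D x f)) p = D x (D (?e j) (D (?e j) f)) p + D (D (?e j) (C j) p) f p" for
      j
  proof -
    have "D (?e j) (D (?e j) (D x f)) p = D (?e j) (D x (D (?e j) f)) p + D (?e j) (\<lambda>q. D (C j q) f q) p"
      unfolding comm by (rule D_add) (intro smooth_fun_D smooth_fun_D_field f sC)+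
    also have "D (?e j) (\<lambda>q. D (C j q) f q) p = D (D (?e j) (C j) p) f p"
      by (simp add: D_D_field[OF f sC] C0 D0)
    also have "D (?e j) (D x (D (?e j) f)) p = D x (D (?e j) (D (?e j) f)) p"
      by (rule D_commute_tangent[OF T_frame(1) x]) (intro smooth_fun_D f)
    finally show ?thesis .
  qed
  \<comment> \<open>The frame \<open>e, \<nu>\<close> is adapted at \<open>p\<close> only: the derivatives of the terms along \<open>\<nu> \<alpha>\<close> do not
    vanish there.\<close>
  have "D x (lap f) p = (\<Sum>b\<in>Basis. D x (D b (D (flip b) f)) p)"
    unfolding lap_def[abs_def] by (rule D_sum) (auto intro: smooth_fun_D f)
  also have "\<dots> = (\<Sum>j\<in>UNIV. D x (D (?e j) (D (?e j) f)) p) - (\<Sum>\<alpha>\<in>UNIV. D x (D (?\<nu> \<alpha>) (D (?\<nu> \<alpha>) f)) p)"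
    by (rule contraction_adapted_frame[OF frame_adapted]) (intro linear_D_D_D linear_D_D smooth_fun_D f)+
  finally have Dlap: "D x (lap f) p = (\<Sum>j\<in>UNIV. D x (D (?e j) (D (?e j) f)) p)
     - (\<Sum>\<alpha>\<in>UNIV. D (D (D x T p (?\<nu> \<alpha>)) T p (?\<nu> \<alpha>)) f p)"
    by (simp add: D_D_normal smooth_fun_D f)
  define V where "V = (\<Sum>j\<in>UNIV. D (?e j) (C j) p) - Q p x"
  have lapD: "lap (D x f) p = D x (lap f) p + D V f p"
  proof -
    have "D V f p = (\<Sum>j\<in>UNIV. D (D (?e j) (C j) p) f p) + (\<Sum>\<alpha>\<in>UNIV. D (D (D x T p (?\<nu> \<alpha>)) T p (?\<nu> \<alpha>)) f
        p)"
      unfolding V_def diff_conv_add_uminus sum_normal_DT_DT[OF x, symmetric]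
      by (simp only: linear_add[OF linear_D[OF f]] linear_sum[OF linear_D[OF f]])
    then show ?thesis by (simp add: lap_frame smooth_fun_D f DD Dlap sum.distrib)
  qed
  have TDC: "T p (D (?e j) (C j) p) = D x T p (D (?e j) T p (?e j)) - D (?e j) T p (D (?e j) T p x)" for j
  proof -
    have "D (?e j) (C j) p = D (?e j) (D (?e j) T) p x - D (?e j) (D x T) p (?e j)"
      unfolding C_def by (simp add: D_diff smooth_fun_apply smooth_fun_DT smooth_fun_const D_apply_const)
    then show ?thesis
      by (simp add: blinfun.diff_right DDT_tangent_part x DT_symmetric[OF x T_frame(1)])
  qed
  \<comment> \<open>Only the tangential part of \<open>V\<close> matters; it is the Ricci curvature together with one more
    \<open>- Q p x\<close>.\<close>
  have TV: "T p V = D x T p (mc p) - 2 *\<^sub>R Q p x"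
    by (simp add: V_def blinfun.diff_right blinfun.sum_right TDC sum_subtractf mc_frame Q_T x scaleR_2)
       (simp add: Q_apply)
  define E where "E = D (F p) T p x - D x T p (F p)"
  \<comment> \<open>The normal part of the drift direction is \<open>- 2 mc\<close>; this is where the mean curvature term in
    \<open>V\<close> is compensated.\<close>
  have E: "T p E = 2 *\<^sub>R D x T p (mc p)"
  proof -
    have FT: "T p (T p (F p)) = T p (F p)" by simp
    have "D (F p) T p x = D x T p (T p (F p))" using DT_symmetric[OF FT x] by (simp only: D_T)
    then have "E = - D x T p (F p - T p (F p))" by (simp add: E_def blinfun.diff_right)
    also have "\<dots> = 2 *\<^sub>R D x T p (mc p)" by (simp add: F_normal_part blinfun.minus_right
        blinfun.scaleR_right)
    finally have "E = 2 *\<^sub>R D x T p (mc p)" .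
    then show ?thesis by (simp add: blinfun.scaleR_right DT_normal[OF T_mc])
  qed
  have "D x (drift_lap f) p = D x (lap f) p - (1 / 2) *\<^sub>R (D x f p + D x (D (F p) f) p)"
  proof -
    have "D x (\<lambda>q. D (F q) f q) p = D x f p + D x (D (F p) f) p"
      by (simp add: D_D_field[OF f smooth_fun_F] D_F x)
    moreover have "smooth_fun (\<lambda>q. D (F q) f q)" by (rule smooth_fun_D_field[OF f smooth_fun_F])
    ultimately show ?thesis
      unfolding drift_lap_def[abs_def]
      by (simp add: D_diff D_scaleR smooth_fun_lap[OF f] smooth_fun_linear[OF
          bounded_linear_scaleR_right])
  qed
  moreover have "D (F p) (D x f) p = D x (D (F p) f) p + D E f p"
    unfolding E_def by (simp flip: D_commute[OF f])
  ultimately have "drift_lap (D x f) p - D x (drift_lap f) p = D V f p + (1 / 2) *\<^sub>R D x f p - (1 / 2) *\<^sub>R D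
      E f p"
    by (simp add: drift_lap_def lapD algebra_simps)
  also have "\<dots> = D (V + (1 / 2) *\<^sub>R x - (1 / 2) *\<^sub>R E) f p"
    by (simp only: linear_add[OF linear_D[OF f]] linear_diff[OF linear_D[OF f]] linear_scale[OF
        linear_D[OF f]])
  also have "\<dots> = D (T p (V + (1 / 2) *\<^sub>R x - (1 / 2) *\<^sub>R E)) f p" by (simp only: D_T)
  also have "T p (V + (1 / 2) *\<^sub>R x - (1 / 2) *\<^sub>R E) = (1 / 2) *\<^sub>R x - 2 *\<^sub>R Q p x"
    by (simp add: blinfun.bilinear_simps TV E x)
  finally show ?thesis by (simp add: algebra_simps)
qed

end

context spacelike_immersion begin

section \<open>Traces of squares of derivatives\<close>

lemma pinner_split: "pinner x y = pinner (T p x) (T p y) + pinner (x - T p x) (y - T p y)"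
  using pinner_T[of p x y] pinner_T[of p x "T p y"] by (simp add: pinner.diff_left pinner.diff_right)

abbreviation "nor p x \<equiv> x - T p x"

text \<open>The two off-diagonal blocks of a self-adjoint operator contribute equally; Parseval turns
  the sum over the tangential parts at normal vectors into the sum over the normal parts at
  tangent vectors.\<close>

lemma lin_trace_blocks:
  fixes X Y :: "('n, 'm) pseudo_space \<Rightarrow>\<^sub>L ('n, 'm) pseudo_space"
  assumes X: "\<And>x y. pinner (X x) y = pinner x (X y)" and Y: "\<And>x y. pinner (Y x) y = pinner x (Y y)"
  shows "lin_trace (Y o\<^sub>L X) = (\<Sum>j\<in>UNIV. pinner (T p (X (te p j))) (T p (Y (te p j))))
     + 2 * (\<Sum>j\<in>UNIV. pinner (nor p (X (te p j))) (nor p (Y (te p j))))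
     - (\<Sum>\<alpha>\<in>UNIV. pinner (nor p (X (ne p \<alpha>))) (nor p (Y (ne p \<alpha>))))"
proof -
  let ?e = "te p" and ?\<nu> = "ne p"
  have TX: "pinner (T p (X (?\<nu> \<alpha>))) (T p (Y (?\<nu> \<alpha>)))
      = (\<Sum>j\<in>UNIV. pinner (nor p (X (?e j))) (?\<nu> \<alpha>) * pinner (nor p (Y (?e j))) (?\<nu> \<alpha>))" for \<alpha>
  proof -
    have n: "pinner (T p z) (?\<nu> \<alpha>) = 0" for z by (simp add: pinner_T pinner.zero_right)
    have "pinner (T p (X (?\<nu> \<alpha>))) (?e j) = pinner (X (?e j)) (?\<nu> \<alpha>)" for j
      using X[of "?\<nu> \<alpha>" "?e j"] by (simp add: pinner_T pinner_commute[of "?\<nu> \<alpha>"])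
    moreover have "pinner (T p (Y (?\<nu> \<alpha>))) (?e j) = pinner (Y (?e j)) (?\<nu> \<alpha>)" for j
      using Y[of "?\<nu> \<alpha>" "?e j"] by (simp add: pinner_T pinner_commute[of "?\<nu> \<alpha>"])
    ultimately show ?thesis
      using tangent_parseval[OF T_T, of p "X (?\<nu> \<alpha>)" "T p (Y (?\<nu> \<alpha>))"] by (simp add: pinner.diff_left n)
  qed
  have "(\<Sum>\<alpha>\<in>UNIV. pinner (T p (X (?\<nu> \<alpha>))) (T p (Y (?\<nu> \<alpha>))))
      = (\<Sum>j\<in>UNIV. \<Sum>\<alpha>\<in>UNIV. pinner (nor p (X (?e j))) (?\<nu> \<alpha>) * pinner (nor p (Y (?e j))) (?\<nu> \<alpha>))"
    unfolding TX by (rule sum.swap)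
  also have "\<dots> = - (\<Sum>j\<in>UNIV. pinner (nor p (X (?e j))) (nor p (Y (?e j))))"
  proof -
    have "T p (nor p (X (?e j))) = 0" for j by (simp add: blinfun.diff_right)
    then have "(\<Sum>\<alpha>\<in>UNIV. pinner (nor p (X (?e j))) (?\<nu> \<alpha>) * pinner (nor p (Y (?e j))) (?\<nu> \<alpha>))
       = - pinner (nor p (X (?e j))) (nor p (Y (?e j)))" for j
      using normal_parseval[of p "nor p (X (?e j))" "nor p (Y (?e j))"] by simp
    then show ?thesis by (simp add: sum_negf)
  qed
  finally have mixed: "(\<Sum>\<alpha>\<in>UNIV. pinner (T p (X (?\<nu> \<alpha>))) (T p (Y (?\<nu> \<alpha>))))
     = - (\<Sum>j\<in>UNIV. pinner (nor p (X (?e j))) (nor p (Y (?e j))))" .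
  have "lin_trace (Y o\<^sub>L X) = (\<Sum>j\<in>UNIV. pinner (X (?e j)) (Y (?e j))) - (\<Sum>\<alpha>\<in>UNIV. pinner (X (?\<nu> \<alpha>)) (Y (?\<nu>
      \<alpha>)))"
    by (simp add: lin_trace_adapted_frame[OF frame_adapted[of p]] Y)
  then show ?thesis
    by (simp only: pinner_split[of "X _" "Y _" p] sum.distrib mixed)
qed

lemma lin_trace_DT:
  fixes Y :: "('n, 'm) pseudo_space \<Rightarrow>\<^sub>L ('n, 'm) pseudo_space"
  assumes Y: "\<And>x y. pinner (Y x) y = pinner x (Y y)"
  shows "lin_trace (Y o\<^sub>L D v T p) = 2 * (\<Sum>j\<in>UNIV. pinner (D v T p (te p j)) (Y (te p j)))"
proof -
  let ?e = "te p" and ?\<nu> = "ne p"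
  have "pinner (D v T p (?e j)) (T p (Y (?e j))) = 0" for j
    using pinner_T[of p "D v T p (?e j)" "Y (?e j)"] by (simp add: DT_tangent pinner.zero_left)
  then show ?thesis
    unfolding lin_trace_blocks[OF DT_selfadjoint Y, of v p p]
    by (simp add: DT_tangent DT_normal pinner_simps)
qed

lemma lin_trace_DT_DT:
  "lin_trace (D w T p o\<^sub>L D v T p) = 2 * (\<Sum>j\<in>UNIV. pinner (D v T p (te p j)) (D w T p (te p j)))"
  by (rule lin_trace_DT) (rule DT_selfadjoint)

lemma linear_lin_trace_DT:
  "linear (\<lambda>w. lin_trace (D v T q o\<^sub>L D w T q))" "linear (\<lambda>v. lin_trace (D v T q o\<^sub>L D w T q))"
  by (rule linearI; simp only: linear_add[OF linear_D[OF smooth_fun_T]] linear_scale[OF linear_D[OF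
      smooth_fun_T]]
      bounded_bilinear.add_right[OF bounded_bilinear_blinfun_compose] bounded_bilinear.add_left[OF
          bounded_bilinear_blinfun_compose]
      bounded_bilinear.scaleR_right[OF bounded_bilinear_blinfun_compose] bounded_bilinear.scaleR_left[OF
          bounded_bilinear_blinfun_compose]
      lin_trace_simps)+

text \<open>By \<open>lin_trace_DT_DT\<close>, the two off-diagonal blocks of \<open>D v T\<close> count the second fundamental
  form twice.\<close>

lemma normsq_B_trace: "normsq_B \<A> F q = - (1 / 2) * (\<Sum>b\<in>Basis. lin_trace (D b T q o\<^sub>L D (flip b) T q))"
proof -
  let ?e = "te q"
  have "(\<Sum>b\<in>Basis. lin_trace (D b T q o\<^sub>L D (flip b) T q)) = (\<Sum>i\<in>UNIV. lin_trace (D (?e i) T q o\<^sub>L D (?e i)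
      T q))"
    by (rule contraction_frame[OF linear_lin_trace_DT]) (simp add: smooth_fun_T blinfun_compose_zero
        linear_0[OF linear_lin_trace])
  then have "(\<Sum>b\<in>Basis. lin_trace (D b T q o\<^sub>L D (flip b) T q))
      = 2 * (\<Sum>i\<in>UNIV. \<Sum>j\<in>UNIV. pinner (D (?e i) T q (?e j)) (D (?e i) T q (?e j)))"
    by (simp only: lin_trace_DT_DT[of _ q] sum_distrib_left)
  then show ?thesis by (simp add: normsq_B_def B_frame_eq)
qed

text \<open>The frame belongs to the fixed point \<open>p\<close> while \<open>q\<close> varies: the vectors are constants, so
  both sides can be differentiated as functions of \<open>q\<close>. The terms along \<open>\<nu> \<alpha>\<close> vanish at \<open>p\<close>, but
  not to second order.\<close>

lemma normsq_B_trace_frame: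
  "normsq_B \<A> F q = - (1 / 2) * (\<Sum>i\<in>UNIV. lin_trace (D (te p i) T q o\<^sub>L D (te p i) T q))
     + (1 / 2) * (\<Sum>\<alpha>\<in>UNIV. lin_trace (D (ne p \<alpha>) T q o\<^sub>L D (ne p \<alpha>) T q))"
proof -
  have "(\<Sum>b\<in>Basis. lin_trace (D b T q o\<^sub>L D (flip b) T q))
     = (\<Sum>i\<in>UNIV. lin_trace (D (te p i) T q o\<^sub>L D (te p i) T q))
       - (\<Sum>\<alpha>\<in>UNIV. lin_trace (D (ne p \<alpha>) T q o\<^sub>L D (ne p \<alpha>) T q))"
    by (rule contraction_adapted_frame[OF frame_adapted linear_lin_trace_DT])
  then show ?thesis unfolding normsq_B_trace by (simp add: algebra_simps)
qed

lemma smooth_fun_trace_square: "smooth_fun (\<lambda>q. lin_trace (D v T q o\<^sub>L D v T q))"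
  by (intro smooth_fun_linear[OF bounded_linear_lin_trace] smooth_fun_bilinear[OF
      bounded_bilinear_blinfun_compose] smooth_fun_DT)

lemma drift_lap_trace_square:
  "drift_lap (\<lambda>q. lin_trace (D v T q o\<^sub>L D v T q)) p
   = 2 * lin_trace (drift_lap (D v T) p o\<^sub>L D v T p)
     + 2 * (\<Sum>k\<in>UNIV. lin_trace (D (te p k) (D v T) p o\<^sub>L D (te p k) (D v T) p))"
proof -
  have "drift_lap (\<lambda>q. lin_trace (D v T q o\<^sub>L D v T q)) p = lin_trace (drift_lap (\<lambda>q. D v T q o\<^sub>L D v T q)
      p)"
    by (intro drift_lap_linear[OF bounded_linear_lin_trace] smooth_fun_bilinear[OF
        bounded_bilinear_blinfun_compose] smooth_fun_DT)
  then show ?thesis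
    by (simp add: drift_lap_bilinear[OF bounded_bilinear_blinfun_compose] smooth_fun_DT lin_trace_simps
        lin_trace_compose_commute[of "D v T p"])
qed

end

section \<open>The norm of the second fundamental form\<close>

lemma sum_UNIV_pairs: "(\<Sum>x\<in>UNIV. h x) = (\<Sum>a\<in>UNIV. \<Sum>b\<in>UNIV. h (a, b))"
  for h :: "'a::finite \<times> 'b::finite \<Rightarrow> 'c::comm_monoid_add"
  by (simp add: sum.cartesian_product case_prod_unfold)

lemma sum_swap_pairs:
  fixes f :: "'a::finite \<Rightarrow> 'a \<Rightarrow> 'a \<Rightarrow> 'a \<Rightarrow> real"
  shows "(\<Sum>c\<in>UNIV. \<Sum>d\<in>UNIV. \<Sum>a\<in>UNIV. \<Sum>b\<in>UNIV. f a b c d) = (\<Sum>a\<in>UNIV. \<Sum>b\<in>UNIV. \<Sum>c\<in>UNIV. \<Sum>d\<in>UNIV. f a b c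
      d)"
  using sum.swap[of "\<lambda>x y. f (fst y) (snd y) (fst x) (snd x)" UNIV UNIV] by (simp add: sum_UNIV_pairs)

text \<open>For the matrix \<open>h\<close>, both sides are the squared norm of a Gram matrix, \<open>tr (h h\<^sup>T h h\<^sup>T)\<close>.\<close>

lemma sum_square_gram:
  fixes h :: "'a::finite \<Rightarrow> 'b::finite \<Rightarrow> real"
  shows "(\<Sum>\<alpha>\<in>UNIV. \<Sum>\<beta>\<in>UNIV. (\<Sum>x\<in>UNIV. h \<alpha> x * h \<beta> x)\<^sup>2) = (\<Sum>x\<in>UNIV. \<Sum>y\<in>UNIV. (\<Sum>\<alpha>\<in>UNIV. h \<alpha> x * h \<alpha> y)\<^sup>2)"
  using sum.swap[of "\<lambda>u v. h (fst u) (fst v) * h (snd u) (fst v) * (h (fst u) (snd v) * h (snd u) (snd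
      v))" UNIV UNIV]
  by (simp add: sum_UNIV_pairs power2_eq_square sum_product mult_ac)

text \<open>The cross terms contain two different ways of pairing the four indices; up to renaming there
  is only one such sum.\<close>

lemma sum_pairing_square:
  fixes g :: "'a::finite \<Rightarrow> 'a \<Rightarrow> 'a \<Rightarrow> 'a \<Rightarrow> real"
  shows "(\<Sum>k\<in>UNIV. \<Sum>i\<in>UNIV. \<Sum>j\<in>UNIV. \<Sum>l\<in>UNIV. (g k j i l + g i j k l)\<^sup>2)
    = 2 * (\<Sum>a\<in>UNIV. \<Sum>b\<in>UNIV. \<Sum>c\<in>UNIV. \<Sum>d\<in>UNIV. (g a b c d)\<^sup>2)
     + 2 * (\<Sum>a\<in>UNIV. \<Sum>b\<in>UNIV. \<Sum>c\<in>UNIV. \<Sum>d\<in>UNIV. g a c b d * g b c a d)"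
proof -
  let ?G = "\<Sum>a\<in>UNIV. \<Sum>b\<in>UNIV. \<Sum>c\<in>UNIV. \<Sum>d\<in>UNIV. (g a b c d)\<^sup>2"
  have 1: "(\<Sum>k\<in>UNIV. \<Sum>i\<in>UNIV. \<Sum>j\<in>UNIV. \<Sum>l\<in>UNIV. (g k j i l)\<^sup>2) = ?G"
    by (rule sum.cong[OF refl]) (rule sum.swap)
  have "(\<Sum>k\<in>UNIV. \<Sum>i\<in>UNIV. \<Sum>j\<in>UNIV. \<Sum>l\<in>UNIV. (g i j k l)\<^sup>2)
      = (\<Sum>i\<in>UNIV. \<Sum>k\<in>UNIV. \<Sum>j\<in>UNIV. \<Sum>l\<in>UNIV. (g i j k l)\<^sup>2)" by (rule sum.swap)
  also have "\<dots> = ?G" by (rule sum.cong[OF refl]) (rule sum.swap)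
  finally have 2: "(\<Sum>k\<in>UNIV. \<Sum>i\<in>UNIV. \<Sum>j\<in>UNIV. \<Sum>l\<in>UNIV. (g i j k l)\<^sup>2) = ?G" .
  have "(g k j i l + g i j k l)\<^sup>2 = (g k j i l)\<^sup>2 + (g i j k l)\<^sup>2 + 2 * (g k j i l * g i j k l)" for i j k l
    by (simp add: power2_sum mult.assoc)
  then show ?thesis by (simp only: sum.distrib 1 2 sum_distrib_left[symmetric] mult_2)
qed

context spacelike_immersion begin

abbreviation shape :: "'p \<Rightarrow> 'n \<Rightarrow> ('n, 'm) pseudo_space \<Rightarrow>\<^sub>L ('n, 'm) pseudo_space" where
  "shape p i \<equiv> D (te p i) T p"

definition BB :: "'p \<Rightarrow> 'n \<Rightarrow> 'n \<Rightarrow> 'n \<Rightarrow> 'n \<Rightarrow> real" where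
  "BB p i j k l = pinner (B_frame \<A> F p i j) (B_frame \<A> F p k l)"

text \<open>The three contractions of \<open>BB \<otimes> BB\<close> that occur: both factors pair the four indices in the
  same way, in two different ways, or each factor has an index that is traced within it.\<close>

definition G2 :: "'p \<Rightarrow> real" where
  "G2 p = (\<Sum>a\<in>UNIV. \<Sum>b\<in>UNIV. \<Sum>c\<in>UNIV. \<Sum>d\<in>UNIV. (BB p a b c d)\<^sup>2)"
definition X2 :: "'p \<Rightarrow> real" where
  "X2 p = (\<Sum>a\<in>UNIV. \<Sum>b\<in>UNIV. \<Sum>c\<in>UNIV. \<Sum>d\<in>UNIV. BB p a c b d * BB p b c a d)"
definition K2 :: "'p \<Rightarrow> real" where
  "K2 p = (\<Sum>a\<in>UNIV. \<Sum>b\<in>UNIV. \<Sum>c\<in>UNIV. \<Sum>d\<in>UNIV. BB p a c a d * BB p b c b d)"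

lemma B_frame_sym: "B_frame \<A> F p i j = B_frame \<A> F p j i"
  unfolding B_frame_eq by (rule DT_symmetric) simp_all

lemma T_B_frame: "T p (B_frame \<A> F p i j) = 0"
  unfolding B_frame_eq by (rule DT_tangent) simp

lemma T_shape_B: "T p (shape p k (B_frame \<A> F p i j)) = shape p k (B_frame \<A> F p i j)"
  by (rule DT_normal[OF T_B_frame])

lemma shape_B_frame: "pinner (shape p k (B_frame \<A> F p i j)) (te p l) = BB p i j k l"
  by (simp add: DT_selfadjoint BB_def B_frame_eq[of p k l])

lemma pinner_shape_B:
  "pinner (shape p k (B_frame \<A> F p i j)) (shape p m (B_frame \<A> F p n u)) = (\<Sum>l\<in>UNIV. BB p i j k l * BB p
      n u m l)"
  unfolding tangent_parseval[OF T_shape_B, of p k i j "shape p m (B_frame \<A> F p n u)"] shape_B_frame ..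

lemma shape_shape_nor_frame:
  "shape p i (shape p k (ne p \<alpha>)) = (\<Sum>l\<in>UNIV. pinner (B_frame \<A> F p k l) (ne p \<alpha>) *\<^sub>R B_frame \<A> F p i l)"
proof -
  let ?\<nu> = "ne p \<alpha>"
  have "pinner (shape p k ?\<nu>) (te p l) = pinner (B_frame \<A> F p k l) ?\<nu>" for l
    unfolding B_frame_eq DT_selfadjoint[of _ p ?\<nu>] by (rule pinner_commute)
  then have "shape p k ?\<nu> = (\<Sum>l\<in>UNIV. pinner (B_frame \<A> F p k l) ?\<nu> *\<^sub>R te p l)"
    using tangent_expansion[of p "shape p k ?\<nu>"] DT_normal[of p ?\<nu>] by simp
  then have "shape p i (shape p k ?\<nu>) = shape p i (\<Sum>l\<in>UNIV. pinner (B_frame \<A> F p k l) ?\<nu> *\<^sub>R te p l)" by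
      (rule arg_cong)
  then show ?thesis by (simp add: blinfun.sum_right blinfun.scaleR_right B_frame_eq[of p i])
qed

text \<open>The form on the normal space is negative definite, so Parseval over \<open>\<nu>\<close> brings a minus sign.\<close>

lemma sum_shape_shape:
  "(\<Sum>\<alpha>\<in>UNIV. pinner (shape p i (shape p k (ne p \<alpha>))) (shape p m (shape p n (ne p \<alpha>))))
   = - (\<Sum>l\<in>UNIV. \<Sum>u\<in>UNIV. BB p k l n u * BB p i l m u)"
proof -
  let ?\<nu> = "ne p" and ?B = "B_frame \<A> F p"
  have "(\<Sum>\<alpha>\<in>UNIV. pinner (shape p i (shape p k (?\<nu> \<alpha>))) (shape p m (shape p n (?\<nu> \<alpha>))))
     = (\<Sum>\<alpha>\<in>UNIV. \<Sum>l\<in>UNIV. \<Sum>u\<in>UNIV. pinner (?B k l) (?\<nu> \<alpha>) * pinner (?B n u) (?\<nu> \<alpha>) * BB p i l m u)"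
    by (simp add: shape_shape_nor_frame pinner.sum_left pinner.sum_right pinner.scaleR_left
        pinner.scaleR_right BB_def
        sum_distrib_left mult_ac)
       (subst sum.swap, simp)?
  also have "\<dots> = (\<Sum>l\<in>UNIV. \<Sum>u\<in>UNIV. \<Sum>\<alpha>\<in>UNIV. pinner (?B k l) (?\<nu> \<alpha>) * pinner (?B n u) (?\<nu> \<alpha>) * BB p i l m
      u)"
    by (simp only: sum.swap[of _ "UNIV :: 'n set" "UNIV :: 'm set"])
  also have "\<dots> = (\<Sum>l\<in>UNIV. \<Sum>u\<in>UNIV. - (BB p k l n u * BB p i l m u))"
  proof (intro sum.cong refl)
    fix l u
    have "BB p k l n u = - (\<Sum>\<alpha>\<in>UNIV. pinner (?B k l) (?\<nu> \<alpha>) * pinner (?B n u) (?\<nu> \<alpha>))"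
      unfolding BB_def by (rule normal_parseval[OF T_B_frame])
    then show "(\<Sum>\<alpha>\<in>UNIV. pinner (?B k l) (?\<nu> \<alpha>) * pinner (?B n u) (?\<nu> \<alpha>) * BB p i l m u) = - (BB p k l n u
        * BB p i l m u)"
      by (simp add: sum_distrib_right)
  qed
  finally show ?thesis by (simp add: sum_negf)
qed

lemma Q_tan_frame: "Q p (te p j) = (\<Sum>i\<in>UNIV. shape p i (B_frame \<A> F p i j))"
  by (simp add: Q_apply B_frame_eq)

lemma sum_Q_frame: "(\<Sum>j\<in>UNIV. pinner (Q p (te p j)) (Q p (te p j))) = K2 p"
proof -
  let ?e = "te p"
  have t: "T p (Q p (?e j)) = Q p (?e j)" for j by (simp add: Q_T)
  have Qe: "pinner (Q p (?e j)) (?e k) = (\<Sum>i\<in>UNIV. BB p i j i k)" for j k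
    by (simp add: Q_tan_frame pinner.sum_left shape_B_frame)
  have "pinner (Q p (?e j)) (Q p (?e j)) = (\<Sum>k\<in>UNIV. \<Sum>a\<in>UNIV. \<Sum>b\<in>UNIV. BB p a j a k * BB p b j b k)" for j
    unfolding tangent_parseval[OF t, of j "Q p (?e j)"] Qe by (simp only: sum_product)
  then have "(\<Sum>j\<in>UNIV. pinner (Q p (?e j)) (Q p (?e j)))
     = (\<Sum>j\<in>UNIV. \<Sum>k\<in>UNIV. \<Sum>a\<in>UNIV. \<Sum>b\<in>UNIV. BB p a j a k * BB p b j b k)" by simp
  also have "\<dots> = K2 p" unfolding K2_def by (rule sum_swap_pairs)
  finally show ?thesis .
qed

lemma sum_S_coeff: "(\<Sum>\<alpha>\<in>UNIV. \<Sum>\<beta>\<in>UNIV. (S_coeff \<A> F p \<alpha> \<beta>)\<^sup>2) = G2 p"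
proof -
  let ?h = "\<lambda>\<alpha> x. h_coeff \<A> F p \<alpha> (fst x) (snd x)"
  have S: "S_coeff \<A> F p \<alpha> \<beta> = (\<Sum>x\<in>UNIV. ?h \<alpha> x * ?h \<beta> x)" for \<alpha> \<beta>
    by (simp add: S_coeff_def sum_UNIV_pairs)
  have "BB p i j k l = - (\<Sum>\<alpha>\<in>UNIV. ?h \<alpha> (i, j) * ?h \<alpha> (k, l))" for i j k l
    unfolding BB_def h_coeff_def normal_parseval[OF T_B_frame, of p i j "B_frame \<A> F p k l"] by simp
  then have G2: "G2 p = (\<Sum>x\<in>UNIV. \<Sum>y\<in>UNIV. (\<Sum>\<alpha>\<in>UNIV. ?h \<alpha> x * ?h \<alpha> y)\<^sup>2)"
    by (simp add: G2_def sum_UNIV_pairs)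
  show ?thesis unfolding S G2 by (rule sum_square_gram)
qed

text \<open>The curvature is the commutator of the shape operators; its squared norm has two equal
  square terms and two equal cross terms.\<close>

lemma normsq_R_perp_eq: "normsq_R_perp \<A> F p = 2 * K2 p - 2 * X2 p"
proof -
  let ?\<nu> = "ne p"
  let ?a = "\<lambda>i j \<alpha>. shape p i (shape p j (?\<nu> \<alpha>))"
  have sq: "(\<Sum>\<alpha>\<in>UNIV. pinner (?a i j \<alpha> - ?a j i \<alpha>) (?a i j \<alpha> - ?a j i \<alpha>))
      = - (\<Sum>l\<in>UNIV. \<Sum>u\<in>UNIV. BB p j l j u * BB p i l i u) - (\<Sum>l\<in>UNIV. \<Sum>u\<in>UNIV. BB p i l i u * BB p j l j
          u)
        + 2 * (\<Sum>l\<in>UNIV. \<Sum>u\<in>UNIV. BB p j l i u * BB p i l j u)" for i j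
  proof -
    have "(\<Sum>\<alpha>\<in>UNIV. pinner (?a i j \<alpha> - ?a j i \<alpha>) (?a i j \<alpha> - ?a j i \<alpha>))
       = (\<Sum>\<alpha>\<in>UNIV. pinner (?a i j \<alpha>) (?a i j \<alpha>)) + (\<Sum>\<alpha>\<in>UNIV. pinner (?a j i \<alpha>) (?a j i \<alpha>))
         - 2 * (\<Sum>\<alpha>\<in>UNIV. pinner (?a i j \<alpha>) (?a j i \<alpha>))"
      by (simp add: pinner.diff_left pinner.diff_right pinner_commute[of "?a j i _" "?a i j _"]
          sum.distrib sum_subtractf sum_distrib_left)
    then show ?thesis by (simp add: sum_shape_shape)
  qed
  have "normsq_R_perp \<A> F p = - (\<Sum>i\<in>UNIV. \<Sum>j\<in>UNIV. \<Sum>\<alpha>\<in>UNIV. pinner (?a i j \<alpha> - ?a j i \<alpha>) (?a i j \<alpha> - ?a j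
      i \<alpha>))"
    by (simp add: normsq_R_perp_def Let_def nor_curvature_eq)
  also have "\<dots> = (\<Sum>i\<in>UNIV. \<Sum>j\<in>UNIV. \<Sum>l\<in>UNIV. \<Sum>u\<in>UNIV. BB p j l j u * BB p i l i u)
     + (\<Sum>i\<in>UNIV. \<Sum>j\<in>UNIV. \<Sum>l\<in>UNIV. \<Sum>u\<in>UNIV. BB p i l i u * BB p j l j u)
     - 2 * (\<Sum>i\<in>UNIV. \<Sum>j\<in>UNIV. \<Sum>l\<in>UNIV. \<Sum>u\<in>UNIV. BB p j l i u * BB p i l j u)"
    unfolding sq by (simp add: sum.distrib sum_subtractf sum_negf sum_distrib_left)
  finally show ?thesis by (simp add: K2_def X2_def mult.commute)
qed

lemma normsq_nabla_B_eq:
  "normsq_nabla_B \<A> F p = - (\<Sum>k\<in>UNIV. \<Sum>i\<in>UNIV. \<Sum>j\<in>UNIV.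
     pinner (nor p (D (te p k) (D (te p i) T) p (te p j)))
            (nor p (D (te p k) (D (te p i) T) p (te p j))))"
  by (simp add: normsq_nabla_B_def Let_def nabla_second_ff_eq)

text \<open>The off-diagonal blocks of \<open>D e\<^sub>k (D e\<^sub>i T)\<close> give the covariant derivative of \<open>B\<close>, the
  diagonal blocks are anticommutators of first derivatives of \<open>T\<close>, up to sign.\<close>

lemma sum_trace_DDT:
  "(\<Sum>k\<in>UNIV. \<Sum>i\<in>UNIV. lin_trace (D (te p k) (D (te p i) T) p o\<^sub>L D (te p k) (D (te p i) T) p))
   = - 2 * normsq_nabla_B \<A> F p + 2 * G2 p + 4 * X2 p + 2 * K2 p"
proof -
  let ?e = "te p" and ?\<nu> = "ne p"
  let ?X = "\<lambda>k i. D (?e k) (D (?e i) T) p"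
  let ?a = "\<lambda>i j \<alpha>. shape p i (shape p j (?\<nu> \<alpha>))"
  have tan: "pinner (T p (?X k i (?e j))) (T p (?X k i (?e j))) = (\<Sum>l\<in>UNIV. (BB p k j i l + BB p i j k
      l)\<^sup>2)" for k i j
  proof -
    have "T p (?X k i (?e j)) = - (shape p i (B_frame \<A> F p k j) + shape p k (B_frame \<A> F p i j))"
      unfolding B_frame_eq by (rule DDT_tangent_part) simp
    then have "pinner (T p (?X k i (?e j))) (?e l) = - (BB p k j i l + BB p i j k l)" for l
      by (simp add: pinner.diff_left pinner.minus_left shape_B_frame)
    then show ?thesis
      unfolding tangent_parseval[OF T_T, of p "?X k i (?e j)" "T p (?X k i (?e j))"]
      by (simp only: power2_eq_square minus_mult_minus)
  qed
  have nor: "(\<Sum>\<alpha>\<in>UNIV. pinner (nor p (?X k i (?\<nu> \<alpha>))) (nor p (?X k i (?\<nu> \<alpha>))))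
      = - (\<Sum>l\<in>UNIV. \<Sum>u\<in>UNIV. BB p k l k u * BB p i l i u) - (\<Sum>l\<in>UNIV. \<Sum>u\<in>UNIV. BB p i l i u * BB p k l k
          u)
        - 2 * (\<Sum>l\<in>UNIV. \<Sum>u\<in>UNIV. BB p k l i u * BB p i l k u)" for k i
  proof -
    have "nor p (?X k i (?\<nu> \<alpha>)) = ?a i k \<alpha> + ?a k i \<alpha>" for \<alpha>
      by (rule DDT_normal_part) simp
    then have "(\<Sum>\<alpha>\<in>UNIV. pinner (nor p (?X k i (?\<nu> \<alpha>))) (nor p (?X k i (?\<nu> \<alpha>))))
       = (\<Sum>\<alpha>\<in>UNIV. pinner (?a i k \<alpha>) (?a i k \<alpha>)) + (\<Sum>\<alpha>\<in>UNIV. pinner (?a k i \<alpha>) (?a k i \<alpha>))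
         + 2 * (\<Sum>\<alpha>\<in>UNIV. pinner (?a i k \<alpha>) (?a k i \<alpha>))"
      by (simp add: pinner.add_left pinner.add_right pinner_commute[of "?a k i _" "?a i k _"] sum.distrib
          sum_distrib_left)
    then show ?thesis by (simp add: sum_shape_shape)
  qed
  have "(\<Sum>k\<in>UNIV. \<Sum>i\<in>UNIV. lin_trace (?X k i o\<^sub>L ?X k i))
    = (\<Sum>k\<in>UNIV. \<Sum>i\<in>UNIV. \<Sum>j\<in>UNIV. \<Sum>l\<in>UNIV. (BB p k j i l + BB p i j k l)\<^sup>2)
      - 2 * normsq_nabla_B \<A> F p
      + ((\<Sum>k\<in>UNIV. \<Sum>i\<in>UNIV. \<Sum>l\<in>UNIV. \<Sum>u\<in>UNIV. BB p k l k u * BB p i l i u)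
         + (\<Sum>k\<in>UNIV. \<Sum>i\<in>UNIV. \<Sum>l\<in>UNIV. \<Sum>u\<in>UNIV. BB p i l i u * BB p k l k u)
         + 2 * (\<Sum>k\<in>UNIV. \<Sum>i\<in>UNIV. \<Sum>l\<in>UNIV. \<Sum>u\<in>UNIV. BB p k l i u * BB p i l k u))"
    unfolding lin_trace_blocks[OF DDT_selfadjoint DDT_selfadjoint, of _ _ p _ _ p p] tan nor
        normsq_nabla_B_eq
    by (simp add: sum.distrib sum_subtractf sum_negf sum_distrib_left)
  then show ?thesis
    by (simp add: sum_pairing_square G2_def X2_def K2_def mult.commute)
qed

lemma sum_trace_normal:
  "(\<Sum>\<alpha>\<in>UNIV. \<Sum>k\<in>UNIV. lin_trace (D (te p k) (D (ne p \<alpha>) T) p o\<^sub>L D (te p k) (D (ne p \<alpha>) T) p))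
   = - 2 * K2 p"
proof -
  let ?e = "te p" and ?\<nu> = "ne p"
  let ?a = "\<lambda>i j \<alpha>. shape p i (shape p j (?\<nu> \<alpha>))"
  have "D (shape p k (?\<nu> \<alpha>)) T p (?e j) = ?a j k \<alpha>" for \<alpha> k j
    by (rule DT_symmetric) (simp_all add: DT_normal)
  then have "lin_trace (D (?e k) (D (?\<nu> \<alpha>) T) p o\<^sub>L D (?e k) (D (?\<nu> \<alpha>) T) p) = 2 * (\<Sum>j\<in>UNIV. pinner (?a j k
      \<alpha>) (?a j k \<alpha>))" for \<alpha> k
    by (simp add: D_D_normal[OF T_frame(2) smooth_fun_T] lin_trace_DT_DT)
  then have "(\<Sum>\<alpha>\<in>UNIV. \<Sum>k\<in>UNIV. lin_trace (D (?e k) (D (?\<nu> \<alpha>) T) p o\<^sub>L D (?e k) (D (?\<nu> \<alpha>) T) p))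
     = 2 * (\<Sum>\<alpha>\<in>UNIV. \<Sum>k\<in>UNIV. \<Sum>j\<in>UNIV. pinner (?a j k \<alpha>) (?a j k \<alpha>))"
    by (simp add: sum_distrib_left)
  also have "(\<Sum>\<alpha>\<in>UNIV. \<Sum>k\<in>UNIV. \<Sum>j\<in>UNIV. pinner (?a j k \<alpha>) (?a j k \<alpha>))
     = (\<Sum>k\<in>UNIV. \<Sum>j\<in>UNIV. \<Sum>\<alpha>\<in>UNIV. pinner (?a j k \<alpha>) (?a j k \<alpha>))"
    by (simp only: sum.swap[of _ "UNIV :: 'n set" "UNIV :: 'm set"])
  also have "\<dots> = - K2 p" by (simp add: sum_shape_shape K2_def sum_negf)
  finally show ?thesis by simp
qed

end

context spacelike_shrinker begin

text \<open>By \<open>drift_lap_D\<close>, the operator is \<open>D e\<^sub>i (\<L> T)\<close> plus a derivative of \<open>T\<close>. Against \<open>D e\<^sub>i T\<close>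
  only the normal part at tangent vectors of the first summand counts, and this follows from
  differentiating the commutation of \<open>\<L> T\<close> with \<open>T\<close>.\<close>

lemma sum_trace_drift_lap_DT:
  "(\<Sum>i\<in>UNIV. lin_trace (drift_lap (D (te p i) T) p o\<^sub>L shape p i))
   = - 8 * K2 p - 4 * G2 p - normsq_B \<A> F p"
proof -
  let ?e = "te p" and ?B = "B_frame \<A> F p"
  define Y where "Y = (\<lambda>i. D (?e i) (drift_lap T) p)"
  have sL: "smooth_fun (drift_lap T)" by (rule smooth_fun_drift_lap[OF smooth_fun_T])
  have Ysa: "pinner (Y i x) y = pinner x (Y i y)" for i x y
  proof -
    have "D (?e i) (\<lambda>q. pinner (drift_lap T q x) y) p = pinner (Y i x) y"
      using D_linear[OF pinner.bounded_linear_left smooth_fun_apply[OF sL smooth_fun_const]]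
      by (simp add: D_apply_const[OF sL] Y_def)
    moreover have "D (?e i) (\<lambda>q. pinner x (drift_lap T q y)) p = pinner x (Y i y)"
      using D_linear[OF pinner.bounded_linear_right smooth_fun_apply[OF sL smooth_fun_const]]
      by (simp add: D_apply_const[OF sL] Y_def)
    ultimately show ?thesis by (simp add: drift_lap_T_selfadjoint)
  qed
  have Ye: "pinner (?B i j) (Y i (?e j)) = - 2 * pinner (shape p i (?B i j)) (Q p (?e j)) - 2 * pinner (?B
      i j) (Q p (?B i j))" for i j
  proof -
    have comm: "T q (drift_lap T q x) = drift_lap T q (T q x)" for q x
      by (simp add: drift_lap_T blinfun.bilinear_simps Q_T)
    have "D (?e i) (\<lambda>q. T q (drift_lap T q (?e j))) p = D (?e i) (\<lambda>q. drift_lap T q (T q (?e j))) p"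
      by (simp only: comm)
    then have "shape p i (drift_lap T p (?e j)) + T p (Y i (?e j)) = Y i (?e j) + drift_lap T p (?B i j)"
      by (simp add: D_apply smooth_fun_apply smooth_fun_T sL smooth_fun_const D_apply_const Y_def
          B_frame_eq)
    then have "Y i (?e j) = shape p i (drift_lap T p (?e j)) + T p (Y i (?e j)) - drift_lap T p (?B i j)"
      by (simp add: algebra_simps)
    also have "drift_lap T p (?e j) = - 2 *\<^sub>R Q p (?e j)"
      by (simp add: drift_lap_T flip: scaleR_diff_left)
    also have "drift_lap T p (?B i j) = 2 *\<^sub>R Q p (?B i j)"
      by (simp add: drift_lap_T T_B_frame blinfun.zero_right)
    finally have "pinner (?B i j) (Y i (?e j)) = pinner (?B i j) (shape p i (- 2 *\<^sub>R Q p (?e j)) + T p (Y i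
        (?e j)) - 2 *\<^sub>R Q p (?B i j))"
      by (rule arg_cong)
    moreover have "pinner (?B i j) (T p (Y i (?e j))) = 0"
      using pinner_T[of p "?B i j" "Y i (?e j)"] by (simp add: T_B_frame pinner.zero_left)
    moreover have "pinner (?B i j) (shape p i (Q p (?e j))) = pinner (shape p i (?B i j)) (Q p (?e j))"
      by (rule DT_selfadjoint[symmetric])
    ultimately show ?thesis
      by (simp add: blinfun.minus_right blinfun.scaleR_right pinner.diff_right pinner.add_right
          pinner.minus_right pinner.scaleR_right)
  qed
  have tr1: "lin_trace (Y i o\<^sub>L shape p i) = (\<Sum>j\<in>UNIV. - 4 * pinner (shape p i (?B i j)) (Q p (?e j)) - 4 *
      pinner (?B i j) (Q p (?B i j)))" for i
  proof -
    have "lin_trace (Y i o\<^sub>L shape p i) = 2 * (\<Sum>j\<in>UNIV. pinner (?B i j) (Y i (?e j)))"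
      unfolding lin_trace_DT[OF Ysa] B_frame_eq ..
    also have "\<dots> = (\<Sum>j\<in>UNIV. 2 * (- 2 * pinner (shape p i (?B i j)) (Q p (?e j)) - 2 * pinner (?B i j) (Q
        p (?B i j))))"
      unfolding Ye sum_distrib_left ..
    finally show ?thesis by (simp add: algebra_simps)
  qed
  have tr2: "lin_trace (D ((1 / 2) *\<^sub>R ?e i - 2 *\<^sub>R Q p (?e i)) T p o\<^sub>L shape p i)
     = (\<Sum>j\<in>UNIV. pinner (?B i j) (?B i j) - 4 * pinner (shape p j (?B j i)) (Q p (?e i)))" for i
  proof -
    let ?w = "(1 / 2) *\<^sub>R ?e i - 2 *\<^sub>R Q p (?e i)"
    have w: "T p ?w = ?w" by (simp add: blinfun.bilinear_simps Q_T)
    have "D ?w T p (?e j) = (1 / 2) *\<^sub>R ?B i j - 2 *\<^sub>R shape p j (Q p (?e i))" for j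
      unfolding DT_symmetric[OF w T_frame(1)] B_frame_sym[of p i j]
      by (simp add: blinfun.diff_right blinfun.scaleR_right B_frame_eq)
    then have "lin_trace (D ?w T p o\<^sub>L shape p i) = 2 * (\<Sum>j\<in>UNIV. pinner (?B i j) ((1 / 2) *\<^sub>R ?B i j - 2 *\<^sub>R
        shape p j (Q p (?e i))))"
      unfolding lin_trace_DT_DT B_frame_eq by simp
    moreover have "pinner (?B i j) (shape p j (Q p (?e i))) = pinner (shape p j (?B j i)) (Q p (?e i))"
        for j
      unfolding B_frame_sym[of p i j] by (rule DT_selfadjoint[symmetric])
    ultimately show ?thesis
      by (simp add: pinner.diff_right pinner.scaleR_right sum_distrib_left algebra_simps)
  qed
  have split: "lin_trace (drift_lap (D (?e i) T) p o\<^sub>L shape p i)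
     = lin_trace (Y i o\<^sub>L shape p i) + lin_trace (D ((1 / 2) *\<^sub>R ?e i - 2 *\<^sub>R Q p (?e i)) T p o\<^sub>L shape p i)"
         for i
    unfolding drift_lap_D[OF T_frame(1) smooth_fun_T] Y_def
    by (simp add: bounded_bilinear.add_left[OF bounded_bilinear_blinfun_compose] lin_trace_simps)
  have QQ: "(\<Sum>j\<in>UNIV. \<Sum>i\<in>UNIV. pinner (shape p i (?B i j)) (Q p (?e j))) = K2 p"
    by (simp add: sum_Q_frame flip: pinner.sum_left Q_tan_frame)
  have QQ': "(\<Sum>i\<in>UNIV. \<Sum>j\<in>UNIV. pinner (shape p i (?B i j)) (Q p (?e j))) = K2 p"
    by (subst sum.swap) (rule QQ)
  have "pinner (?B i j) (Q p (?B i j)) = (\<Sum>k\<in>UNIV. \<Sum>l\<in>UNIV. (BB p i j k l)\<^sup>2)" for i j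
  proof -
    have "pinner (?B i j) (shape p k (shape p k (?B i j))) = (\<Sum>l\<in>UNIV. (BB p i j k l)\<^sup>2)" for k
      using pinner_shape_B[of p k i j k i j] by (simp add: DT_selfadjoint power2_eq_square)
    then show ?thesis by (simp add: Q_apply pinner.sum_right)
  qed
  then have BQB: "(\<Sum>i\<in>UNIV. \<Sum>j\<in>UNIV. pinner (?B i j) (Q p (?B i j))) = G2 p" by (simp add: G2_def)
  have "(\<Sum>i\<in>UNIV. lin_trace (drift_lap (D (?e i) T) p o\<^sub>L shape p i))
     = - 4 * (\<Sum>i\<in>UNIV. \<Sum>j\<in>UNIV. pinner (shape p i (?B i j)) (Q p (?e j)))
       - 4 * (\<Sum>i\<in>UNIV. \<Sum>j\<in>UNIV. pinner (?B i j) (Q p (?B i j)))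
       + (\<Sum>i\<in>UNIV. \<Sum>j\<in>UNIV. pinner (?B i j) (?B i j))
       - 4 * (\<Sum>i\<in>UNIV. \<Sum>j\<in>UNIV. pinner (shape p j (?B j i)) (Q p (?e i)))"
    unfolding split tr1 tr2 by (simp add: sum.distrib sum_subtractf sum_negf sum_distrib_left)
  then show ?thesis by (simp add: QQ QQ' BQB normsq_B_def)
qed

theorem drift_laplacian_normsq_B:
  "drift_laplacian \<A> F (normsq_B \<A> F) p =
     normsq_B \<A> F p + 2 * normsq_R_perp \<A> F p
     + 2 * (\<Sum>\<alpha>\<in>UNIV. \<Sum>\<beta>\<in>UNIV. (S_coeff \<A> F p \<alpha> \<beta>)\<^sup>2)
     + 2 * normsq_nabla_B \<A> F p"
proof -
  let ?e = "te p" and ?\<nu> = "ne p"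
  define f where "f = (\<lambda>q. \<Sum>i\<in>UNIV. lin_trace (D (?e i) T q o\<^sub>L D (?e i) T q))"
  define h where "h = (\<lambda>q. \<Sum>\<alpha>\<in>UNIV. lin_trace (D (?\<nu> \<alpha>) T q o\<^sub>L D (?\<nu> \<alpha>) T q))"
  have sf: "smooth_fun f" and sh: "smooth_fun h"
    unfolding f_def h_def by (intro smooth_fun_sum smooth_fun_trace_square finite)+
  have B: "normsq_B \<A> F = (\<lambda>q. (- 1 / 2) *\<^sub>R f q + (1 / 2) *\<^sub>R h q)"
    unfolding f_def h_def by (rule ext) (simp add: normsq_B_trace_frame[of _ p])
  have Lf: "drift_lap f p = 2 * (\<Sum>i\<in>UNIV. lin_trace (drift_lap (D (?e i) T) p o\<^sub>L shape p i))
      + 2 * (\<Sum>k\<in>UNIV. \<Sum>i\<in>UNIV. lin_trace (D (?e k) (D (?e i) T) p o\<^sub>L D (?e k) (D (?e i) T) p))"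
  proof -
    have "drift_lap f p = 2 * (\<Sum>i\<in>UNIV. lin_trace (drift_lap (D (?e i) T) p o\<^sub>L shape p i))
      + 2 * (\<Sum>i\<in>UNIV. \<Sum>k\<in>UNIV. lin_trace (D (?e k) (D (?e i) T) p o\<^sub>L D (?e k) (D (?e i) T) p))"
      unfolding f_def
      by (subst drift_lap_sum) (simp_all add: smooth_fun_trace_square drift_lap_trace_square sum.distrib
          sum_distrib_left)
    also have "(\<Sum>i\<in>UNIV. \<Sum>k\<in>UNIV. lin_trace (D (?e k) (D (?e i) T) p o\<^sub>L D (?e k) (D (?e i) T) p))
       = (\<Sum>k\<in>UNIV. \<Sum>i\<in>UNIV. lin_trace (D (?e k) (D (?e i) T) p o\<^sub>L D (?e k) (D (?e i) T) p))" by (rule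
           sum.swap)
    finally show ?thesis .
  qed
  have Lh: "drift_lap h p = 2 * (\<Sum>\<alpha>\<in>UNIV. \<Sum>k\<in>UNIV. lin_trace (D (?e k) (D (?\<nu> \<alpha>) T) p o\<^sub>L D (?e k) (D (?\<nu>
      \<alpha>) T) p))"
    unfolding h_def
    by (subst drift_lap_sum) (simp_all add: smooth_fun_trace_square drift_lap_trace_square
        sum_distrib_left smooth_fun_T linear_0[OF linear_lin_trace])
  have "smooth_fun (normsq_B \<A> F)"
    unfolding B by (intro smooth_fun_add smooth_fun_linear[OF bounded_linear_scaleR_right] sf sh)
  then have "drift_laplacian \<A> F (normsq_B \<A> F) p = drift_lap (normsq_B \<A> F) p" by (rule
      drift_laplacian_eq)
  also have "\<dots> = (- 1 / 2) *\<^sub>R drift_lap f p + (1 / 2) *\<^sub>R drift_lap h p"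
    unfolding B
    by (subst drift_lap_add; (intro smooth_fun_linear[OF bounded_linear_scaleR_right] sf sh)?)
       (simp only: drift_lap_linear[OF bounded_linear_scaleR_right sf] drift_lap_linear[OF
           bounded_linear_scaleR_right sh])
  finally show ?thesis
    unfolding Lf Lh sum_trace_drift_lap_DT sum_trace_DDT sum_trace_normal sum_S_coeff normsq_R_perp_eq
    by (simp add: field_simps)
qed

end

section \<open>Determinants of contractions\<close>

lemma row_combination: "(\<Sum>i\<in>UNIV. x $ i *s row i A) = x v* A" for A :: "real ^ 'n ^ 'n"
  by (simp add: vec_eq_iff vector_matrix_mult_def row_def mult.commute)

text \<open>The powers of a contraction are contractions, whose entries and hence determinants are
  bounded; but the powers of a number larger than 1 are not.\<close>

lemma det_contraction_le_1:
  fixes A :: "real ^ 'n ^ 'n"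
  assumes "\<And>x. norm (A *v x) \<le> norm x"
  shows "\<bar>det A\<bar> \<le> 1"
proof (rule ccontr)
  assume "\<not> \<bar>det A\<bar> \<le> 1"
  then obtain k where k: "real (card {p. p permutes (UNIV :: 'n set)}) < \<bar>det A\<bar> ^ k"
    using real_arch_pow[of "\<bar>det A\<bar>"] by (meson not_le)
  define B where "B = ((\<lambda>X. A ** X) ^^ k) (mat 1)"
  have "det B = det A ^ k \<and> (\<forall>x. norm (B *v x) \<le> norm x)"
    unfolding B_def
  proof (induction k)
    case (Suc k)
    let ?C = "((\<lambda>X. A ** X) ^^ k) (mat 1)"
    have "norm ((A ** ?C) *v x) \<le> norm x" for x
    proof -
      have "norm ((A ** ?C) *v x) = norm (A *v (?C *v x))" by (simp add: matrix_vector_mul_assoc)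
      also have "\<dots> \<le> norm (?C *v x)" by (rule assms)
      also have "\<dots> \<le> norm x" using Suc by blast
      finally show ?thesis .
    qed
    with Suc show ?case by (simp add: det_mul)
  qed simp
  then have det: "det B = det A ^ k" and B: "\<And>x. norm (B *v x) \<le> norm x" by auto
  have entry: "\<bar>B $ i $ j\<bar> \<le> 1" for i j
  proof -
    have "\<bar>B $ i $ j\<bar> = \<bar>(B *v axis j 1) $ i\<bar>" by (simp add: matrix_vector_mult_basis column_def)
    also have "\<dots> \<le> norm (B *v axis j 1)" by (rule component_le_norm_cart)
    also have "\<dots> \<le> norm (axis j 1 :: real ^ 'n)" by (rule B)
    finally show ?thesis by (simp add: norm_axis_1)
  qed
  have "\<bar>det B\<bar> \<le> (\<Sum>p\<in>{p. p permutes (UNIV :: 'n set)}. \<bar>of_int (sign p) * (\<Prod>i\<in>UNIV. B $ i $ p i)\<bar>)"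
    unfolding det_def by (rule sum_abs)
  also have "\<dots> \<le> (\<Sum>p\<in>{p. p permutes (UNIV :: 'n set)}. 1)"
  proof (rule sum_mono)
    fix p :: "'n \<Rightarrow> 'n"
    have "\<bar>of_int (sign p)\<bar> = (1::real)" by (simp add: sign_def)
    moreover have "\<bar>\<Prod>i\<in>UNIV. B $ i $ p i\<bar> \<le> 1" unfolding abs_prod by (rule prod_le_1) (use entry in auto)
    ultimately show "\<bar>of_int (sign p) * (\<Prod>i\<in>UNIV. B $ i $ p i)\<bar> \<le> 1" by (simp add: abs_mult)
  qed
  also have "\<dots> = real (card {p. p permutes (UNIV :: 'n set)})" by simp
  finally show False using k by (simp add: det power_abs)
qed

text \<open>After composition with a suitable \<open>S\<close> of determinant \<open>1 / r\<close>, where \<open>r\<close> is the length of the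
  image of the axis, the image of the axis becomes a unit vector \<open>y\<close> and the images of the
  orthogonal vectors become orthogonal to \<open>y\<close>. The composition is still a contraction, so its
  determinant is at most 1.\<close>

lemma det_contraction_le_axis:
  fixes A :: "real ^ 'n ^ 'n"
  assumes A: "\<And>x. norm (A *v x) \<le> norm x"
  shows "\<bar>det A\<bar> \<le> norm (A *v axis k 1)"
proof (cases "A *v axis k 1 = 0")
  case True
  have "\<not> invertible A"
  proof
    assume "invertible A"
    then obtain B where "B ** A = mat 1" unfolding invertible_def by blast
    then have "B *v (A *v axis k 1) = axis k 1" by (simp add: matrix_vector_mul_assoc)
    then show False using True by (simp add: axis_eq_0_iff)
  qed
  then have "det A = 0" using invertible_det_nz by blast
  then show ?thesis by simp
next
  case False
  define r where "r = norm (A *v axis k 1)"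
  define y where "y = (1 / r) *\<^sub>R (A *v axis k 1)"
  have r: "r > 0" using False by (simp add: r_def)
  have y1: "norm y = 1" using r by (simp add: y_def r_def)
  have yy: "inner y y = 1" using y1 by (simp add: norm_eq_1)
  have Ak: "A *v axis k 1 = r *\<^sub>R y" using r by (simp add: y_def)
  \<comment> \<open>\<open>S z = z + \<langle>c, z\<rangle> e\<^sub>k\<close> with \<open>A (S z) = z\<^sub>k y + (A z - \<langle>A z, y\<rangle> y)\<close>\<close>
  define c where "c = (1 / r) *\<^sub>R axis k 1 - (1 / r) *\<^sub>R (transpose A *v y)"
  define S where "S = (\<chi> i. if i = k then axis k 1 + c else (axis i 1 :: real ^ 'n))"
  have cz: "inner c z = (z $ k - inner (A *v z) y) / r" for z
  proof -
    have "inner (transpose A *v y) z = inner (A *v z) y"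
      using dot_lmul_matrix[of y A z] by (simp add: transpose_matrix_vector inner_commute[of "A *v z"])
    then show ?thesis by (simp add: c_def inner_diff_left inner_axis' diff_divide_distrib)
  qed
  have "c $ k = inner c (axis k 1)" by (simp add: inner_axis)
  also have "\<dots> = (1 - inner (r *\<^sub>R y) y) / r" by (simp only: cz Ak) (simp add: axis_def)
  also have "\<dots> = 1 / r - 1" using r y1 by (simp add: dot_square_norm diff_divide_distrib)
  finally have ck: "c $ k = 1 / r - 1" .
  have detS: "det S = 1 / r"
  proof -
    have "(\<chi> i. if i = k then (\<Sum>i\<in>UNIV. (axis k 1 + c) $ i *s row i (mat 1)) else row i (mat 1)) = S"
      unfolding row_combination vector_matrix_mul_rid by (simp add: S_def vec_eq_iff row_def mat_def
          axis_def)
    then show ?thesis using cramer_lemma_transpose[of k "axis k 1 + c" "mat 1"] by (simp add: ck)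
  qed
  have Sz: "S *v z = z + inner c z *\<^sub>R axis k 1" for z
  proof -
    have "(S *v z) $ i = inner (S $ i) z" for i by (simp add: matrix_vector_mul_component)
    then show ?thesis by (simp add: vec_eq_iff S_def inner_add_left inner_axis') (simp add: axis_def)
  qed
  have "norm ((A ** S) *v z) \<le> norm z" for z
  proof -
    define z' where "z' = z - z $ k *\<^sub>R axis k 1"
    define P where "P = (\<lambda>x. x - inner x y *\<^sub>R y)"
    have zz: "(norm z)\<^sup>2 = (norm z')\<^sup>2 + (z $ k)\<^sup>2"
      unfolding power2_norm_eq_inner by (simp add: z'_def inner_diff_left inner_diff_right inner_axis
          inner_axis' power2_eq_square)
    have "(A ** S) *v z = A *v z + inner c z *\<^sub>R (r *\<^sub>R y)"
      by (simp add: Sz matrix_vector_mul_assoc[symmetric] matrix_vector_right_distrib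
          matrix_vector_mult_scaleR Ak)
    also have "inner c z *\<^sub>R (r *\<^sub>R y) = (z $ k - inner (A *v z) y) *\<^sub>R y" using r by (simp add: cz)
    also have "A *v z + \<dots> = P (A *v z) + z $ k *\<^sub>R y" by (simp add: P_def scaleR_diff_left)
    also have "P (A *v z) = P (A *v z')"
      using y1 by (simp add: P_def z'_def matrix_vector_mult_diff_distrib matrix_vector_mult_scaleR Ak
          inner_diff_left dot_square_norm algebra_simps)
    finally have eq: "(A ** S) *v z = P (A *v z') + z $ k *\<^sub>R y" .
    have Py: "inner (P x) y = 0" "inner y (P x) = 0" for x
      using y1 by (simp_all add: P_def inner_diff_left inner_diff_right dot_square_norm inner_commute)
    have Pn: "(norm (P x))\<^sup>2 \<le> (norm x)\<^sup>2" for x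
    proof -
      have "(norm (P x))\<^sup>2 = (norm x)\<^sup>2 - (inner x y)\<^sup>2"
        unfolding power2_norm_eq_inner using y1
        by (simp add: P_def inner_diff_left inner_diff_right power2_eq_square inner_commute[of y x] yy)
      then show ?thesis by simp
    qed
    have "(norm ((A ** S) *v z))\<^sup>2 = (norm (P (A *v z')))\<^sup>2 + (z $ k)\<^sup>2"
      unfolding power2_norm_eq_inner eq using y1
      by (simp add: inner_add_left inner_add_right Py yy power2_eq_square)
    also have "\<dots> \<le> (norm (A *v z'))\<^sup>2 + (z $ k)\<^sup>2" using Pn by simp
    also have "\<dots> \<le> (norm z')\<^sup>2 + (z $ k)\<^sup>2" using A[of z'] by (simp add: power_mono)
    also have "\<dots> = (norm z)\<^sup>2" by (simp add: zz)
    finally show ?thesis by (simp add: power2_le_iff_abs_le)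
  qed
  then have "\<bar>det (A ** S)\<bar> \<le> 1" by (rule det_contraction_le_1)
  then show ?thesis using r by (simp add: det_mul detS r_def abs_mult field_simps)
qed

text \<open>A rotation moves \<open>x\<close> to a coordinate axis.\<close>

lemma det_contraction_le:
  fixes A :: "real ^ 'n ^ 'n"
  assumes A: "\<And>x. norm (A *v x) \<le> norm x"
  shows "\<bar>det A\<bar> * norm x \<le> norm (A *v x)"
proof (cases "x = 0")
  case False
  define u where "u = (1 / norm x) *\<^sub>R x"
  have u: "norm u = 1" "x = norm x *\<^sub>R u" using False by (simp_all add: u_def)
  obtain R k where R: "orthogonal_matrix R" "R *v axis k 1 = u"
    using orthogonal_matrix_exists_basis[OF u(1)] by metis
  have "norm ((A ** R) *v z) \<le> norm z" for z
  proof -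
    have "norm (R *v z) = norm z"
      using R(1) orthogonal_transformation_matrix[of "(*v) R"] orthogonal_transformation_norm[of "(*v) R"]
          by simp
    then show ?thesis using A[of "R *v z"] by (simp add: matrix_vector_mul_assoc)
  qed
  from det_contraction_le_axis[OF this, of k] have "\<bar>det (A ** R)\<bar> \<le> norm (A *v u)"
    by (simp add: matrix_vector_mul_assoc[symmetric] R(2))
  moreover have "\<bar>det (A ** R)\<bar> = \<bar>det A\<bar>" using det_orthogonal_matrix[OF R(1)] by (auto simp: det_mul)
  ultimately have "\<bar>det A\<bar> * norm x \<le> norm (A *v u) * norm x" by (simp add: mult_right_mono)
  also have "\<dots> = norm (A *v (norm x *\<^sub>R u))" by (simp add: matrix_vector_mult_scaleR)
  finally show ?thesis by (simp only: u(2)[symmetric])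
qed simp

section \<open>Derivatives of the logarithm of a determinant\<close>

text \<open>The inverse matrix through determinants, so that its entries are smooth functions of a
  smooth matrix.\<close>

definition cramer_inverse :: "real ^ 'n ^ 'n \<Rightarrow> real ^ 'n ^ 'n" where
  "cramer_inverse M = (\<chi> k i. det (\<chi> r l. if l = k then axis i 1 $ r else M $ r $ l) * inverse (det M))"

lemma cramer_inverse:
  assumes "det M \<noteq> 0"
  shows "M ** cramer_inverse M = mat 1" "cramer_inverse M ** M = mat 1"
proof -
  show 1: "M ** cramer_inverse M = mat 1"
  proof -
    have "M *v column i (cramer_inverse M) = axis i 1" for i
      unfolding cramer[OF assms] by (simp add: column_def cramer_inverse_def divide_inverse)
    then have "(M *v column i (cramer_inverse M)) $ r = axis i 1 $ r" for i r by simp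
    then show ?thesis
      by (simp add: vec_eq_iff matrix_matrix_mult_def matrix_vector_mult_def column_def mat_def axis_def)
  qed
  then show "cramer_inverse M ** M = mat 1" using matrix_left_right_inverse by blast
qed

text \<open>Write the new row as a combination of the rows of \<open>M\<close>; the coefficients are its product with
  the inverse.\<close>

lemma det_replace_row:
  assumes "det M \<noteq> 0"
  shows "det (\<chi> i. if i = k then x else M $ i) = (\<Sum>l\<in>UNIV. x $ l * cramer_inverse M $ l $ k) * det M"
proof -
  let ?y = "x v* cramer_inverse M"
  have "?y v* M = x"
    by (simp add: vector_matrix_mul_assoc cramer_inverse(2)[OF assms])
  then have "(\<chi> i. if i = k then (\<Sum>i\<in>UNIV. ?y $ i *s row i M) else row i M) = (\<chi> i. if i = k then x else M
      $ i)"
    unfolding row_combination by (simp add: vec_eq_iff row_def)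
  then show ?thesis
    using cramer_lemma_transpose[of k ?y M] by (simp add: vector_matrix_mult_def mult.commute)
qed

context spacelike_immersion begin

lemma smooth_fun_inverse:
  fixes f :: "'p \<Rightarrow> real"
  assumes "smooth_fun f" "\<And>p. f p \<noteq> 0"
  shows "smooth_fun (\<lambda>p. inverse (f p))"
  using assms smooth_on_inverse[OF chart_homeomorphism(2)] by (fastforce simp: smooth_fun_def comp_def)

lemma smooth_fun_prod:
  fixes f :: "'i \<Rightarrow> 'p \<Rightarrow> real"
  shows "finite I \<Longrightarrow> (\<And>i. i \<in> I \<Longrightarrow> smooth_fun (f i)) \<Longrightarrow> smooth_fun (\<lambda>p. \<Prod>i\<in>I. f i p)"
  by (induction I rule: finite_induct) (auto simp: smooth_fun_const intro!: smooth_fun_bilinear[OF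
      bounded_bilinear_mult])

lemma D_prod:
  fixes f :: "'i \<Rightarrow> 'p \<Rightarrow> real"
  assumes "finite I" "\<And>i. i \<in> I \<Longrightarrow> smooth_fun (f i)"
  shows "D v (\<lambda>q. \<Prod>i\<in>I. f i q) p = (\<Sum>i\<in>I. \<Prod>j\<in>I. if j = i then D v (f j) p else f j p)"
  using assms
proof (induction I rule: finite_induct)
  case (insert k I)
  have "D v (\<lambda>q. \<Prod>i\<in>insert k I. f i q) p = D v (\<lambda>q. f k q * (\<Prod>i\<in>I. f i q)) p" using insert by simp
  also have "\<dots> = D v (f k) p * (\<Prod>i\<in>I. f i p) + f k p * D v (\<lambda>q. \<Prod>i\<in>I. f i q) p"
    using insert by (intro D_bilinear[OF bounded_bilinear_mult] smooth_fun_prod) auto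
  also have "\<dots> = D v (f k) p * (\<Prod>i\<in>I. f i p) + f k p * (\<Sum>i\<in>I. \<Prod>j\<in>I. if j = i then D v (f j) p else f j p)"
    using insert by simp
  also have "(\<Prod>i\<in>I. f i p) = (\<Prod>j\<in>I. if j = k then D v (f j) p else f j p)"
    using insert by (intro prod.cong) auto
  also have "f k p * (\<Sum>i\<in>I. \<Prod>j\<in>I. if j = i then D v (f j) p else f j p)
      = (\<Sum>i\<in>I. (if k = i then D v (f k) p else f k p) * (\<Prod>j\<in>I. if j = i then D v (f j) p else f j p))"
    unfolding sum_distrib_left using insert by (intro sum.cong) auto
  finally show ?case using insert by simp
qed simp

text \<open>Jacobi's formula. The Leibniz rule differentiates one row at a time.\<close>

lemma D_det:
  fixes M :: "'p \<Rightarrow> real ^ 'k ^ 'k::finite"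
  assumes s: "\<And>i j. smooth_fun (\<lambda>q. M q $ i $ j)" and "det (M p) \<noteq> 0"
  shows "D v (\<lambda>q. det (M q)) p = (\<Sum>i\<in>UNIV. \<Sum>l\<in>UNIV. D v (\<lambda>q. M q $ i $ l) p * cramer_inverse (M p) $ l $
      i) * det (M p)"
proof -
  let ?P = "{\<pi>. \<pi> permutes (UNIV :: 'k set)}"
  let ?d = "\<lambda>i. \<chi> j. D v (\<lambda>q. M q $ i $ j) p"
  have "D v (\<lambda>q. det (M q)) p = (\<Sum>\<pi>\<in>?P. of_int (sign \<pi>) * D v (\<lambda>q. \<Prod>i\<in>UNIV. M q $ i $ \<pi> i) p)"
    unfolding det_def
    by (subst D_sum; (intro smooth_fun_bilinear[OF bounded_bilinear_mult] smooth_fun_const smooth_fun_prod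
        s finite_permutations finite)?)
       (intro sum.cong refl D_linear[OF bounded_linear_mult_right] smooth_fun_prod s finite)
  also have "\<dots> = (\<Sum>\<pi>\<in>?P. \<Sum>i\<in>UNIV. of_int (sign \<pi>) * (\<Prod>j\<in>UNIV. (\<chi> j. if j = i then ?d i else M p $ j) $ j $
      \<pi> j))"
    unfolding D_prod[OF finite s] sum_distrib_left
    by (intro sum.cong refl arg_cong2[of _ _ _ _ "(*)"] prod.cong) auto
  also have "\<dots> = (\<Sum>i\<in>UNIV. det (\<chi> j. if j = i then ?d i else M p $ j))"
    unfolding det_def by (rule sum.swap)
  finally show ?thesis
    by (simp add: det_replace_row[OF assms(2)] sum_distrib_right)
qed

lemma smooth_fun_cramer_inverse:
  fixes M :: "'p \<Rightarrow> real ^ 'k ^ 'k::finite"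
  assumes s: "\<And>i j. smooth_fun (\<lambda>q. M q $ i $ j)" and d: "\<And>q. det (M q) \<noteq> 0"
  shows "smooth_fun (\<lambda>q. cramer_inverse (M q) $ k $ i)"
  unfolding cramer_inverse_def vec_lambda_beta
proof (intro smooth_fun_bilinear[OF bounded_bilinear_mult] smooth_fun_inverse smooth_fun_det s d)
  show "smooth_fun (\<lambda>p. (\<chi> r l. if l = k then axis i 1 $ r else M p $ r $ l) $ r $ l)" for r l
    using s by (cases "l = k") (simp_all add: smooth_fun_const)
qed

lemma D_ln_det:
  fixes M :: "'p \<Rightarrow> real ^ 'k ^ 'k::finite"
  assumes s: "\<And>i j. smooth_fun (\<lambda>q. M q $ i $ j)" and pos: "\<And>q. det (M q) > 0"
  shows "D v (\<lambda>q. ln (det (M q))) p = (\<Sum>i\<in>UNIV. \<Sum>l\<in>UNIV. D v (\<lambda>q. M q $ i $ l) p * cramer_inverse (M p) $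
      l $ i)"
proof -
  have "D v (\<lambda>q. ln (det (M q))) p = inverse (det (M p)) * D v (\<lambda>q. det (M q)) p"
    using pos[of p] by (intro D_chain_real smooth_fun_det s) (auto intro!: derivative_eq_intros simp:
        field_simps)
  then show ?thesis using D_det[OF s, of p v] pos[of p] by simp
qed

lemma cramer_inverse_mat_1: "cramer_inverse (mat 1) = mat 1"
  using cramer_inverse(1)[of "mat 1"] by simp

lemma D_ln_det_identity:
  fixes M :: "'p \<Rightarrow> real ^ 'k ^ 'k::finite"
  assumes s: "\<And>i j. smooth_fun (\<lambda>q. M q $ i $ j)" and pos: "\<And>q. det (M q) > 0" and M: "M p = mat 1"
  shows "D v (\<lambda>q. ln (det (M q))) p = (\<Sum>i\<in>UNIV. D v (\<lambda>q. M q $ i $ i) p)"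
  unfolding D_ln_det[OF s pos] M cramer_inverse_mat_1 by (simp add: mat_def if_distrib cong: if_cong)

text \<open>Differentiate Jacobi's formula once more; where \<open>M\<close> is the identity, the derivative of its
  inverse is \<open>- D v M\<close>.\<close>

lemma D_D_ln_det_identity:
  fixes M :: "'p \<Rightarrow> real ^ 'k ^ 'k::finite"
  assumes s: "\<And>i j. smooth_fun (\<lambda>q. M q $ i $ j)" and pos: "\<And>q. det (M q) > 0" and M: "M p = mat 1"
  shows "D v (D v (\<lambda>q. ln (det (M q)))) p = (\<Sum>i\<in>UNIV. D v (D v (\<lambda>q. M q $ i $ i)) p)
     - (\<Sum>i\<in>UNIV. \<Sum>l\<in>UNIV. D v (\<lambda>q. M q $ i $ l) p * D v (\<lambda>q. M q $ l $ i) p)"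
proof -
  let ?N = "\<lambda>q. cramer_inverse (M q)"
  have nz: "det (M q) \<noteq> 0" for q using pos[of q] by simp
  have sN: "smooth_fun (\<lambda>q. ?N q $ k $ i)" for k i by (rule smooth_fun_cramer_inverse[OF s nz])
  have DN: "D v (\<lambda>q. ?N q $ r $ i) p = - D v (\<lambda>q. M q $ r $ i) p" for r i
  proof -
    have "(\<lambda>q. \<Sum>k\<in>UNIV. M q $ r $ k * ?N q $ k $ i) = (\<lambda>q. mat 1 $ r $ i)"
      using cramer_inverse(1)[OF nz] by (simp add: matrix_matrix_mult_def vec_eq_iff)
    then have "D v (\<lambda>q. \<Sum>k\<in>UNIV. M q $ r $ k * ?N q $ k $ i) p = 0" by simp
    then have "(\<Sum>k\<in>UNIV. D v (\<lambda>q. M q $ r $ k) p * ?N p $ k $ i + M p $ r $ k * D v (\<lambda>q. ?N q $ k $ i) p)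
        = 0"
      by (subst (asm) D_sum) (simp_all add: smooth_fun_bilinear[OF bounded_bilinear_mult] s sN
          D_bilinear[OF bounded_bilinear_mult])
    then show ?thesis
      by (simp add: M cramer_inverse_mat_1 sum.distrib) (simp add: mat_def if_distrib if_distribR cong:
          if_cong)
  qed
  have "D v (\<lambda>q. ln (det (M q))) = (\<lambda>q. \<Sum>i\<in>UNIV. \<Sum>l\<in>UNIV. D v (\<lambda>q. M q $ i $ l) q * ?N q $ l $ i)"
    by (rule ext) (rule D_ln_det[OF s pos])
  then have "D v (D v (\<lambda>q. ln (det (M q)))) p
     = (\<Sum>i\<in>UNIV. \<Sum>l\<in>UNIV. D v (\<lambda>q. D v (\<lambda>q. M q $ i $ l) q * ?N q $ l $ i) p)"
    by (simp add: D_sum smooth_fun_sum smooth_fun_bilinear[OF bounded_bilinear_mult] s sN smooth_fun_D)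
  also have "\<dots> = (\<Sum>i\<in>UNIV. \<Sum>l\<in>UNIV. D v (D v (\<lambda>q. M q $ i $ l)) p * mat 1 $ l $ i
       - D v (\<lambda>q. M q $ i $ l) p * D v (\<lambda>q. M q $ l $ i) p)"
    by (simp add: D_bilinear[OF bounded_bilinear_mult] s sN smooth_fun_D DN M cramer_inverse_mat_1)
  finally show ?thesis
    by (simp add: sum_subtractf) (simp add: mat_def if_distrib cong: if_cong)
qed

end

section \<open>The w-function\<close>

context spacelike_immersion begin

lemma normal_nonpos: "T p v = 0 \<Longrightarrow> pinner v v \<le> 0"
  by (simp add: normal_parseval[of p v v] sum_nonneg)

lemma normal_Cauchy_Schwarz:
  assumes "T p u = 0" "T p v = 0"
  shows "(pinner u v)\<^sup>2 \<le> pinner u u * pinner v v"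
proof -
  let ?u = "\<lambda>\<alpha>. pinner u (ne p \<alpha>)" and ?v = "\<lambda>\<alpha>. pinner v (ne p \<alpha>)"
  have "(\<Sum>\<alpha>\<in>UNIV. ?u \<alpha> * ?v \<alpha>)\<^sup>2 \<le> (\<Sum>\<alpha>\<in>UNIV. (?u \<alpha>)\<^sup>2) * (\<Sum>\<alpha>\<in>UNIV. (?v \<alpha>)\<^sup>2)"
    by (rule Cauchy_Schwarz_ineq_sum)
  then show ?thesis
    by (simp add: normal_parseval[OF assms(1), of v] normal_parseval[OF assms(1), of u] normal_parseval[OF
        assms(2), of v] power2_eq_square)
qed

definition frame_matrix :: "('n \<Rightarrow> ('n, 'm) pseudo_space) \<Rightarrow> ('n \<Rightarrow> ('n, 'm) pseudo_space) \<Rightarrow> real ^ 'n ^ 'n"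
    where
  "frame_matrix e a = (\<chi> i j. pinner (e i) (a j))"

definition gram :: "('n \<Rightarrow> ('n, 'm) pseudo_space) \<Rightarrow> 'p \<Rightarrow> real ^ 'n ^ 'n" where
  "gram a q = (\<chi> i j. pinner (T q (a i)) (a j))"

text \<open>Parseval for the tangential parts of the vectors \<open>a i\<close>.\<close>

lemma gram_frame_matrix:
  assumes "orthonormal_basis 1 (tangent_space \<A> F q) e"
  shows "gram a q = transpose (frame_matrix e a) ** frame_matrix e a"
proof -
  have e: "\<And>i j. pinner (e i) (e j) = (if i = j then 1 else 0)" "span (range e) = tangent_space \<A> F q"
    using assms by (auto simp: orthonormal_basis_def)
  have Te: "T q (e k) = e k" for k using e(2) span_base[of "e k" "range e"] by (auto simp:
      tangent_space_iff)
  have "pinner (T q u) v = (\<Sum>k\<in>UNIV. pinner (e k) u * pinner (e k) v)" for u v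
  proof -
    have "T q u \<in> span (range e)" using e(2) T_in by simp
    from orthonormal_span_eq[OF e(1) _ this] have "T q u = (\<Sum>k\<in>UNIV. pinner (T q u) (e k) *\<^sub>R e k)" by simp
    also have "\<dots> = (\<Sum>k\<in>UNIV. pinner (e k) u *\<^sub>R e k)" by (simp add: pinner_T Te pinner_commute[of u])
    finally show ?thesis by (simp add: pinner.sum_left pinner.scaleR_left)
  qed
  then show ?thesis by (simp add: gram_def frame_matrix_def vec_eq_iff matrix_matrix_mult_def
      transpose_def)
qed

lemma det_gram_square:
  "orthonormal_basis 1 (tangent_space \<A> F q) e \<Longrightarrow> det (gram a q) = (det (frame_matrix e a))\<^sup>2"
  by (simp add: gram_frame_matrix det_mul det_transpose power2_eq_square)

lemma tan_frame_orthonormal_basis: "orthonormal_basis 1 (tangent_space \<A> F q) (te q)"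
  using frame_adapted[of q] by (simp add: adapted_frame_def)

context
  fixes a :: "'n \<Rightarrow> ('n, 'm) pseudo_space"
  assumes a: "\<And>i j. pinner (a i) (a j) = (if i = j then 1 else 0)"
begin

lemma pinner_combination: "pinner (\<Sum>j\<in>UNIV. x $ j *\<^sub>R a j) (\<Sum>j\<in>UNIV. x $ j *\<^sub>R a j) = (norm x)\<^sup>2"
  by (simp add: pinner.sum_right pinner.scaleR_right orthonormal_sum_coefficient[OF a]
      power2_norm_eq_inner inner_vec_def)

text \<open>A vector of the plane spanned by \<open>a\<close> that is orthogonal to all of \<open>e\<close> is normal, hence has
  non-positive square; but this square is \<open>|x|\<^sup>2\<close>.\<close>

lemma det_frame_matrix_nonzero: "det (frame_matrix (te q) a) \<noteq> 0"
proof -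
  let ?W = "frame_matrix (te q) a"
  have "x = 0" if "?W *v x = 0" for x
  proof -
    let ?v = "\<Sum>j\<in>UNIV. x $ j *\<^sub>R a j"
    have "pinner (te q i) ?v = (?W *v x) $ i" for i
      by (simp add: frame_matrix_def matrix_vector_mult_def pinner.sum_right pinner.scaleR_right
          mult.commute)
    then have "pinner ?v (te q i) = 0" for i using that pinner_commute[of ?v] by simp
    then have "T q ?v = 0" using T_expansion[of q ?v] by simp
    then have "(norm x)\<^sup>2 \<le> 0" using normal_nonpos[of q ?v] by (simp only: pinner_combination)
    then show "x = 0" by simp
  qed
  then have "invertible ?W" using matrix_left_invertible_ker[of ?W] invertible_left_inverse[of ?W] by
      blast
  then show ?thesis using invertible_det_nz by blast
qed

lemma det_gram_pos: "det (gram a q) > 0"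
  using det_frame_matrix_nonzero by (simp add: det_gram_square[OF tan_frame_orthonormal_basis])

text \<open>The squares of the determinants in the definition do not depend on the frame; if the
  determinant of one frame is negative, reversing one of its vectors makes it positive.\<close>

lemma w_function_eq: "w_function \<A> F a q = sqrt (det (gram a q))"
  unfolding w_function_def
proof (rule the_equality)
  fix r assume "0 < r \<and> (\<exists>e :: 'n \<Rightarrow> _. orthonormal_basis 1 (tangent_space \<A> F q) e \<and> r = det (\<chi> i j.
      pinner (e i) (a j)))"
  then obtain e :: "'n \<Rightarrow> _" where e: "r > 0" "orthonormal_basis 1 (tangent_space \<A> F q) e" "r = det
      (frame_matrix e a)"
    by (auto simp: frame_matrix_def)
  then show "r = sqrt (det (gram a q))" by (simp add: det_gram_square[OF e(2)])
next
  let ?e = "te q"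
  let ?d = "det (frame_matrix ?e a)"
  obtain k :: 'n where True by blast
  define e where "e = (\<lambda>i. (if i = k then sgn ?d else 1) *\<^sub>R ?e i)"
  have s: "sgn ?d * sgn ?d = 1" using det_frame_matrix_nonzero[of q] by (simp add: sgn_if)
  have ee: "pinner (e i) (e j) = (if i = j then 1 else 0)" for i j
    using s by (simp add: e_def pinner.scaleR_left pinner.scaleR_right frame_orthonormal)
  have "span (range e) \<subseteq> tangent_space \<A> F q"
  proof (rule span_minimal[OF _ tangent_space_spacelike(1)])
    show "range e \<subseteq> tangent_space \<A> F q"
      by (auto simp: e_def tangent_space_iff blinfun.scaleR_right)
  qed
  moreover have "dim (span (range e)) = dim (tangent_space \<A> F q)"
    using orthonormal_independent(3)[OF ee] tangent_space_spacelike(2) by simp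
  ultimately have "span (range e) = tangent_space \<A> F q"
    by (intro subspace_dim_equal[OF subspace_span tangent_space_spacelike(1)]) auto
  with ee have ob: "orthonormal_basis 1 (tangent_space \<A> F q) e" by (simp add: orthonormal_basis_def)
  have "frame_matrix e a = (\<chi> i. if i = k then sgn ?d *s frame_matrix ?e a $ i else frame_matrix ?e a $
      i)"
    by (simp add: frame_matrix_def e_def vec_eq_iff pinner.scaleR_left)
  then have "det (frame_matrix e a) = sgn ?d * ?d"
    using det_row_mul[of k "sgn ?d" "\<lambda>i. frame_matrix ?e a $ i" "\<lambda>i. frame_matrix ?e a $ i"] by simp
  then have "det (frame_matrix e a) = \<bar>?d\<bar>" by (simp add: abs_sgn mult.commute)
  then have "sqrt (det (gram a q)) = det (frame_matrix e a)"
    by (simp add: det_gram_square[OF tan_frame_orthonormal_basis])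
  then show "0 < sqrt (det (gram a q)) \<and> (\<exists>e :: 'n \<Rightarrow> _. orthonormal_basis 1 (tangent_space \<A> F q) e \<and> sqrt
      (det (gram a q)) = det (\<chi> i j. pinner (e i) (a j)))"
    using ob real_sqrt_gt_zero[OF det_gram_pos[of q]] by (intro conjI exI[of _ e]) (simp_all only:
        frame_matrix_def)
qed

end

lemma drift_lap_const: "drift_lap (\<lambda>q. k) p = 0"
proof -
  have "D v (\<lambda>q. k) = (\<lambda>q. 0)" for v by (rule ext) simp
  then show ?thesis by (simp add: drift_lap_def lap_def)
qed

end

context spacelike_shrinker begin

text \<open>The matrix is the identity at \<open>p\<close>. Writing \<open>b i = e i + n i\<close>, the terms with \<open>\<L> T\<close> give
  \<open>2 |B|\<^sup>2\<close> and the sum of the squares \<open>\<langle>B\<^sub>k\<^sub>i, n\<^sub>l\<rangle>\<^sup>2\<close>, which cancels the squares in the second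
  derivative of the determinant; the cross terms remain.\<close>

lemma drift_lap_ln_det:
  fixes b :: "'n \<Rightarrow> ('n, 'm) pseudo_space" and p :: 'p
  defines "M \<equiv> gram b" and "n \<equiv> \<lambda>i. b i - te p i"
  assumes b: "\<And>i. T p (b i) = te p i" and pos: "\<And>q. det (M q) > 0"
  shows "drift_lap (\<lambda>q. ln (det (M q))) p = 2 * normsq_B \<A> F p
     - 2 * (\<Sum>k\<in>UNIV. \<Sum>i\<in>UNIV. \<Sum>l\<in>UNIV. pinner (B_frame \<A> F p k i) (n l) * pinner (B_frame \<A> F p k l) (n
         i))"
proof -
  let ?e = "te p" and ?B = "B_frame \<A> F p"
  define c where "c = (\<lambda>k i l. pinner (?B k i) (n l))"
  have bn: "b i = ?e i + n i" for i by (simp add: n_def)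
  have Tn: "T p (n i) = 0" for i by (simp add: n_def blinfun.diff_right b)
  have M1: "M p = mat 1"
    by (simp add: M_def gram_def vec_eq_iff mat_def b)
       (simp add: bn pinner.add_right frame_orthonormal pinner_tangent_normal[OF T_frame(1) Tn])
  have Mij: "(\<lambda>q. M q $ i $ j) = (\<lambda>q. pinner (T q (b i)) (b j))" for i j by (simp add: M_def gram_def)
  have sM: "smooth_fun (\<lambda>q. M q $ i $ j)" for i j
    unfolding Mij by (intro smooth_fun_linear[OF pinner.bounded_linear_left] smooth_fun_apply smooth_fun_T
        smooth_fun_const)
  have DM: "D v (\<lambda>q. M q $ i $ j) = (\<lambda>q. pinner (D v T q (b i)) (b j))" for v i j
    unfolding Mij
    by (rule ext) (simp add: D_linear[OF pinner.bounded_linear_left] smooth_fun_apply smooth_fun_T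
        smooth_fun_const D_apply_const)
  have DDM: "D v (D v (\<lambda>q. M q $ i $ j)) p = pinner (D v (D v T) p (b i)) (b j)" for v i j
    unfolding DM by (simp add: D_linear[OF pinner.bounded_linear_left] smooth_fun_apply smooth_fun_DT
        smooth_fun_const D_apply_const)
  have m: "pinner (shape p k (b i)) (b l) = c k i l + c k l i" for k i l
  proof -
    have 1: "pinner (?B k i) (?e l) = 0"
      using pinner_tangent_normal[OF T_frame(1) T_B_frame, of p l k i] pinner_commute[of "?B k i"] by simp
    have 2: "pinner (shape p k (n i)) (n l) = 0" by (rule pinner_tangent_normal[OF DT_normal[OF Tn] Tn])
    have 3: "pinner (shape p k (n i)) (?e l) = c k l i"
      unfolding c_def B_frame_eq DT_selfadjoint[of _ p "n i"] by (rule pinner_commute)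
    have "shape p k (b i) = ?B k i + shape p k (n i)" by (simp add: bn blinfun.add_right B_frame_eq)
    then show ?thesis by (simp add: bn[of l] pinner.add_left pinner.add_right 1 2 3) (simp add: c_def)
  qed
  have Qn: "pinner (Q p (n i)) (n i) = (\<Sum>k\<in>UNIV. \<Sum>l\<in>UNIV. (c k l i)\<^sup>2)" for i
  proof -
    have "pinner (shape p k (shape p k (n i))) (n i) = (\<Sum>l\<in>UNIV. (c k l i)\<^sup>2)" for k
    proof -
      have "pinner (shape p k (n i)) (?e l) = c k l i" for l
        unfolding c_def B_frame_eq DT_selfadjoint[of _ p "n i"] by (rule pinner_commute)
      moreover have "pinner (shape p k (shape p k (n i))) (n i) = pinner (shape p k (n i)) (shape p k (n
          i))"
        by (rule DT_selfadjoint)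
      ultimately show ?thesis
        using tangent_parseval[OF DT_normal[OF Tn], of "?e k" i "shape p k (n i)"] by (simp add:
            power2_eq_square)
    qed
    then show ?thesis by (simp add: Q_apply pinner.sum_left)
  qed
  have Qe: "(\<Sum>i\<in>UNIV. pinner (Q p (?e i)) (?e i)) = - normsq_B \<A> F p"
  proof -
    have "pinner (shape p k (shape p k (?e i))) (?e i) = pinner (?B k i) (?B k i)" for k i
      unfolding B_frame_eq by (rule DT_selfadjoint)
    then have "(\<Sum>i\<in>UNIV. pinner (Q p (?e i)) (?e i)) = (\<Sum>i\<in>UNIV. \<Sum>k\<in>UNIV. pinner (?B k i) (?B k i))"
      by (simp add: Q_apply pinner.sum_left)
    also have "\<dots> = (\<Sum>k\<in>UNIV. \<Sum>i\<in>UNIV. pinner (?B k i) (?B k i))" by (rule sum.swap)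
    finally show ?thesis by (simp add: normsq_B_def)
  qed
  have LT: "pinner (drift_lap T p (b i)) (b i) = 2 * pinner (Q p (n i)) (n i) - 2 * pinner (Q p (?e i))
      (?e i)" for i
  proof -
    have L: "drift_lap T p (b i) = 2 *\<^sub>R Q p (n i) - 2 *\<^sub>R Q p (?e i)"
    proof -
      have "drift_lap T p (b i) = 2 *\<^sub>R Q p (?e i + n i) - (2 *\<^sub>R Q p (?e i) + 2 *\<^sub>R Q p (?e i))"
        by (simp add: drift_lap_T b bn[symmetric] flip: scaleR_add_left)
      then show ?thesis by (simp add: blinfun.add_right scaleR_add_right)
    qed
    have 1: "pinner (Q p (?e i)) (n i) = 0"
      by (rule pinner_tangent_normal[OF _ Tn]) (simp add: Q_T)
    have 2: "pinner (Q p (n i)) (?e i) = 0"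
      using 1 Q_selfadjoint[of p "n i" "?e i"] pinner_commute[of "n i"] by simp
    show ?thesis unfolding L unfolding bn[of i] by (simp add: pinner.diff_left pinner.add_right
        pinner.scaleR_left 1 2)
  qed
  have s: "smooth_fun (\<lambda>q. ln (det (M q)))" by (intro smooth_fun_ln smooth_fun_det sM pos)
  have "drift_lap (\<lambda>q. ln (det (M q))) p
     = (\<Sum>k\<in>UNIV. (\<Sum>i\<in>UNIV. pinner (D (?e k) (D (?e k) T) p (b i)) (b i))
          - (\<Sum>i\<in>UNIV. \<Sum>l\<in>UNIV. (c k i l + c k l i) * (c k l i + c k i l)))
       - (1 / 2) * (\<Sum>i\<in>UNIV. pinner (D (F p) T p (b i)) (b i))"
    unfolding drift_lap_def lap_frame[OF s] D_D_ln_det_identity[OF sM pos M1] D_ln_det_identity[OF sM pos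
        M1] DDM
    unfolding DM m by simp
  also have "\<dots> = (\<Sum>i\<in>UNIV. pinner (drift_lap T p (b i)) (b i))
       - (\<Sum>k\<in>UNIV. \<Sum>i\<in>UNIV. \<Sum>l\<in>UNIV. (c k i l + c k l i) * (c k l i + c k i l))"
  proof -
    have "(\<Sum>k\<in>UNIV. \<Sum>i\<in>UNIV. pinner (D (?e k) (D (?e k) T) p (b i)) (b i)) = (\<Sum>i\<in>UNIV. pinner (lap T p (b
        i)) (b i))"
      by (subst sum.swap) (simp add: lap_frame smooth_fun_T blinfun.sum_left pinner.sum_left)
    then show ?thesis
      by (simp add: drift_lap_def blinfun.diff_left blinfun.scaleR_left pinner.diff_left
          pinner.scaleR_left sum_subtractf sum_divide_distrib)
  qed
  also have "(\<Sum>i\<in>UNIV. pinner (drift_lap T p (b i)) (b i))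
      = 2 * (\<Sum>i\<in>UNIV. \<Sum>k\<in>UNIV. \<Sum>l\<in>UNIV. (c k l i)\<^sup>2) + 2 * normsq_B \<A> F p"
  proof -
    have "(\<Sum>i\<in>UNIV. pinner (drift_lap T p (b i)) (b i))
      = 2 * (\<Sum>i\<in>UNIV. pinner (Q p (n i)) (n i)) - 2 * (\<Sum>i\<in>UNIV. pinner (Q p (?e i)) (?e i))"
      unfolding LT by (simp add: sum_subtractf sum_distrib_left)
    then show ?thesis unfolding Qe Qn by simp
  qed
  also have "(\<Sum>i\<in>UNIV. \<Sum>k\<in>UNIV. \<Sum>l\<in>UNIV. (c k l i)\<^sup>2) = (\<Sum>k\<in>UNIV. \<Sum>i\<in>UNIV. \<Sum>l\<in>UNIV. (c k l i)\<^sup>2)"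
    by (rule sum.swap)
  also have "(\<Sum>k\<in>UNIV. \<Sum>i\<in>UNIV. \<Sum>l\<in>UNIV. (c k i l + c k l i) * (c k l i + c k i l))
     = 2 * (\<Sum>k\<in>UNIV. \<Sum>i\<in>UNIV. \<Sum>l\<in>UNIV. (c k l i)\<^sup>2) + 2 * (\<Sum>k\<in>UNIV. \<Sum>i\<in>UNIV. \<Sum>l\<in>UNIV. c k i l * c k l i)"
  proof -
    have "(\<Sum>i\<in>UNIV. \<Sum>l\<in>UNIV. (c k i l)\<^sup>2) = (\<Sum>i\<in>UNIV. \<Sum>l\<in>UNIV. (c k l i)\<^sup>2)" for k by (rule sum.swap)
    moreover have "(c k i l + c k l i) * (c k l i + c k i l) = (c k i l)\<^sup>2 + (c k l i)\<^sup>2 + 2 * (c k i l * c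
        k l i)" for k i l
      by (simp add: power2_eq_square algebra_simps)
    ultimately show ?thesis by (simp add: sum.distrib sum_distrib_left[symmetric])
  qed
  finally show ?thesis by (simp add: c_def)
qed

theorem drift_laplacian_ln_w:
  assumes a: "\<And>i j. pinner (a i) (a j) = (if i = j then 1 else 0)"
  shows "drift_laplacian \<A> F (\<lambda>q. ln (w_function \<A> F a q)) p \<ge> normsq_B \<A> F p / (w_function \<A> F a p)\<^sup>2"
proof -
  let ?e = "te p" and ?B = "B_frame \<A> F p"
  define W where "W = frame_matrix ?e a"
  define X where "X = cramer_inverse W"
  \<comment> \<open>The basis of the plane whose tangential parts form the orthonormal frame at \<open>p\<close>.\<close>
  define b where "b = (\<lambda>i. \<Sum>l\<in>UNIV. X $ l $ i *\<^sub>R a l)"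
  define n where "n = (\<lambda>i. b i - ?e i)"
  define d where "d = (det X)\<^sup>2"
  have W0: "det W \<noteq> 0" unfolding W_def by (rule det_frame_matrix_nonzero[OF a])
  have WX: "W ** X = mat 1" unfolding X_def by (rule cramer_inverse(1)[OF W0])
  have dWX: "det W * det X = 1" using arg_cong[OF WX, of det] by (simp add: det_mul)
  have eb: "pinner (b i) (?e k) = (if k = i then 1 else 0)" for i k
  proof -
    have "pinner (?e k) (b i) = (W ** X) $ k $ i"
      by (simp add: b_def W_def frame_matrix_def matrix_matrix_mult_def pinner.sum_right
          pinner.scaleR_right mult.commute)
    then show ?thesis by (simp add: WX mat_def pinner_commute[of "b i"])
  qed
  have Tb: "T p (b i) = ?e i" for i
    unfolding T_expansion eb by (simp add: if_distribR if_distrib[of "\<lambda>r. r *\<^sub>R _"] cong: if_cong)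
  have Tn: "T p (n i) = 0" for i by (simp add: n_def blinfun.diff_right Tb)
  have gram_b: "gram b q = transpose X ** gram a q ** X" for q
    by (simp add: vec_eq_iff gram_def b_def matrix_matrix_mult_def transpose_def blinfun.sum_right
        blinfun.scaleR_right
        pinner.sum_left pinner.sum_right pinner.scaleR_left pinner.scaleR_right sum_distrib_left
            sum_distrib_right mult_ac)
       (intro allI sum.swap)?
  have det_gram_b: "det (gram b q) = d * det (gram a q)" for q
    by (simp add: gram_b det_mul det_transpose d_def power2_eq_square)
  have d: "d > 0" using dWX by (auto simp: d_def)
  have posb: "det (gram b q) > 0" for q by (simp add: det_gram_b d det_gram_pos[OF a])
  have sb: "smooth_fun (\<lambda>q. ln (det (gram b q)))"
    by (intro smooth_fun_ln smooth_fun_det posb)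
       (simp add: gram_def smooth_fun_linear[OF pinner.bounded_linear_left] smooth_fun_apply smooth_fun_T
           smooth_fun_const)
  have lnw: "(\<lambda>q. ln (w_function \<A> F a q)) = (\<lambda>q. (1 / 2) *\<^sub>R ln (det (gram b q)) + (- ln d / 2))"
  proof
    fix q
    have "ln (det (gram b q)) = ln d + ln (det (gram a q))"
      unfolding det_gram_b using d det_gram_pos[OF a, of q] by (simp add: ln_mult)
    then show "ln (w_function \<A> F a q) = (1 / 2) *\<^sub>R ln (det (gram b q)) + (- ln d / 2)"
      using det_gram_pos[OF a, of q] by (simp add: w_function_eq[OF a] ln_sqrt field_simps)
  qed
  have w2: "(w_function \<A> F a p)\<^sup>2 = 1 / d"
  proof -
    have "(w_function \<A> F a p)\<^sup>2 = (det W)\<^sup>2"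
      using det_gram_pos[OF a, of p] by (simp add: w_function_eq[OF a] W_def det_gram_square[OF
          tan_frame_orthonormal_basis])
    moreover have "(det W)\<^sup>2 * d = 1" using dWX by (simp add: d_def flip: power_mult_distrib)
    ultimately show ?thesis using d by (simp add: field_simps)
  qed
  \<comment> \<open>The vectors \<open>a\<close> are orthonormal, and so are the tangential parts of the \<open>b i\<close>: compare the
    two values of the square of \<open>\<Sum> s\<^sub>i b\<^sub>i\<close>.\<close>
  have norm_X: "(norm (X *v s))\<^sup>2 = (norm s)\<^sup>2 + pinner (\<Sum>i\<in>UNIV. s $ i *\<^sub>R n i) (\<Sum>i\<in>UNIV. s $ i *\<^sub>R n i)" for
      s
  proof -
    let ?z = "\<Sum>i\<in>UNIV. s $ i *\<^sub>R n i" and ?t = "\<Sum>i\<in>UNIV. s $ i *\<^sub>R ?e i"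
    have "(\<Sum>l\<in>UNIV. (X *v s) $ l *\<^sub>R a l) = (\<Sum>i\<in>UNIV. s $ i *\<^sub>R b i)"
      by (simp add: b_def matrix_vector_mult_def scaleR_sum_left scaleR_sum_right mult.commute) (rule
          sum.swap)
    also have "\<dots> = ?t + ?z" by (simp add: n_def scaleR_diff_right sum_subtractf)
    finally have "(norm (X *v s))\<^sup>2 = pinner (?t + ?z) (?t + ?z)"
      using pinner_combination[OF a, of "X *v s"] by simp
    also have "\<dots> = pinner ?t ?t + pinner ?z ?z"
    proof -
      have "pinner ?t ?z = 0" by (rule pinner_tangent_normal[of p]) (simp_all add: blinfun.sum_right
          blinfun.scaleR_right Tn)
      then show ?thesis by (simp add: pinner.add_left pinner.add_right pinner_commute[of ?z ?t])
    qed
    also have "pinner ?t ?t = (norm s)\<^sup>2" by (rule pinner_combination[OF frame_orthonormal(1)])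
    finally show ?thesis .
  qed
  have contr: "norm (X *v s) \<le> norm s" for s
  proof -
    have "T p (\<Sum>i\<in>UNIV. s $ i *\<^sub>R n i) = 0" by (simp add: blinfun.sum_right blinfun.scaleR_right Tn)
    then have "(norm (X *v s))\<^sup>2 \<le> (norm s)\<^sup>2" unfolding norm_X using normal_nonpos by fastforce
    then show ?thesis by (simp add: power2_le_iff_abs_le)
  qed
  have d1: "d \<le> 1" using det_contraction_le_1[OF contr] by (simp add: d_def abs_square_le_1)
  \<comment> \<open>With \<open>s\<^sub>l = \<langle>u, n\<^sub>l\<rangle>\<close> and \<open>z = \<Sum> s\<^sub>l n\<^sub>l\<close> one has \<open>|s|\<^sup>2 = \<langle>u, z\<rangle>\<close>. Apply Cauchy-Schwarz in the
    normal space; \<open>\<langle>z, z\<rangle>\<close> is controlled by \<open>norm_X\<close> and the lower bound for the contraction \<open>X\<close>.\<close>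
  have bound: "(\<Sum>l\<in>UNIV. (pinner u (n l))\<^sup>2) \<le> (1 - d) * - pinner u u" if u: "T p u = 0" for u
  proof -
    define s where "s = (\<chi> l. pinner u (n l))"
    let ?z = "\<Sum>i\<in>UNIV. s $ i *\<^sub>R n i"
    have Tz: "T p ?z = 0" by (simp add: blinfun.sum_right blinfun.scaleR_right Tn)
    have ss: "(norm s)\<^sup>2 = (\<Sum>l\<in>UNIV. (pinner u (n l))\<^sup>2)"
      unfolding power2_norm_eq_inner inner_vec_def by (simp add: s_def power2_eq_square)
    have uz: "pinner u ?z = (norm s)\<^sup>2"
      by (simp add: ss pinner.sum_right pinner.scaleR_right) (simp add: s_def power2_eq_square)
    have "d * (norm s)\<^sup>2 \<le> (norm (X *v s))\<^sup>2"
      using power_mono[OF det_contraction_le[OF contr, of s], of 2] by (simp add: d_def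
          power_mult_distrib)
    then have zz: "- pinner ?z ?z \<le> (1 - d) * (norm s)\<^sup>2" unfolding norm_X by (simp add: algebra_simps)
    have "(norm s)\<^sup>2 * (norm s)\<^sup>2 \<le> (- pinner u u) * (- pinner ?z ?z)"
      using normal_Cauchy_Schwarz[OF u Tz] by (simp add: uz power2_eq_square)
    also have "\<dots> \<le> (- pinner u u) * ((1 - d) * (norm s)\<^sup>2)"
      using normal_nonpos[OF u] by (intro mult_left_mono[OF zz]) simp
    finally have fin: "(norm s)\<^sup>2 * (norm s)\<^sup>2 \<le> ((1 - d) * - pinner u u) * (norm s)\<^sup>2" by (simp add:
        algebra_simps)
    show ?thesis
    proof (cases "s = 0")
      case True
      then have "(\<Sum>l\<in>UNIV. (pinner u (n l))\<^sup>2) = 0" using ss by simp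
      moreover have "0 \<le> (1 - d) * - pinner u u" using d1 normal_nonpos[OF u] by (intro
          mult_nonneg_nonneg) auto
      ultimately show ?thesis by simp
    next
      case False
      then have "(norm s)\<^sup>2 > 0" by simp
      with fin have "(norm s)\<^sup>2 \<le> (1 - d) * - pinner u u" by (rule mult_right_le_imp_le)
      then show ?thesis by (simp only: ss)
    qed
  qed
  let ?c = "\<lambda>k i l. pinner (?B k i) (n l)"
  have "(\<Sum>k\<in>UNIV. \<Sum>i\<in>UNIV. \<Sum>l\<in>UNIV. ?c k i l * ?c k l i)
      \<le> (\<Sum>k\<in>UNIV. \<Sum>i\<in>UNIV. \<Sum>l\<in>UNIV. ((?c k i l)\<^sup>2 + (?c k l i)\<^sup>2) / 2)"
  proof (intro sum_mono)
    fix k i l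
    show "?c k i l * ?c k l i \<le> ((?c k i l)\<^sup>2 + (?c k l i)\<^sup>2) / 2"
      using sum_squares_bound[of "?c k i l" "?c k l i"] by (simp add: mult.assoc)
  qed
  also have "\<dots> = (\<Sum>k\<in>UNIV. \<Sum>i\<in>UNIV. \<Sum>l\<in>UNIV. (?c k i l)\<^sup>2)"
  proof -
    have "(\<Sum>i\<in>UNIV. \<Sum>l\<in>UNIV. (?c k l i)\<^sup>2) = (\<Sum>i\<in>UNIV. \<Sum>l\<in>UNIV. (?c k i l)\<^sup>2)" for k by (rule sum.swap)
    then show ?thesis by (simp add: add_divide_distrib sum.distrib sum_divide_distrib[symmetric])
  qed
  also have "\<dots> \<le> (\<Sum>k\<in>UNIV. \<Sum>i\<in>UNIV. (1 - d) * - pinner (?B k i) (?B k i))"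
    by (intro sum_mono bound T_B_frame)
  also have "\<dots> = (1 - d) * normsq_B \<A> F p"
    by (simp add: normsq_B_def sum_distrib_left sum_negf)
  finally have est: "(\<Sum>k\<in>UNIV. \<Sum>i\<in>UNIV. \<Sum>l\<in>UNIV. ?c k i l * ?c k l i) \<le> (1 - d) * normsq_B \<A> F p" .
  have "smooth_fun (\<lambda>q. ln (w_function \<A> F a q))"
    unfolding lnw by (intro smooth_fun_add smooth_fun_linear[OF bounded_linear_scaleR_right] sb
        smooth_fun_const)
  then have "drift_laplacian \<A> F (\<lambda>q. ln (w_function \<A> F a q)) p = drift_lap (\<lambda>q. ln (w_function \<A> F a q))
      p"
    by (rule drift_laplacian_eq)
  also have "\<dots> = (1 / 2) *\<^sub>R drift_lap (\<lambda>q. ln (det (gram b q))) p"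
    unfolding lnw
    by (subst drift_lap_add; (intro smooth_fun_linear[OF bounded_linear_scaleR_right] sb
        smooth_fun_const)?)
       (simp only: drift_lap_linear[OF bounded_linear_scaleR_right sb] drift_lap_const add_0_right)
  also have "\<dots> = normsq_B \<A> F p - (\<Sum>k\<in>UNIV. \<Sum>i\<in>UNIV. \<Sum>l\<in>UNIV. ?c k i l * ?c k l i)"
    unfolding drift_lap_ln_det[OF Tb posb] n_def by simp
  finally show ?thesis using est d by (simp add: w2 algebra_simps)
qed

end

theorem proposition3p1:
  fixes \<A> :: "('p::{t2_space, second_countable_topology}, 'n::finite) atlas"
    and F :: "('p, 'n, 'm::finite) amb_map"
    and A :: "('n, 'm) pseudo_space set"
    and a :: "'n \<Rightarrow> ('n, 'm) pseudo_space"
  assumes "spacelike_self_shrinker \<A> F"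
    and "0 \<in> range F"
    and "subspace A" and "dim A = CARD('n)" and "spacelike_on A"
    and "orthonormal_basis 1 A a"
  shows "\<forall>p.
     drift_laplacian \<A> F (normsq_B \<A> F) p =
       normsq_B \<A> F p + 2 * normsq_R_perp \<A> F p
       + 2 * (\<Sum>\<alpha>\<in>UNIV. \<Sum>\<beta>\<in>UNIV. (S_coeff \<A> F p \<alpha> \<beta>)\<^sup>2)
       + 2 * normsq_nabla_B \<A> F p \<and>
     drift_laplacian \<A> F (normsq_H \<A> F) p =
       normsq_H \<A> F p + 2 * normsq_P \<A> F p + 2 * normsq_nabla_H \<A> F p \<and>
     drift_laplacian \<A> F (\<lambda>q. ln (w_function \<A> F a q)) p \<ge>
       normsq_B \<A> F p / (w_function \<A> F a p)\<^sup>2"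
proof -
  interpret spacelike_shrinker \<A> F
    by unfold_locales (use assms(1) in \<open>auto simp: spacelike_self_shrinker_def\<close>)
  have "pinner (a i) (a j) = (if i = j then 1 else 0)" for i j
    using assms(6) by (simp add: orthonormal_basis_def)
  then show ?thesis
    by (intro allI conjI drift_laplacian_normsq_B drift_laplacian_normsq_H drift_laplacian_ln_w)
qed

end
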